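(* Let $E$ be the exterior algebra over an infinite field $K$ on $e_1,\dots,e_n$ and $J\subset E$ a graded ideal. Then $J$ is componentwise linear if and only if $\beta^E_i(E/J)=\beta^E_i\big(E/\mathrm{Gin}(J)\big)$ for some $i\ge1$.
   Context: $\beta^E_i(M)=\dim_K\mathrm{Tor}^E_i(K,M)$. $\mathrm{Gin}(J)$ is the generic initial ideal of $J$ with respect to the reverse lexicographic order induced by $e_1>\cdots>e_n$. $J$ is componentwise linear if for every $k$ the ideal $J_{\langle k\rangle}$ generated by all homogeneous elements of $J$ of degree $k$ has a linear resolution, i.e. $\beta^E_{i,i+j}(J_{\langle k\rangle})=0$ for all $i$ and all $j\ne k$. *)

theory Defs
  imports Complex_Main "HOL-Library.Function_Algebras"
begin

section \<open>Exterior algebra E = K<e_1,...,e_n> (indices 0..n-1 stand for e_1..e_n)\<close>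

text \<open>An element of E is a coefficient function on squarefree monomials e_S, S a subset
  of {0..<n}; e_S = e_{s1} wedge ... wedge e_{sk} with s1 < ... < sk.\<close>

type_synonym 'k ext = "nat set \<Rightarrow> 'k"

definition ext_carrier :: "nat \<Rightarrow> 'k::field ext set" where
  "ext_carrier n = {f. \<forall>S. f S \<noteq> 0 \<longrightarrow> S \<subseteq> {..<n}}"

definition ext_sign :: "nat set \<Rightarrow> nat set \<Rightarrow> 'k::field" where
  "ext_sign S R = (-1) ^ card {(s, r). s \<in> S \<and> r \<in> R \<and> r < s}"

text \<open>Product: e_S * e_R = sign * e_(S union R) if S, R disjoint, and 0 otherwise.\<close>
definition ext_mult :: "'k::field ext \<Rightarrow> 'k ext \<Rightarrow> 'k ext" where
  "ext_mult f g = (\<lambda>T. \<Sum>S\<in>Pow T. ext_sign S (T - S) * f S * g (T - S))"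

definition ext_mono :: "nat set \<Rightarrow> 'k::field ext" where
  "ext_mono S = (\<lambda>T. if T = S then 1 else 0)"

definition ext_scale :: "'k::field \<Rightarrow> 'k ext \<Rightarrow> 'k ext" where
  "ext_scale c f = (\<lambda>S. c * f S)"

definition hom_comp :: "nat \<Rightarrow> 'k::field ext \<Rightarrow> 'k ext" where
  "hom_comp k f = (\<lambda>S. if card S = k then f S else 0)"

definition homogeneous :: "nat \<Rightarrow> 'k::field ext \<Rightarrow> bool" where
  "homogeneous k f \<longleftrightarrow> (\<forall>S. f S \<noteq> 0 \<longrightarrow> card S = k)"

text \<open>Two-sided ideal of E (in particular a K-subspace).\<close>
definition ext_ideal :: "nat \<Rightarrow> 'k::field ext set \<Rightarrow> bool" where
  "ext_ideal n I \<longleftrightarrow> I \<subseteq> ext_carrier n \<and> 0 \<in> I \<and>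
     (\<forall>f\<in>I. \<forall>g\<in>I. f + g \<in> I) \<and>
     (\<forall>f\<in>I. \<forall>a\<in>ext_carrier n. ext_mult a f \<in> I \<and> ext_mult f a \<in> I)"

definition graded_ideal :: "nat \<Rightarrow> 'k::field ext set \<Rightarrow> bool" where
  "graded_ideal n I \<longleftrightarrow> ext_ideal n I \<and> (\<forall>f\<in>I. \<forall>k. hom_comp k f \<in> I)"

definition ideal_gen :: "nat \<Rightarrow> 'k::field ext set \<Rightarrow> 'k ext set" where
  "ideal_gen n G = \<Inter>{I. ext_ideal n I \<and> G \<subseteq> I}"

definition comp_ideal :: "nat \<Rightarrow> nat \<Rightarrow> 'k::field ext set \<Rightarrow> 'k ext set" where
  "comp_ideal n k J = ideal_gen n {f \<in> J. homogeneous k f}"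

text \<open>Tor^E_i(K,M) is computed from the Cartan complex (the minimal free resolution of K
  over E, with divided power variables x^(a)):  C_i(M) = direct sum over multi-indices a on
  {0..<n} with |a| = i of M x^(a), differential d(m x^(a)) = sum_j e_j m x^(a - eps_j),
  internal degree deg(m x^(a)) = deg m + |a|.  A chain is a function (a, S) |-> coefficient.
  The module M is given as a subquotient N/L with L \<subseteq> N graded ideals of E
  (M = E/J: N = E, L = J;  M = J: N = J, L = 0).\<close>

type_synonym 'k chain = "(nat \<Rightarrow> nat) \<Rightarrow> nat set \<Rightarrow> 'k"

definition valid_mi :: "nat \<Rightarrow> nat \<Rightarrow> (nat \<Rightarrow> nat) \<Rightarrow> bool" where
  "valid_mi n i a \<longleftrightarrow> (\<forall>j. a j \<noteq> 0 \<longrightarrow> j < n) \<and> (\<Sum>j<n. a j) = i"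

definition chains :: "nat \<Rightarrow> 'k::field ext set \<Rightarrow> nat \<Rightarrow> nat \<Rightarrow> 'k chain set" where
  "chains n N i d = {c. (\<forall>a. c a \<in> N) \<and>
      (\<forall>a S. c a S \<noteq> 0 \<longrightarrow> valid_mi n i a \<and> card S + i = d)}"

definition cartan_diff :: "nat \<Rightarrow> 'k::field chain \<Rightarrow> 'k chain" where
  "cartan_diff n c = (\<lambda>b. \<Sum>j<n. ext_mult (ext_mono {j}) (c (b(j := Suc (b j)))))"

definition vdim :: "('x \<Rightarrow> 'k::field) set \<Rightarrow> nat" where
  "vdim V = vector_space.dim (\<lambda>(c::'k) f. (\<lambda>x. c * f x)) V"

definition cdim :: "'k::field chain set \<Rightarrow> nat" where
  "cdim V = vdim ((\<lambda>c. \<lambda>(a, S). c a S) ` V)"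

text \<open>beta_{i,d}(N/L) = dim_K Tor^E_i(K, N/L)_d = dim of the degree-d part of H_i.\<close>
definition betti_gr :: "nat \<Rightarrow> 'k::field ext set \<Rightarrow> 'k ext set \<Rightarrow> nat \<Rightarrow> nat \<Rightarrow> nat" where
  "betti_gr n N L i d =
     cdim {c \<in> chains n N i d. cartan_diff n c \<in> chains n L (i - 1) d}
   - cdim ({cartan_diff n c + z | c z. c \<in> chains n N (Suc i) d \<and> z \<in> chains n L i d})"

text \<open>Note: for i = 0 the condition on the differential is automatic (the differential of
  a 0-chain vanishes), so the (i - 1) truncation is harmless.  Internal degrees of
  nonzero chains in homological degree i lie in {i..i+n}.\<close>
definition betti :: "nat \<Rightarrow> 'k::field ext set \<Rightarrow> 'k ext set \<Rightarrow> nat \<Rightarrow> nat" where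
  "betti n N L i = (\<Sum>d\<le>i + n. betti_gr n N L i d)"

definition componentwise_linear :: "nat \<Rightarrow> 'k::field ext set \<Rightarrow> bool" where
  "componentwise_linear n J \<longleftrightarrow>
     (\<forall>k i j. j \<noteq> k \<longrightarrow> betti_gr n (comp_ideal n k J) {0} i (i + j) = 0)"

text \<open>On monomials of equal degree: e_S > e_T iff the largest index in the symmetric
  difference lies in T.\<close>
definition revlex_gt :: "nat set \<Rightarrow> nat set \<Rightarrow> bool" where
  "revlex_gt S T \<longleftrightarrow> S \<noteq> T \<and> Max ((S - T) \<union> (T - S)) \<in> T"

definition is_lead :: "'k::field ext \<Rightarrow> nat set \<Rightarrow> bool" where
  "is_lead f S \<longleftrightarrow> f S \<noteq> 0 \<and> (\<forall>T. T \<noteq> S \<and> f T \<noteq> 0 \<longrightarrow> revlex_gt S T)"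

definition in_ideal :: "nat \<Rightarrow> 'k::field ext set \<Rightarrow> 'k ext set" where
  "in_ideal n I = ideal_gen n {ext_mono S | S f k. f \<in> I \<and> homogeneous k f \<and> is_lead f S}"

text \<open>Linear change of coordinates g (an n x n matrix): e_j |-> sum_k g k j e_k,
  extended to an algebra endomorphism of E.\<close>
definition lin_form :: "nat \<Rightarrow> (nat \<Rightarrow> nat \<Rightarrow> 'k::field) \<Rightarrow> nat \<Rightarrow> 'k ext" where
  "lin_form n g j = (\<lambda>T. \<Sum>k<n. if T = {k} then g k j else 0)"

definition ext_act :: "nat \<Rightarrow> (nat \<Rightarrow> nat \<Rightarrow> 'k::field) \<Rightarrow> 'k ext \<Rightarrow> 'k ext" where
  "ext_act n g f = (\<Sum>S\<in>Pow {..<n}.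
      ext_scale (f S) (foldr (\<lambda>j p. ext_mult (lin_form n g j) p)
                          (sorted_list_of_set S) (ext_mono {})))"

definition invertible_mat :: "nat \<Rightarrow> (nat \<Rightarrow> nat \<Rightarrow> 'k::field) \<Rightarrow> bool" where
  "invertible_mat n g \<longleftrightarrow> (\<exists>h. \<forall>i<n. \<forall>j<n.
      (\<Sum>k<n. g i k * h k j) = (if i = j then 1 else 0))"

inductive_set polyfun :: "nat \<Rightarrow> ((nat \<Rightarrow> nat \<Rightarrow> 'k::field) \<Rightarrow> 'k) set" for n where
  pconst: "(\<lambda>g. c) \<in> polyfun n"
| pvar: "i < n \<Longrightarrow> j < n \<Longrightarrow> (\<lambda>g. g i j) \<in> polyfun n"
| padd: "p \<in> polyfun n \<Longrightarrow> q \<in> polyfun n \<Longrightarrow> (\<lambda>g. p g + q g) \<in> polyfun n"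
| pmult: "p \<in> polyfun n \<Longrightarrow> q \<in> polyfun n \<Longrightarrow> (\<lambda>g. p g * q g) \<in> polyfun n"

text \<open>Gin(J): the initial ideal in(gJ), which is the same for all g in a nonempty Zariski
  open subset of GL_n(K) (K infinite).\<close>
definition Gin :: "nat \<Rightarrow> 'k::field ext set \<Rightarrow> 'k ext set" where
  "Gin n J = (THE I. \<exists>p\<in>polyfun n. (\<exists>g. p g \<noteq> 0) \<and>
      (\<forall>g. p g \<noteq> 0 \<longrightarrow> invertible_mat n g \<and> in_ideal n (ext_act n g ` J) = I))"

end

theory Submission
  imports Defs "HOL-Library.Nat_Bijection" "HOL-Computational_Algebra.Polynomial"
begin

text \<open>Put \<open>J\<close> into generic coordinates and filter the Cartan complex of \<open>E/J\<close> by the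
  number of divided power variables: \<open>h(q,i,d)\<close> is the dimension of the homology on the variables
  with index at least \<open>q\<close>. The long exact sequence for one more variable gives the exact formula
  \<open>h(q,i+1,d+1) = h(q+1,i+1,d+1) + h(q,i,d) - k(q,i,d) - k(q,i+1,d)\<close>, where \<open>k(q,i,d)\<close> is the rank
  of the connecting map. By the revlex order the terms with \<open>i = 0\<close> agree for \<open>J\<close> and for
  \<open>Gin(J)\<close>; for \<open>Gin(J)\<close>, which is stable, a contracting homotopy gives \<open>k(q,i,d) = 0\<close> for
  \<open>i > 0\<close>. Hence the Betti numbers of \<open>E/Gin(J)\<close> are upper bounds, and equality in one homological
  degree forces equality in all lower ones, down to \<open>i = 1\<close>, where it says that all \<open>k(q,1,d)\<close> of
  \<open>J\<close> vanish. The number \<open>k(q,1,d)\<close> only depends on the degree \<open>d\<close> component of \<open>J\<close>, so it can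
  be compared with the ideal generated by that component; there the recursion propagates the
  vanishing to all higher degrees, which gives a linear resolution.

  Conversely, suppose that a linear ideal had a nonzero connecting rank in generic coordinates, and
  consider the largest degree in which its generic annihilator numbers do not vanish. The maps dual
  to two consecutive coordinates then generate everything, while the first one alone is not onto.
  A pencil argument shows that a transvection strictly increases the rank of the first map, so that
  the coordinates can be improved, a contradiction.\<close>



text \<open>Nonvanishing of polynomials in the matrix entries can impose finitely many conditions
  only, while the Cartan complex has infinitely many homological degrees; over a countable field
  infinitely many nonempty open sets may have empty intersection. Generic coordinates are therefore
  defined by ranks of truncated homogeneous components alone. These ranks fix the leading monomials
  and thus all terms with \<open>i = 0\<close>, but they say nothing directly about
  \<open>h(q,i,d)\<close> with \<open>q > 0\<close> and \<open>i > 0\<close>. This gap shapes the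
  converse: vanishing at level \<open>q + 1\<close> in the homological degrees below a bound
  \<open>R\<close> is derived from vanishing at level \<open>q\<close> below a larger bound, and the
  coordinates are allowed to depend on \<open>R\<close>. The larger bound comes from the pencil
  argument, which needs as many further homological degrees as it takes the images of the powers of
  one map to stabilize inside a finite-dimensional space.\<close>

section \<open>Linear algebra: dimensions of finite-dimensional subspaces of large function
  spaces\<close>

context vector_space begin

text \<open>The ambient function spaces are infinite-dimensional, where \<open>dim\<close> of a
  subspace without a finite basis is the default value 0; finiteness is therefore tracked for each
  subspace separately.\<close>

definition fin_dim :: "'b set \<Rightarrow> bool" where
  "fin_dim S \<longleftrightarrow> (\<exists>B. finite B \<and> S \<subseteq> local.span B)"

lemma fin_dim_mono: "local.fin_dim S \<Longrightarrow> T \<subseteq> S \<Longrightarrow> local.fin_dim T"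
  unfolding fin_dim_def by blast

lemma fin_dim_obtain_basis:
  assumes "local.fin_dim S"
  obtains B where "finite B" "B \<subseteq> S" "local.independent B" "S \<subseteq> local.span B" "card B = local.dim S"
proof -
  from assms obtain A where A: "finite A" "S \<subseteq> local.span A" unfolding fin_dim_def by blast
  obtain B where B: "B \<subseteq> S" "local.independent B" "S \<subseteq> local.span B" "card B = local.dim S"
    using basis_exists by blast
  have "finite B" using independent_span_bound[OF A(1) B(2)] B(1) A(2) by blast
  then show ?thesis using B that by blast
qed

lemma independent_card_le_dim:
  assumes "local.fin_dim S" "B \<subseteq> S" "local.independent B"
  shows "finite B" "card B \<le> local.dim S"
proof -
  obtain A where A: "finite A" "A \<subseteq> S" "local.independent A" "S \<subseteq> local.span A" "card A = local.dim S"
    using fin_dim_obtain_basis[OF assms(1)] .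
  show "finite B" "card B \<le> local.dim S"
    using independent_span_bound[OF A(1) assms(3)] assms(2) A(4,5) by auto
qed

lemma fin_dim_dim_mono:
  assumes "local.fin_dim S" "T \<subseteq> S"
  shows "local.dim T \<le> local.dim S"
proof -
  obtain B where B: "B \<subseteq> T" "local.independent B" "T \<subseteq> local.span B" "card B = local.dim T"
    using basis_exists by blast
  show ?thesis using independent_card_le_dim(2)[OF assms(1), of B] B assms(2) by auto
qed

lemma fin_dim_subspace_eq:
  assumes "local.fin_dim S" "T \<subseteq> S" "local.subspace T" "local.dim S \<le> local.dim T"
  shows "T = S"
proof (rule ccontr)
  assume "T \<noteq> S"
  then obtain x where x: "x \<in> S" "x \<notin> T" using assms(2) by blast
  obtain B where B: "finite B" "B \<subseteq> T" "local.independent B" "T \<subseteq> local.span B" "card B = local.dim T"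
    using fin_dim_obtain_basis[OF fin_dim_mono[OF assms(1,2)]] .
  have "local.span B \<subseteq> T" using B(2) assms(3) by (simp add: span_minimal)
  then have xB: "x \<notin> local.span B" using x(2) by blast
  then have "local.independent (insert x B)" using B(3) by (simp add: independent_insertI)
  then have "card (insert x B) \<le> local.dim S"
    using independent_card_le_dim(2)[OF assms(1), of "insert x B"] x(1) B(2) assms(2) by blast
  moreover have "x \<notin> B" using xB span_base by blast
  ultimately show False using B(1,5) assms(4) by simp
qed

lemma dim_subspace_0: "local.dim {0} = 0"
  using dim_unique[of "{}" "{0}" 0] by (simp add: independent_empty)

end

context vector_space_pair begin

text \<open>A basis \<open>B\<close> of the kernel in \<open>S\<close> extends to a basis
  \<open>C\<close> of \<open>S\<close>, and the images of \<open>C - B\<close> form a basis of the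
  image.\<close>

lemma rank_nullity:
  assumes S: "vs1.subspace S" and fd: "vs1.fin_dim S" and f: "Vector_Spaces.linear s1 s2 f"
  shows "vs1.dim S = vs1.dim {x\<in>S. f x = 0} + vs2.dim (f ` S)"
    and "vs2.fin_dim (f ` S)"
proof -
  let ?N = "{x\<in>S. f x = 0}"
  interpret f: Vector_Spaces.linear s1 s2 f by fact
  have N: "?N \<subseteq> S" by blast
  have Nsub: "vs1.subspace ?N"
    using S by (auto simp: vs1.subspace_def f.add f.scale)
  obtain B where B: "finite B" "B \<subseteq> ?N" "vs1.independent B" "?N \<subseteq> vs1.span B" "card B = vs1.dim ?N"
    using vs1.fin_dim_obtain_basis[OF vs1.fin_dim_mono[OF fd N]] .
  have "B \<subseteq> S" using B(2) by blast
  then obtain C where C: "B \<subseteq> C" "C \<subseteq> S" "vs1.independent C" "S \<subseteq> vs1.span C"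
    using vs1.maximal_independent_subset_extend[OF _ B(3)] by metis
  have finC: "finite C" and "card C = vs1.dim S"
    using vs1.independent_card_le_dim(1)[OF fd C(2,3)] vs1.basis_card_eq_dim[OF C(2,4,3)] by auto
  have spB: "vs1.span B \<subseteq> ?N" using B(2) Nsub by (simp add: vs1.span_minimal)
  \<comment> \<open>A relation among the images produces a kernel element, which \<open>B\<close>
    spans already; together this is a relation on \<open>C\<close> and hence trivial.\<close>
  have key: "\<forall>b\<in>C - B. u b = 0" if "(\<Sum>b\<in>C - B. s2 (u b) (f b)) = 0" for u
  proof -
    let ?x = "\<Sum>b\<in>C - B. s1 (u b) b"
    have "f ?x = 0" using that by (simp add: f.sum f.scale)
    moreover have "?x \<in> S" using C(2) by (intro vs1.subspace_sum[OF S] vs1.subspace_scale[OF S]) auto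
    ultimately have "?x \<in> vs1.span B" using B(4) by blast
    then obtain v where v: "?x = (\<Sum>b\<in>B. s1 (v b) b)"
      using vs1.span_finite[OF B(1)] by auto
    define w where "w = (\<lambda>b. if b \<in> B then - v b else u b)"
    have "(\<Sum>b\<in>C. s1 (w b) b) = (\<Sum>b\<in>C-B. s1 (w b) b) + (\<Sum>b\<in>B. s1 (w b) b)"
      using sum.subset_diff[OF C(1) finC, of "\<lambda>b. s1 (w b) b"] by simp
    also have "(\<Sum>b\<in>C-B. s1 (w b) b) = ?x" by (rule sum.cong) (auto simp: w_def)
    also have "(\<Sum>b\<in>B. s1 (w b) b) = - (\<Sum>b\<in>B. s1 (v b) b)"
      unfolding sum_negf[symmetric] by (rule sum.cong) (auto simp: w_def)
    finally have "(\<Sum>b\<in>C. s1 (w b) b) = 0" using v by simp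
    then have "\<forall>b\<in>C. w b = 0" using vs1.independentD[OF C(3) finC subset_refl] by auto
    then show ?thesis by (auto simp: w_def split: if_splits)
  qed
  have inj: "inj_on f (C - B)"
  proof (rule inj_onI)
    fix x y assume xy: "x \<in> C - B" "y \<in> C - B" "f x = f y"
    show "x = y"
    proof (rule ccontr)
      assume ne: "x \<noteq> y"
      define u where "u = (\<lambda>b. if b = x then 1 else if b = y then - 1 else (0::'a))"
      have "(\<Sum>b\<in>C - B. s2 (u b) (f b)) = (\<Sum>b\<in>{x,y}. s2 (u b) (f b))"
        by (rule sum.mono_neutral_right) (use finC xy in \<open>auto simp: u_def\<close>)
      also have "\<dots> = 0" using ne xy by (simp add: u_def)
      finally have "u x = 0" using key xy by blast
      then show False by (simp add: u_def)
    qed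
  qed
  have ind: "vs2.independent (f ` (C - B))"
  proof (rule vs2.independent_if_scalars_zero)
    show "finite (f ` (C - B))" using finC by simp
    fix g y assume a: "(\<Sum>x\<in>f ` (C - B). s2 (g x) x) = 0" and y: "y \<in> f ` (C - B)"
    have "(\<Sum>b\<in>C - B. s2 (g (f b)) (f b)) = 0" using a by (simp add: sum.reindex[OF inj])
    from key[OF this] y show "g y = 0" by auto
  qed
  have spn: "f ` S \<subseteq> vs2.span (f ` (C - B))"
  proof
    fix y assume "y \<in> f ` S"
    then obtain x where x: "x \<in> vs1.span C" "y = f x" using C(4) by blast
    from x(1) have "f x \<in> vs2.span (f ` (C - B))"
    proof (induct rule: vs1.span_induct_alt)
      case base show ?case by (simp add: vs2.span_zero)
    next
      case (step c x y)
      show ?case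
      proof (cases "x \<in> B")
        case True
        then have "f x = 0" using B(2) by blast
        then show ?thesis using step by (simp add: f.add f.scale)
      next
        case False
        then have "f x \<in> vs2.span (f ` (C - B))" using step(1) by (intro vs2.span_base) auto
        then show ?thesis using step by (simp add: f.add f.scale vs2.span_add vs2.span_scale)
      qed
    qed
    then show "y \<in> vs2.span (f ` (C - B))" using x by simp
  qed
  show "vs2.fin_dim (f ` S)" unfolding vs2.fin_dim_def
    using spn finC by (intro exI[of _ "f ` (C - B)"] conjI finite_imageI finite_Diff)
  have CS: "C - B \<subseteq> S" using C(2) by blast
  have "vs2.dim (f ` S) = card (f ` (C - B))"
    using vs2.basis_card_eq_dim[OF image_mono[OF CS] spn ind] by simp
  also have "\<dots> = card C - card B" using card_image[OF inj] C(1) B(1) by (simp add: card_Diff_subset)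
  finally show "vs1.dim S = vs1.dim ?N + vs2.dim (f ` S)"
    using \<open>card C = vs1.dim S\<close> B(5) card_mono[OF finC C(1)] by simp
qed

lemma dim_image_inj:
  assumes S: "vs1.subspace S" and fd: "vs1.fin_dim S" and f: "Vector_Spaces.linear s1 s2 f"
    and inj: "\<And>x. x \<in> S \<Longrightarrow> f x = 0 \<Longrightarrow> x = 0"
  shows "vs2.dim (f ` S) = vs1.dim S"
proof -
  interpret f: Vector_Spaces.linear s1 s2 f by fact
  have "{x\<in>S. f x = 0} = {0}" using inj vs1.subspace_0[OF S] f.zero by auto
  then show ?thesis using rank_nullity(1)[OF S fd f] vs1.dim_subspace_0 by simp
qed

end

context vector_space begin

text \<open>The map \<open>r\<close> stands in for the quotient map by \<open>S\<close>: congruence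
  modulo \<open>S\<close> becomes equality of values of a linear endomorphism, and dimensions of
  quotients become ranks.\<close>

lemma subspace_is_kernel:
  assumes S: "local.subspace S"
  obtains r where "Vector_Spaces.linear scale scale r" "\<And>x. r x = 0 \<longleftrightarrow> x \<in> S"
proof -
  interpret vp: vector_space_pair scale scale by unfold_locales
  obtain B where B: "B \<subseteq> S" "local.independent B" "S \<subseteq> local.span B" by (rule basis_exists)
  define C where "C = extend_basis B"
  have C: "local.independent C" "B \<subseteq> C" "local.span C = UNIV"
    unfolding C_def by (rule independent_extend_basis[OF B(2)], rule extend_basis_superset[OF B(2)],
      rule span_extend_basis[OF B(2)])
  define r where "r = vp.construct C (\<lambda>b. if b \<in> B then 0 else b)"
  have lr: "Vector_Spaces.linear scale scale r" unfolding r_def by (rule vp.linear_construct[OF C(1)])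
  interpret r: Vector_Spaces.linear scale scale r by fact
  have rb: "r b = (if b \<in> B then 0 else b)" if "b \<in> C" for b
    unfolding r_def using vp.construct_basis[OF C(1) that] .
  have diff: "x - r x \<in> S" for x
  proof -
    have "x \<in> local.span C" using C(3) by simp
    then show ?thesis
    proof (induct rule: span_induct_alt)
      case base show ?case using subspace_0[OF S] by (simp add: r.zero)
    next
      case (step c x y)
      have "x - r x \<in> S" using rb[OF step(1)] B(1) subspace_0[OF S] by auto
      then have "scale c (x - r x) + (y - r y) \<in> S"
        using step subspace_add[OF S] subspace_scale[OF S] by blast
      then show ?case by (simp only: r.add r.scale scale_right_diff_distrib add_diff_add)
    qed
  qed
  have zero: "r x = 0" if "x \<in> S" for x
  proof -
    have "x \<in> local.span B" using B(3) that by blast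
    then show ?thesis
    proof (induct rule: span_induct_alt)
      case base show ?case by (simp add: r.zero)
    next
      case (step c x y)
      then show ?case using rb C(2) by (auto simp: r.add r.scale)
    qed
  qed
  have "r x = 0 \<longleftrightarrow> x \<in> S" for x using diff[of x] zero[of x] by auto
  then show ?thesis using lr that by blast
qed

end

context vector_space_pair begin

text \<open>\<open>f\<close> induces a surjection from \<open>Z\<close> onto \<open>A\<close> modulo
  \<open>B\<close> whose kernel is the preimage of \<open>B\<close>; the count is arranged without
  subtraction.\<close>

lemma dim_relation:
  assumes Z: "vs1.subspace Z" "vs1.fin_dim Z" and A: "vs2.subspace A" "vs2.fin_dim A"
    and B: "vs2.subspace B" "B \<subseteq> A" and f: "Vector_Spaces.linear s1 s2 f"
    and fA: "\<And>z. z \<in> Z \<Longrightarrow> f z \<in> A"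
    and onto: "\<And>a. a \<in> A \<Longrightarrow> \<exists>z\<in>Z. a - f z \<in> B"
  shows "vs1.dim Z + vs2.dim B = vs1.dim {z\<in>Z. f z \<in> B} + vs2.dim A"
proof -
  interpret vp2: vector_space_pair s2 s2 by unfold_locales
  obtain r where r: "Vector_Spaces.linear s2 s2 r" and rB: "\<And>x. r x = 0 \<longleftrightarrow> x \<in> B"
    using vs2.subspace_is_kernel[OF B(1)] by blast
  interpret r: Vector_Spaces.linear s2 s2 r by fact
  interpret f: Vector_Spaces.linear s1 s2 f by fact
  have rf: "Vector_Spaces.linear s1 s2 (r \<circ> f)"
    by unfold_locales (simp_all add: f.add f.scale r.add r.scale)
  have im: "(r \<circ> f) ` Z = r ` A"
  proof
    show "(r \<circ> f) ` Z \<subseteq> r ` A" using fA by auto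
    show "r ` A \<subseteq> (r \<circ> f) ` Z"
    proof
      fix y assume "y \<in> r ` A"
      then obtain a where a: "a \<in> A" "y = r a" by blast
      then obtain z where z: "z \<in> Z" "a - f z \<in> B" using onto by blast
      then have "r a = r (f z)" using rB[of "a - f z"] by (simp add: r.diff)
      then show "y \<in> (r \<circ> f) ` Z" using a z by auto
    qed
  qed
  have 1: "vs1.dim Z = vs1.dim {z\<in>Z. f z \<in> B} + vs2.dim (r ` A)"
    using rank_nullity(1)[OF Z rf] im rB by simp
  have "{x\<in>A. r x = 0} = B" using B(2) rB by auto
  then have 2: "vs2.dim A = vs2.dim B + vs2.dim (r ` A)"
    using vp2.rank_nullity(1)[OF A r] by simp
  show ?thesis using 1 2 by simp
qed

end


section \<open>Operators on exterior elements and on chains\<close>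

text \<open>\<open>lm j\<close> is multiplication by \<open>e_j\<close> from the left. On chains, \<open>sh j\<close> contracts with the
  variable dual to \<open>e_j\<close>, i.e. \<open>x^(a + eps_j)\<close> goes to \<open>x^(a)\<close>, \<open>up q\<close> is its right inverse, and
  \<open>rs q\<close> projects to the part free of \<open>x_q\<close>.\<close>

definition sg :: "nat \<Rightarrow> nat set \<Rightarrow> 'k::field" where
  "sg j T = (-1) ^ card {r \<in> T. r < j}"

definition lm :: "nat \<Rightarrow> 'k::field ext \<Rightarrow> 'k ext" where
  "lm j f = (\<lambda>T. if j \<in> T then sg j T * f (T - {j}) else 0)"

definition sh :: "nat \<Rightarrow> 'k::field chain \<Rightarrow> 'k chain" where
  "sh j c = (\<lambda>b. c (b(j := Suc (b j))))"

definition up :: "nat \<Rightarrow> 'k::field chain \<Rightarrow> 'k chain" where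
  "up q c = (\<lambda>b. if b q = 0 then 0 else c (b(q := b q - 1)))"

definition rs :: "nat \<Rightarrow> 'k::field chain \<Rightarrow> 'k chain" where
  "rs q c = (\<lambda>b. if b q = 0 then c b else 0)"

definition lmc :: "nat \<Rightarrow> 'k::field chain \<Rightarrow> 'k chain" where
  "lmc q c = (\<lambda>b. lm q (c b))"

text \<open>The Cartan differential with \<open>lm\<close> in place of \<open>ext_mult\<close>. The
  operator identities for \<open>lm\<close> hold for arbitrary functions; on chains with
  coefficients in \<open>ext_carrier\<close> both differentials agree.\<close>

definition cdf :: "nat \<Rightarrow> 'k::field chain \<Rightarrow> 'k chain" where
  "cdf n c = (\<lambda>b. \<Sum>j<n. lm j (c (b(j := Suc (b j)))))"

definition csc :: "'k::field \<Rightarrow> 'k chain \<Rightarrow> 'k chain" where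
  "csc r c = (\<lambda>a S. r * c a S)"

definition fsc :: "'k::field \<Rightarrow> ('x \<Rightarrow> 'k) \<Rightarrow> 'x \<Rightarrow> 'k" where
  "fsc r f = (\<lambda>x. r * f x)"

lemma csc_apply [simp]: "csc r c a S = r * c a S" by (simp add: csc_def)
lemma fsc_apply [simp]: "fsc r c a = r * c a" by (simp add: fsc_def)

lemma sum_fun_apply: "(\<Sum>x\<in>A. f x) y = (\<Sum>x\<in>A. f x y)"
  for f :: "'a \<Rightarrow> 'b \<Rightarrow> 'c::comm_monoid_add"
  by (induct A rule: infinite_finite_induct) auto

interpretation cv: vector_space csc
  by unfold_locales (auto simp: fun_eq_iff algebra_simps)

interpretation fv: vector_space fsc
  by unfold_locales (auto simp: fun_eq_iff algebra_simps)

interpretation cc: vector_space_pair csc csc by unfold_locales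
interpretation cf: vector_space_pair csc fsc by unfold_locales
interpretation ff: vector_space_pair fsc fsc by unfold_locales

lemma linear_cscI:
  assumes "\<And>x y. f (x + y) = f x + f y" "\<And>r x. f (csc r x) = csc r (f x)"
  shows "Vector_Spaces.linear csc csc f"
  by unfold_locales (auto simp: assms)

subsection \<open>Sign rules\<close>

lemma sg_sq [simp]: "sg j T * sg j T = (1::'k::field)" "sg j T * (sg j T * x) = (x::'k::field)"
  by (simp_all add: sg_def power_mult_distrib[symmetric] mult.assoc[symmetric])

lemma sg_nz [simp]: "sg j T \<noteq> (0::'k::field)" by (simp add: sg_def)

lemma sg_remove_self [simp]: "sg j (T - {j}) = sg j T" "sg j (insert j T) = sg j T"
  unfolding sg_def by (metis (no_types, lifting) Diff_iff less_irrefl singletonD Collect_cong,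
   metis (no_types, lifting) insert_iff less_irrefl Collect_cong)

lemma sg_remove: 
  assumes "i \<in> T" 
  shows "sg j (T - {i}) = (if i < j then - sg j T else sg j T :: 'k::field)"
proof (cases "i < j")
  case True
  have e: "{r \<in> T. r < j} = insert i {r \<in> T - {i}. r < j}" using assms True by auto
  have "card {r \<in> T. r < j} = Suc (card {r \<in> T - {i}. r < j})"
    unfolding e by (subst card_insert_disjoint) auto
  then show ?thesis using True by (simp add: sg_def)
next
  case False
  have e: "{r \<in> T. r < j} = {r \<in> T - {i}. r < j}" using False by auto
  show ?thesis using False unfolding sg_def e by simp
qed

lemma lm_anticomm: "lm i (lm j f) = - lm j (lm i f)"
proof
  fix T
  show "lm i (lm j f) T = (- lm j (lm i f)) T"
  proof (cases "i \<in> T \<and> j \<in> T \<and> i \<noteq> j")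
    case True
    then have "T - {i} - {j} = T - {j} - {i}" by blast
    then show ?thesis using True
      by (auto simp: lm_def sg_remove neq_iff)
  qed (auto simp: lm_def)
qed

lemma lm_lm [simp]: "lm j (lm j f) = 0" by (auto simp: lm_def fun_eq_iff)

lemma lm_add: "lm j (f + g) = lm j f + lm j g" by (auto simp: lm_def fun_eq_iff algebra_simps)
lemma lm_fsc: "lm j (fsc r f) = fsc r (lm j f)" by (auto simp: lm_def fun_eq_iff)
lemma lm_0 [simp]: "lm j 0 = 0" "lm j (\<lambda>_. 0) = (\<lambda>_. 0)" by (auto simp: lm_def fun_eq_iff)
lemma lm_neg: "lm j (- f) = - lm j f" by (auto simp: lm_def fun_eq_iff)
lemma lm_diff: "lm j (f - g) = lm j f - lm j g" by (auto simp: lm_def fun_eq_iff algebra_simps)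
lemma lm_sum: "lm j (sum f A) = (\<Sum>x\<in>A. lm j (f x))"
proof (induct A rule: infinite_finite_induct)
  case (insert x A)
  have "sum f (insert x A) = f x + sum f A" by (rule sum.insert[OF insert(1,2)])
  then have "lm j (sum f (insert x A)) = lm j (f x) + lm j (sum f A)" using lm_add[of j "f x" "sum f A"] by (simp only:)
  then show ?case using insert(3) sum.insert[OF insert(1,2), of "\<lambda>x. lm j (f x)"] by argo
qed (simp_all add: lm_0)

lemma lm_carrier: "f \<in> ext_carrier n \<Longrightarrow> j < n \<Longrightarrow> lm j f \<in> ext_carrier n"
  unfolding ext_carrier_def lm_def by (auto split: if_splits)

lemma ext_mult_mono_left:
  assumes "f \<in> ext_carrier n"
  shows "ext_mult (ext_mono {j}) f = lm j f"
proof
  fix T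
  show "ext_mult (ext_mono {j}) f T = lm j f T"
  proof (cases "finite T")
    case True
    have "ext_mult (ext_mono {j}) f T
        = (\<Sum>S\<in>Pow T. if S = {j} then ext_sign {j} (T - {j}) * f (T - {j}) else 0)"
      unfolding ext_mult_def by (rule sum.cong) (auto simp: ext_mono_def)
    also have "\<dots> = (if j \<in> T then ext_sign {j} (T - {j}) * f (T - {j}) else 0)"
      using True by (subst sum.delta) auto
    also have "ext_sign {j} (T - {j}) = (sg j T :: 'a)"
    proof -
      have "{(s, r). s \<in> {j} \<and> r \<in> T - {j} \<and> r < s} = Pair j ` {r \<in> T. r < j}" by auto
      then show ?thesis unfolding ext_sign_def sg_def by (simp add: card_image inj_on_def)
    qed
    finally show ?thesis by (simp add: lm_def)
  next
    \<comment> \<open>A sum over \<open>Pow T\<close> with \<open>T\<close> infinite is 0 by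
      convention; elements of the carrier are supported on finite sets, so the right side is 0 as
      well.\<close>
    case False
    then have "f (T - {j}) = 0" using assms finite_subset[OF _ finite_lessThan[of n]]
      unfolding ext_carrier_def by (metis (mono_tags, lifting) finite.emptyI finite_Diff_insert finite_Diff2 mem_Collect_eq)
    then show ?thesis using False by (simp add: lm_def ext_mult_def)
  qed
qed

lemma cartan_diff_eq:
  assumes "\<And>a. c a \<in> ext_carrier n"
  shows "cartan_diff n c = cdf n c"
  unfolding cartan_diff_def cdf_def using ext_mult_mono_left[OF assms] by auto

subsection \<open>Operators on chains\<close>

lemma sh_up [simp]: "sh j (up j c) = c" by (auto simp: sh_def up_def)
lemma sh_comm: "sh j (sh k c) = sh k (sh j c)"
  by (cases "j = k") (auto simp: sh_def fun_upd_twist fun_eq_iff)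
lemma rs_up [simp]: "rs q (up q c) = 0" by (auto simp: rs_def up_def fun_eq_iff)
lemma sh_rs [simp]: "sh q (rs q c) = 0" by (auto simp: rs_def sh_def fun_eq_iff)
lemma rs_decomp: "c = rs q c + up q (sh q c)"
  by (rule ext) (auto simp: rs_def up_def sh_def)

lemma sh_0 [simp]: "sh j 0 = 0" by (auto simp: sh_def fun_eq_iff)
lemma up_0 [simp]: "up j 0 = 0" by (auto simp: up_def fun_eq_iff)
lemma rs_0 [simp]: "rs j 0 = 0" by (auto simp: rs_def fun_eq_iff)
lemma lmc_0 [simp]: "lmc j 0 = 0" by (auto simp: lmc_def fun_eq_iff)
lemma cdf_0 [simp]: "cdf n 0 = 0" by (auto simp: cdf_def fun_eq_iff sum_fun_apply)

lemma sh_add: "sh j (c + c') = sh j c + sh j c'" by (auto simp: sh_def fun_eq_iff)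
lemma up_add: "up j (c + c') = up j c + up j c'" by (auto simp: up_def fun_eq_iff)
lemma rs_add: "rs j (c + c') = rs j c + rs j c'" by (auto simp: rs_def fun_eq_iff)
lemma lmc_add: "lmc j (c + c') = lmc j c + lmc j c'" by (auto simp: lmc_def lm_add fun_eq_iff)
lemma cdf_add: "cdf n (c + c') = cdf n c + cdf n c'"
  by (auto simp: cdf_def lm_add fun_eq_iff sum.distrib sum_fun_apply)

lemma sh_csc: "sh j (csc r c) = csc r (sh j c)" by (auto simp: sh_def fun_eq_iff)
lemma up_csc: "up j (csc r c) = csc r (up j c)" by (auto simp: up_def fun_eq_iff)
lemma rs_csc: "rs j (csc r c) = csc r (rs j c)" by (auto simp: rs_def fun_eq_iff)
lemma csc_b: "csc r c b = fsc r (c b)" by (auto simp: fun_eq_iff)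
lemma lmc_csc: "lmc j (csc r c) = csc r (lmc j c)" by (auto simp: lmc_def csc_b lm_fsc fun_eq_iff)
lemma cdf_csc: "cdf n (csc r c) = csc r (cdf n c)"
  by (auto simp: cdf_def csc_b lm_fsc fun_eq_iff sum_fun_apply sum_distrib_left)

lemma lin_sh: "Vector_Spaces.linear csc csc (sh j)" by (rule linear_cscI[OF sh_add sh_csc])
lemma lin_up: "Vector_Spaces.linear csc csc (up j)" by (rule linear_cscI[OF up_add up_csc])
lemma lin_rs: "Vector_Spaces.linear csc csc (rs j)" by (rule linear_cscI[OF rs_add rs_csc])
lemma lin_lmc: "Vector_Spaces.linear csc csc (lmc j)" by (rule linear_cscI[OF lmc_add lmc_csc])
lemma lin_cdf: "Vector_Spaces.linear csc csc (cdf j)" by (rule linear_cscI[OF cdf_add cdf_csc])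

lemmas sh_diff = cc.linear_diff[OF lin_sh] and rs_diff = cc.linear_diff[OF lin_rs] and lmc_diff = cc.linear_diff[OF lin_lmc]
  and cdf_diff = cc.linear_diff[OF lin_cdf]
lemmas up_neg = cc.linear_neg[OF lin_up] and cdf_neg = cc.linear_neg[OF lin_cdf]

lemma cdf_alt: "cdf n c = (\<Sum>j<n. lmc j (sh j c))"
  by (auto simp: cdf_def lmc_def sh_def fun_eq_iff sum_fun_apply)

lemma cdf_sh: "cdf n (sh j c) = sh j (cdf n c)"
proof -
  have "sh j (\<Sum>i<n. lmc i (sh i c)) = (\<Sum>i<n. sh j (lmc i (sh i c)))"
    by (rule cc.linear_sum[OF lin_sh])
  moreover have "sh j (lmc i (sh i c)) = lmc i (sh i (sh j c))" for i
    by (subst sh_comm) (auto simp: lmc_def sh_def)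
  ultimately show ?thesis unfolding cdf_alt by simp
qed

lemma cdf_lmc: "cdf n (lmc q c) = - lmc q (cdf n c)"
proof -
  have "lmc q (\<Sum>i<n. lmc i (sh i c)) = (\<Sum>i<n. lmc q (lmc i (sh i c)))"
    by (rule cc.linear_sum[OF lin_lmc])
  moreover have "lmc i (sh i (lmc q c)) = - lmc q (lmc i (sh i c))" for i
    by (rule ext) (simp add: lmc_def sh_def lm_anticomm[of q])
  ultimately show ?thesis unfolding cdf_alt by (simp add: sum_negf)
qed

text \<open>Symmetric coefficients meet anticommuting factors. The two mixed sums cancel in an
  induction over \<open>A\<close>; no division by 2 occurs, so characteristic 2 is covered. Both the
  vanishing of the squared differential and that of squares of linear forms come from here.\<close>

lemma lm_sq_sum: "(\<Sum>i\<in>A. \<Sum>j\<in>A. lm i (lm j (f i j))) = 0"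
  if "finite A" "\<And>i j. f i j = f j i" for f :: "nat \<Rightarrow> nat \<Rightarrow> 'k::field ext"
  using that(1)
proof (induct A)
  case empty show ?case by simp
next
  case (insert x A)
  have "(\<Sum>i\<in>insert x A. \<Sum>j\<in>insert x A. lm i (lm j (f i j)))
      = (\<Sum>j\<in>A. lm x (lm j (f x j))) + (\<Sum>i\<in>A. lm i (lm x (f i x)))
        + (\<Sum>i\<in>A. \<Sum>j\<in>A. lm i (lm j (f i j)))"
    using insert by (simp add: sum.distrib algebra_simps)
  also have "(\<Sum>i\<in>A. lm i (lm x (f i x))) = - (\<Sum>j\<in>A. lm x (lm j (f x j)))"
    unfolding sum_negf[symmetric] by (rule sum.cong) (auto simp: lm_anticomm[of _ x] that(2)[of _ x])
  finally show ?case using insert by simp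
qed

lemma cdf_cdf [simp]: "cdf n (cdf n c) = 0"
proof
  fix b
  have "cdf n (cdf n c) b = (\<Sum>i<n. \<Sum>j<n. lm i (lm j (sh i (sh j c) b)))"
    unfolding cdf_def by (auto simp: lm_sum sh_def intro!: sum.cong)
  also have "\<dots> = 0" by (rule lm_sq_sum) (auto simp: sh_comm)
  finally show "cdf n (cdf n c) b = 0 b" by simp
qed

text \<open>\<open>up q\<close> misses commuting with the differential by one term: it has value 0
  at exponent 0, where the contraction with \<open>x_q\<close> still sees the
  \<open>x_q\<close>-free part of \<open>c\<close>. This defect represents the connecting
  map.\<close>

lemma cdf_up:
  assumes "q < n"
  shows "cdf n (up q c) = up q (cdf n c) + lmc q (rs q c)"
proof -
  have 1: "lmc j (sh j (up q c)) = up q (lmc j (sh j c))" if "j \<noteq> q" for j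
    using that by (auto simp: lmc_def sh_def up_def fun_eq_iff fun_upd_twist)
  have 2: "lmc q (sh q (up q c)) = lmc q (rs q c) + up q (lmc q (sh q c))"
    by (rule ext) (auto simp: lmc_def sh_def up_def rs_def)
  have "cdf n (up q c) = lmc q (sh q (up q c)) + (\<Sum>j\<in>{..<n}-{q}. lmc j (sh j (up q c)))"
    unfolding cdf_alt using assms by (subst sum.remove[of _ q]) auto
  also have "\<dots> = lmc q (rs q c) + up q (lmc q (sh q c)) + (\<Sum>j\<in>{..<n}-{q}. up q (lmc j (sh j c)))"
    unfolding 2 using 1 by (auto intro!: sum.cong)
  also have "\<dots> = lmc q (rs q c) + up q (cdf n c)"
    unfolding cdf_alt cc.linear_sum[OF lin_up] using assms by (simp add: sum.remove[of _ q] add.assoc)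
  finally show ?thesis by (simp add: add.commute)
qed

subsection \<open>Chain spaces\<close>

text \<open>The index \<open>q\<close> restricts to the variables \<open>x_q, ..., x_(n-1)\<close>, \<open>i\<close> is the homological and \<open>d\<close>
  the total degree. The homology of the Cartan complex of \<open>E/J\<close> on these variables is \<open>Zc / Bc\<close>.\<close>

definition Ch :: "nat \<Rightarrow> nat \<Rightarrow> nat \<Rightarrow> nat \<Rightarrow> 'k::field chain set" where
  "Ch n q i d = {c. \<forall>a S. c a S \<noteq> 0 \<longrightarrow>
     valid_mi n i a \<and> (\<forall>j<q. a j = 0) \<and> S \<subseteq> {..<n} \<and> card S + i = d}"

definition Zc :: "nat \<Rightarrow> 'k::field ext set \<Rightarrow> nat \<Rightarrow> nat \<Rightarrow> nat \<Rightarrow> 'k chain set" where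
  "Zc n J q i d = {c \<in> Ch n q i d. \<forall>b. cdf n c b \<in> J}"

definition Jc :: "nat \<Rightarrow> 'k::field ext set \<Rightarrow> nat \<Rightarrow> nat \<Rightarrow> nat \<Rightarrow> 'k chain set" where
  "Jc n J q i d = {c \<in> Ch n q i d. \<forall>a. c a \<in> J}"

definition Bc :: "nat \<Rightarrow> 'k::field ext set \<Rightarrow> nat \<Rightarrow> nat \<Rightarrow> nat \<Rightarrow> 'k chain set" where
  "Bc n J q i d = {cdf n w + l | w l. w \<in> Ch n q (Suc i) d \<and> l \<in> Jc n J q i d}"

lemma valid_mi_Suc:
  assumes "j < n"
  shows "valid_mi n (Suc i) (b(j := Suc (b j))) \<longleftrightarrow> valid_mi n i b"
proof -
  have "(\<Sum>k<n. (b(j := Suc (b j))) k) = Suc (b j) + (\<Sum>k\<in>{..<n}-{j}. b k)"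
    using assms by (subst sum.remove[of _ j]) auto
  also have "\<dots> = Suc (\<Sum>k<n. b k)" using assms by (subst (2) sum.remove[of _ j]) auto
  finally show ?thesis using assms unfolding valid_mi_def by auto
qed

lemma sh_Ch:
  assumes "c \<in> Ch n q (Suc i) (Suc d)" "j < n"
  shows "sh j c \<in> Ch n q i d"
proof -
  have "valid_mi n i a \<and> (\<forall>k<q. a k = 0) \<and> S \<subseteq> {..<n} \<and> card S + i = d"
    if "sh j c a S \<noteq> 0" for a S
  proof -
    have *: "c (a(j := Suc (a j))) S \<noteq> 0" using that by (simp add: sh_def)
    have "valid_mi n (Suc i) (a(j := Suc (a j)))" "\<forall>k<q. (a(j := Suc (a j))) k = 0"
      "S \<subseteq> {..<n}" "card S + Suc i = Suc d"
      using assms(1) * unfolding Ch_def by blast+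
    then show ?thesis using assms(2) by (auto simp: valid_mi_Suc split: if_splits)
  qed
  then show ?thesis unfolding Ch_def by blast
qed

lemma up_Ch:
  assumes "c \<in> Ch n p i d" "q < n" "p \<le> q"
  shows "up q c \<in> Ch n p (Suc i) (Suc d)"
proof -
  have "valid_mi n (Suc i) a \<and> (\<forall>k<p. a k = 0) \<and> S \<subseteq> {..<n} \<and> card S + Suc i = Suc d"
    if "up q c a S \<noteq> 0" for a S
  proof -
    have 0: "a q \<noteq> 0" and *: "c (a(q := a q - 1)) S \<noteq> 0"
      using that by (auto simp: up_def split: if_splits)
    have "valid_mi n i (a(q := a q - 1))" "\<forall>k<p. (a(q := a q - 1)) k = 0"
      "S \<subseteq> {..<n}" "card S + i = d"
      using assms(1) * unfolding Ch_def by blast+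
    moreover have "(a(q := a q - 1))(q := Suc ((a(q := a q - 1)) q)) = a" using 0 by auto
    ultimately show ?thesis using assms(2,3) valid_mi_Suc[OF assms(2), of i "a(q := a q - 1)"]
      by (auto split: if_splits)
  qed
  then show ?thesis unfolding Ch_def by blast
qed

lemma rs_Ch: "c \<in> Ch n q i d \<Longrightarrow> rs q c \<in> Ch n (Suc q) i d"
  unfolding Ch_def rs_def by (auto split: if_splits simp: less_Suc_eq)

text \<open>This identifies the kernel in the short exact sequence of complexes in which
  \<open>sh q\<close> is the projection, lowering homological and total degree by one.\<close>

lemma Ch_Suc: "c \<in> Ch n (Suc q) i d \<longleftrightarrow> c \<in> Ch n q i d \<and> sh q c = 0"
proof
  assume "c \<in> Ch n (Suc q) i d"
  then show "c \<in> Ch n q i d \<and> sh q c = 0"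
    unfolding Ch_def sh_def fun_eq_iff by fastforce
next
  assume a: "c \<in> Ch n q i d \<and> sh q c = 0"
  then have "rs q c = c" using rs_decomp[of c q] by simp
  then show "c \<in> Ch n (Suc q) i d" using rs_Ch a by metis
qed

lemma Ch_SucD: "c \<in> Ch n (Suc q) i d \<Longrightarrow> c \<in> Ch n q i d" by (simp add: Ch_Suc)

lemma lmc_Ch:
  assumes "c \<in> Ch n q i d" "j < n"
  shows "lmc j c \<in> Ch n q i (Suc d)"
proof -
  have "valid_mi n i a \<and> (\<forall>k<q. a k = 0) \<and> T \<subseteq> {..<n} \<and> card T + i = Suc d"
    if "lmc j c a T \<noteq> 0" for a T
  proof -
    have j: "j \<in> T" and *: "c a (T - {j}) \<noteq> 0"
      using that by (auto simp: lmc_def lm_def split: if_splits)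
    have h: "valid_mi n i a" "\<forall>k<q. a k = 0" "T - {j} \<subseteq> {..<n}" "card (T - {j}) + i = d"
      using assms(1) * unfolding Ch_def by blast+
    then have T: "T \<subseteq> {..<n}" using assms(2) by auto
    then have "finite T" using finite_subset by blast
    then have "card T = Suc (card (T - {j}))" using j by (metis card.remove)
    then show ?thesis using h T by auto
  qed
  then show ?thesis unfolding Ch_def by blast
qed

lemma Ch_add: "c \<in> Ch n q i d \<Longrightarrow> c' \<in> Ch n q i d \<Longrightarrow> c + c' \<in> Ch n q i d"
  unfolding Ch_def plus_fun_apply mem_Collect_eq by (metis add_cancel_right_left)

lemma Ch_0 [simp]: "0 \<in> Ch n q i d" unfolding Ch_def by simp

lemma Ch_csc: "c \<in> Ch n q i d \<Longrightarrow> csc r c \<in> Ch n q i d"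
  unfolding Ch_def csc_apply mem_Collect_eq by (metis mult_zero_right)

lemma subspace_Ch: "cv.subspace (Ch n q i d)"
  unfolding cv.subspace_def using Ch_add Ch_0 Ch_csc by blast

lemma Ch_sum: "(\<And>x. x \<in> A \<Longrightarrow> f x \<in> Ch n q i d) \<Longrightarrow> sum f A \<in> Ch n q i d"
  by (rule cv.subspace_sum[OF subspace_Ch])

lemma Ch_trivial: "d < i \<Longrightarrow> Ch n q i d = {0}"
  unfolding Ch_def by (auto simp: fun_eq_iff)

lemma cdf_Ch:
  assumes "c \<in> Ch n q (Suc i) d"
  shows "cdf n c \<in> Ch n q i d"
proof (cases d)
  case 0
  then have "c = 0" using assms Ch_trivial[of d "Suc i"] by auto
  then show ?thesis by simp
next
  case (Suc d')
  show ?thesis unfolding cdf_alt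
    by (rule Ch_sum) (use assms Suc in \<open>auto intro!: lmc_Ch sh_Ch\<close>)
qed

lemma cdf_Ch0: "c \<in> Ch n q 0 d \<Longrightarrow> cdf n c = 0"
proof -
  assume "c \<in> Ch n q 0 d"
  moreover have "\<not> valid_mi n 0 (b(j := Suc (b j)))" if "j < n" for b j
    using that unfolding valid_mi_def by (auto simp: sum_eq_0_iff)
  ultimately have *: "c (b(j := Suc (b j))) = 0" if "j < n" for b j
    using that unfolding Ch_def fun_eq_iff by fastforce
  have "cdf n c b = 0" for b
    unfolding cdf_def by (rule sum.neutral) (simp add: *)
  then show ?thesis by (simp add: fun_eq_iff)
qed

lemma Ch_n_trivial: "n \<le> q \<Longrightarrow> Ch n q (Suc i) d = ({0} :: 'k::field chain set)"
proof -
  assume nq: "n \<le> q"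
  have "c = 0" if c: "c \<in> Ch n q (Suc i) d" for c :: "'k chain"
  proof (rule ccontr)
    assume "c \<noteq> 0"
    then obtain a S where "c a S \<noteq> 0" by (auto simp: fun_eq_iff)
    then have "(\<Sum>j<n. a j) = Suc i" "\<forall>j<q. a j = 0"
      using c unfolding Ch_def valid_mi_def by blast+
    then show False using nq by simp
  qed
  then show ?thesis by auto
qed

lemma finite_valid_mi: "finite {a. valid_mi n i a}"
proof (rule finite_subset)
  show "{a. valid_mi n i a} \<subseteq> {a. \<forall>j. (j \<in> {..<n} \<longrightarrow> a j \<in> {..i}) \<and> (j \<notin> {..<n} \<longrightarrow> a j = 0)}"
  proof (intro subsetI CollectI allI conjI impI)
    fix a j assume a: "a \<in> {a. valid_mi n i a}"
    show "a j \<in> {..i}" if "j \<in> {..<n}"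
      using a member_le_sum[of j "{..<n}" a] that unfolding valid_mi_def by auto
    show "a j = 0" if "j \<notin> {..<n}" using a that unfolding valid_mi_def by auto
  qed
  show "finite {a. \<forall>j. (j \<in> {..<n} \<longrightarrow> a j \<in> {..i}) \<and> (j \<notin> {..<n} \<longrightarrow> a j = (0::nat))}"
    by (rule finite_set_of_finite_funs) auto
qed

lemma fin_dim_Ch: "cv.fin_dim (Ch n q i d :: 'k::field chain set)"
proof -
  define X where "X = {a. valid_mi n i a} \<times> Pow {..<n}"
  have fX: "finite X" unfolding X_def using finite_valid_mi by auto
  define u :: "(nat \<Rightarrow> nat) \<times> nat set \<Rightarrow> 'k chain"
    where "u = (\<lambda>(a, S) b T. if b = a \<and> T = S then 1 else 0)"
  have "c \<in> cv.span (u ` X)" if c: "c \<in> Ch n q i d" for c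
  proof -
    have "c b T = (\<Sum>x\<in>X. csc (c (fst x) (snd x)) (u x)) b T" for b T
    proof -
      have "(\<Sum>x\<in>X. csc (c (fst x) (snd x)) (u x)) b T
          = (\<Sum>x\<in>X. if x = (b, T) then c b T else 0)"
        unfolding sum_fun_apply
        by (rule sum.cong[OF refl]) (auto simp: u_def split: if_splits)
      also have "\<dots> = c b T"
      proof -
        have "(b, T) \<in> X" if "c b T \<noteq> 0" using c that unfolding Ch_def X_def by blast
        then show ?thesis using fX by (auto simp: sum.delta)
      qed
      finally show ?thesis by simp
    qed
    then have "c = (\<Sum>x\<in>X. csc (c (fst x) (snd x)) (u x))" by (intro ext)
    also have "\<dots> \<in> cv.span (u ` X)"
      by (intro cv.span_sum cv.span_scale cv.span_base) auto
    finally show ?thesis .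
  qed
  then show ?thesis unfolding cv.fin_dim_def using fX by (intro exI[of _ "u ` X"]) auto
qed


section \<open>The long exact sequence for one more variable and the resulting recursion\<close>

text \<open>\<open>kdm\<close> is the rank of the connecting map of the long exact sequence for adding the
  variable \<open>x_q\<close>.\<close>

definition hdm :: "nat \<Rightarrow> 'k::field ext set \<Rightarrow> nat \<Rightarrow> nat \<Rightarrow> nat \<Rightarrow> int" where
  "hdm n J q i d = int (cv.dim (Zc n J q i d)) - int (cv.dim (Bc n J q i d))"

definition kdm :: "nat \<Rightarrow> 'k::field ext set \<Rightarrow> nat \<Rightarrow> nat \<Rightarrow> nat \<Rightarrow> int" where
  "kdm n J q i d = int (cv.dim (Zc n J q i d)) - int (cv.dim (sh q ` Zc n J q (Suc i) (Suc d)))"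

lemma sh_lmc: "sh j (lmc q c) = lmc q (sh j c)" by (simp add: sh_def lmc_def)

lemma cdf_decomp:
  assumes "q < n"
  shows "cdf n w = cdf n (rs q w) + up q (cdf n (sh q w)) + lmc q (rs q (sh q w))"
proof -
  have "cdf n w = cdf n (rs q w + up q (sh q w))" using rs_decomp by metis
  then show ?thesis by (simp only: cdf_add cdf_up[OF assms] add.assoc)
qed

lemma sh_cdf_rs: "sh q (cdf n (rs q w)) = 0" by (simp add: cdf_sh[symmetric])

lemma Zc_Suc: "Zc n J (Suc q) i d = {c \<in> Zc n J q i d. sh q c = 0}"
  unfolding Zc_def by (auto simp: Ch_Suc)

lemma Zc_Ch: "Zc n J q i d \<subseteq> Ch n q i d" unfolding Zc_def by blast
lemma Jc_Ch: "Jc n J q i d \<subseteq> Ch n q i d" unfolding Jc_def by blast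

text \<open>Closure under left multiplication by the generators is what makes the chains with
  coefficients in \<open>J\<close> a subcomplex; the grading enters in the locale
  \<open>gid\<close>.\<close>

locale lid =
  fixes n :: nat and J :: "'k::field ext set"
  assumes J_carrier: "J \<subseteq> ext_carrier n" and J_0: "0 \<in> J"
    and J_add: "f \<in> J \<Longrightarrow> g \<in> J \<Longrightarrow> f + g \<in> J"
    and J_fsc: "f \<in> J \<Longrightarrow> fsc r f \<in> J"
    and J_lm: "f \<in> J \<Longrightarrow> j < n \<Longrightarrow> lm j f \<in> J"
begin

lemma subspace_J: "fv.subspace J"
  unfolding fv.subspace_def using J_0 J_add J_fsc by blast

lemma J_neg: "f \<in> J \<Longrightarrow> - f \<in> J"
  using fv.subspace_neg[OF subspace_J] .

lemma J_sum: "(\<And>x. x \<in> A \<Longrightarrow> f x \<in> J) \<Longrightarrow> sum f A \<in> J"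
  by (rule fv.subspace_sum[OF subspace_J])

lemma subspace_Jc: "cv.subspace (Jc n J q i d)"
  unfolding cv.subspace_def Jc_def using Ch_add Ch_csc J_0 J_add J_fsc
  by (auto simp: csc_b)

lemma subspace_Zc: "cv.subspace (Zc n J q i d)"
  unfolding cv.subspace_def Zc_def using Ch_add Ch_csc J_0 J_add J_fsc
  by (auto simp: cdf_add cdf_csc csc_b)

lemma cdf_in_J: "(\<And>a. c a \<in> J) \<Longrightarrow> cdf n c b \<in> J"
  unfolding cdf_def by (intro J_sum J_lm) auto

lemma Jc_Zc: "Jc n J q i d \<subseteq> Zc n J q i d"
  unfolding Jc_def Zc_def using cdf_in_J by auto

lemma Bc_Zc: "Bc n J q i d \<subseteq> Zc n J q i d"
proof
  fix b assume "b \<in> Bc n J q i d"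
  then obtain w l where w: "w \<in> Ch n q (Suc i) d" and l: "l \<in> Jc n J q i d" and b: "b = cdf n w + l"
    unfolding Bc_def by blast
  have "cdf n w \<in> Zc n J q i d" using cdf_Ch[OF w] J_0 by (simp add: Zc_def)
  then show "b \<in> Zc n J q i d"
    unfolding b using l Jc_Zc cv.subspace_add[OF subspace_Zc] by blast
qed

lemma subspace_Bc: "cv.subspace (Bc n J q i d)"
proof -
  have "cv.subspace (cdf n ` Ch n q (Suc i) d)"
    by (rule cc.linear_subspace_image[OF lin_cdf subspace_Ch])
  from cv.subspace_sums[OF this subspace_Jc]
  have "cv.subspace {x + y |x y. x \<in> cdf n ` Ch n q (Suc i) d \<and> y \<in> Jc n J q i d}" .
  moreover have "{x + y |x y. x \<in> cdf n ` Ch n q (Suc i) d \<and> y \<in> Jc n J q i d} = Bc n J q i d"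
    unfolding Bc_def by blast
  ultimately show ?thesis by (simp only:)
qed

lemma Jc_Bc: "Jc n J q i d \<subseteq> Bc n J q i d"
proof
  fix l assume "l \<in> Jc n J q i d"
  then have "cdf n 0 + l \<in> Bc n J q i d" unfolding Bc_def using Ch_0 by blast
  then show "l \<in> Bc n J q i d" by simp
qed

lemma cdf_Bc: "w \<in> Ch n q (Suc i) d \<Longrightarrow> cdf n w \<in> Bc n J q i d"
proof -
  assume w: "w \<in> Ch n q (Suc i) d"
  have "0 \<in> Jc n J q i d" using cv.subspace_0[OF subspace_Jc] .
  then have "cdf n w + 0 \<in> Bc n J q i d" unfolding Bc_def using w by blast
  then show ?thesis by simp
qed

lemma fin_dim_Zc: "cv.fin_dim (Zc n J q i d)"
  by (rule cv.fin_dim_mono[OF fin_dim_Ch Zc_Ch])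
lemma fin_dim_Bc: "cv.fin_dim (Bc n J q i d)"
  by (rule cv.fin_dim_mono[OF fin_dim_Zc Bc_Zc])

lemma sh_Jc: "l \<in> Jc n J q (Suc i) (Suc d) \<Longrightarrow> j < n \<Longrightarrow> sh j l \<in> Jc n J q i d"
  unfolding Jc_def using sh_Ch by (auto simp: sh_def)

lemma up_Jc: "l \<in> Jc n J q i d \<Longrightarrow> q < n \<Longrightarrow> up q l \<in> Jc n J q (Suc i) (Suc d)"
  unfolding Jc_def using up_Ch[of l n q i d q] J_0 by (auto simp: up_def)

lemma rs_Jc: "l \<in> Jc n J q i d \<Longrightarrow> rs q l \<in> Jc n J (Suc q) i d"
  unfolding Jc_def using rs_Ch J_0 by (auto simp: rs_def)

lemma sh_Zc: "z \<in> Zc n J q (Suc i) (Suc d) \<Longrightarrow> j < n \<Longrightarrow> sh j z \<in> Zc n J q i d"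
  unfolding Zc_def using sh_Ch by (auto simp: cdf_sh sh_def[of j "cdf n z"])

lemma sh_Bc: 
  assumes "b \<in> Bc n J q (Suc i) (Suc d)" "j < n" 
  shows "sh j b \<in> Bc n J q i d"
proof -
  obtain w l where w: "w \<in> Ch n q (Suc (Suc i)) (Suc d)" and l: "l \<in> Jc n J q (Suc i) (Suc d)"
    and b: "b = cdf n w + l" using assms(1) unfolding Bc_def by blast
  have "sh j b = cdf n (sh j w) + sh j l" unfolding b by (simp add: sh_add cdf_sh)
  then show ?thesis unfolding Bc_def using sh_Ch[OF w assms(2)] sh_Jc[OF l assms(2)] by blast
qed

text \<open>\<open>up q\<close> lifts the bounding chain \<open>w\<close> and the summand
  \<open>l\<close> separately, with the differential applied after lifting \<open>w\<close>;
  contraction commutes with the differential, so the lift contracts back to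
  \<open>b\<close>.\<close>

lemma sh_Bc_onto:
  assumes "b \<in> Bc n J q i d" "q < n"
  shows "b \<in> sh q ` Bc n J q (Suc i) (Suc d)"
proof -
  obtain w l where w: "w \<in> Ch n q (Suc i) d" and l: "l \<in> Jc n J q i d"
    and b: "b = cdf n w + l" using assms(1) unfolding Bc_def by blast
  have "sh q (cdf n (up q w) + up q l) = b" unfolding b by (simp add: sh_add cdf_sh[symmetric])
  moreover have "cdf n (up q w) + up q l \<in> Bc n J q (Suc i) (Suc d)"
    unfolding Bc_def using up_Ch[OF w assms(2)] up_Jc[OF l assms(2)] by blast
  ultimately show ?thesis by (metis imageI)
qed

lemma sh_Bc_image: "q < n \<Longrightarrow> sh q ` Bc n J q (Suc i) (Suc d) = Bc n J q i d"
  using sh_Bc sh_Bc_onto by blast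

text \<open>The connecting value is the boundary of \<open>up q p\<close> minus \<open>up q\<close>
  of the boundary of \<open>p\<close>, and the latter has coefficients in \<open>J\<close>. It thus
  becomes a boundary once \<open>x_q\<close> may be used.\<close>

lemma delta_in:
  assumes p: "p \<in> Zc n J q i d" and q: "q < n"
  shows "lmc q (rs q p) \<in> Bc n J q i (Suc d)"
proof -
  have pC: "p \<in> Ch n q i d" using p Zc_Ch by blast
  have u: "up q p \<in> Ch n q (Suc i) (Suc d)" using up_Ch[OF pC q] by simp
  have e: "lmc q (rs q p) = cdf n (up q p) - up q (cdf n p)" by (simp add: cdf_up[OF q])
  have "lmc q (rs q p) \<in> Ch n q i (Suc d)" using lmc_Ch[OF Ch_SucD[OF rs_Ch[OF pC]] q] .
  then have "up q (cdf n p) \<in> Ch n q i (Suc d)"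
    using cv.subspace_diff[OF subspace_Ch cdf_Ch[OF u]] e by (metis diff_diff_eq2 add_diff_cancel_left')
  then have "up q (cdf n p) \<in> Jc n J q i (Suc d)"
    using p J_0 unfolding Jc_def Zc_def up_def by auto
  then have "- up q (cdf n p) \<in> Jc n J q i (Suc d)" using cv.subspace_neg[OF subspace_Jc] by blast
  moreover have "lmc q (rs q p) = cdf n (up q p) + - up q (cdf n p)" using e by simp
  ultimately show ?thesis unfolding Bc_def using u by blast
qed

text \<open>Contracting \<open>b = cdf n w + l\<close> with \<open>x_q\<close> shows that the
  boundary of \<open>p = sh q w\<close> is \<open>- sh q l\<close>, so \<open>p\<close> is a cycle
  modulo \<open>J\<close>. What its connecting value misses of \<open>b\<close> comes from the
  \<open>x_q\<close>-free parts of \<open>w\<close> and \<open>l\<close>.\<close>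

lemma delta_onto:
  assumes b: "b \<in> Bc n J q i (Suc d)" "sh q b = 0" and q: "q < n"
  shows "\<exists>p\<in>Zc n J q i d. b - lmc q (rs q p) \<in> Bc n J (Suc q) i (Suc d)"
proof -
  obtain w l where w: "w \<in> Ch n q (Suc i) (Suc d)" and l: "l \<in> Jc n J q i (Suc d)"
    and be: "b = cdf n w + l" using b(1) unfolding Bc_def by blast
  define p where "p = sh q w"
  have pC: "p \<in> Ch n q i d" unfolding p_def by (rule sh_Ch[OF w q])
  have dw: "cdf n w = cdf n (rs q w) + up q (cdf n p) + lmc q (rs q p)"
    unfolding p_def by (rule cdf_decomp[OF q])
  have "sh q b = cdf n p + sh q l"
    unfolding be dw by (simp add: sh_add sh_cdf_rs sh_lmc)
  then have dp: "cdf n p = - sh q l" using b(2) by (simp add: eq_neg_iff_add_eq_0)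
  have "p \<in> Zc n J q i d" unfolding Zc_def using pC l J_neg unfolding Jc_def
    by (auto simp: dp sh_def)
  moreover have "b - lmc q (rs q p) = cdf n (rs q w) + rs q l"
  proof -
    have "l = rs q l + up q (sh q l)" by (rule rs_decomp)
    then show ?thesis unfolding be dw dp by (simp add: up_neg algebra_simps)
  qed
  moreover have "cdf n (rs q w) + rs q l \<in> Bc n J (Suc q) i (Suc d)"
    unfolding Bc_def using rs_Ch[OF w] rs_Jc[OF l] by blast
  ultimately show ?thesis by metis
qed

text \<open>Exactness at the source of the connecting map: a cycle lifts along \<open>sh q\<close>
  exactly when the defect of its naive lift \<open>up q p\<close> can be bounded without
  \<open>x_q\<close>.\<close>

lemma delta_kernel:
  assumes p: "p \<in> Zc n J q i d" and q: "q < n"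
  shows "lmc q (rs q p) \<in> Bc n J (Suc q) i (Suc d) \<longleftrightarrow> p \<in> sh q ` Zc n J q (Suc i) (Suc d)"
proof
  assume "p \<in> sh q ` Zc n J q (Suc i) (Suc d)"
  then obtain w where w: "w \<in> Zc n J q (Suc i) (Suc d)" and pw: "p = sh q w" by blast
  have wC: "w \<in> Ch n q (Suc i) (Suc d)" using w Zc_Ch by blast
  have dw: "cdf n w = cdf n (rs q w) + up q (cdf n p) + lmc q (rs q p)"
    unfolding pw by (rule cdf_decomp[OF q])
  have wJ: "cdf n w \<in> Jc n J q i (Suc d)" using w cdf_Ch unfolding Zc_def Jc_def by blast
  have r: "rs q c = c" if "sh q c = 0" for c :: "'k chain" using rs_decomp[of c q] that by simp
  have "rs q (cdf n w) = cdf n (rs q w) + lmc q (rs q p)"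
    unfolding dw by (simp add: rs_add r sh_cdf_rs sh_lmc)
  then have "lmc q (rs q p) = cdf n (- rs q w) + rs q (cdf n w)" by (simp add: cdf_neg)
  moreover have "- rs q w \<in> Ch n (Suc q) (Suc i) (Suc d)"
    using cv.subspace_neg[OF subspace_Ch rs_Ch[OF wC]] .
  ultimately show "lmc q (rs q p) \<in> Bc n J (Suc q) i (Suc d)"
    unfolding Bc_def using rs_Jc[OF wJ] by blast
next
  assume "lmc q (rs q p) \<in> Bc n J (Suc q) i (Suc d)"
  then obtain v l where v: "v \<in> Ch n (Suc q) (Suc i) (Suc d)" and l: "l \<in> Jc n J (Suc q) i (Suc d)"
    and e: "lmc q (rs q p) = cdf n v + l" unfolding Bc_def by blast
  have pC: "p \<in> Ch n q i d" using p Zc_Ch by blast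
  \<comment> \<open>\<open>v\<close> cancels the defect of \<open>up q p\<close> modulo
    \<open>J\<close>; being free of \<open>x_q\<close> it does not disturb the contraction.\<close>
  define w where "w = up q p - v"
  have "w \<in> Ch n q (Suc i) (Suc d)" unfolding w_def
    using cv.subspace_diff[OF subspace_Ch up_Ch[OF pC q order_refl] Ch_SucD[OF v]] .
  moreover have "cdf n w = up q (cdf n p) + l"
    unfolding w_def by (simp add: cdf_diff cdf_up[OF q] e)
  then have "cdf n w b \<in> J" for b
    using p l J_add J_0 unfolding Zc_def Jc_def up_def by auto
  moreover have "sh q w = p" unfolding w_def using v by (simp add: sh_diff Ch_Suc)
  ultimately show "p \<in> sh q ` Zc n J q (Suc i) (Suc d)" unfolding Zc_def by blast
qed

text \<open>The connecting map sends cycles onto the boundaries free of \<open>x_q\<close>, taken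
  modulo the boundaries formed without \<open>x_q\<close>; its kernel is the image of
  \<open>sh q\<close>. So both sides count the same rank.\<close>

lemma delta_dim:
  assumes q: "q < n"
  shows "kdm n J q i d = int (cv.dim {b \<in> Bc n J q i (Suc d). sh q b = 0})
     - int (cv.dim (Bc n J (Suc q) i (Suc d)))"
proof -
  let ?A = "{b \<in> Bc n J q i (Suc d). sh q b = 0}"
  let ?f = "\<lambda>p. lmc q (rs q p)"
  have lin: "Vector_Spaces.linear csc csc ?f"
    by (rule linear_cscI) (simp_all add: lmc_add rs_add lmc_csc rs_csc)
  have A: "cv.subspace ?A"
    using subspace_Bc[of q i "Suc d"] unfolding cv.subspace_def by (auto simp: sh_add sh_csc)
  have fA: "cv.fin_dim ?A" by (rule cv.fin_dim_mono[OF fin_dim_Bc]) auto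
  have BA: "Bc n J (Suc q) i (Suc d) \<subseteq> ?A"
  proof
    fix b assume b: "b \<in> Bc n J (Suc q) i (Suc d)"
    then have "sh q b = 0" using Bc_Zc Zc_Suc by blast
    moreover have "b \<in> Bc n J q i (Suc d)"
      using b Ch_SucD unfolding Bc_def Jc_def by blast
    ultimately show "b \<in> ?A" by blast
  qed
  have "cv.dim (Zc n J q i d) + cv.dim (Bc n J (Suc q) i (Suc d))
      = cv.dim {z \<in> Zc n J q i d. ?f z \<in> Bc n J (Suc q) i (Suc d)} + cv.dim ?A"
  proof (rule cc.dim_relation[OF subspace_Zc fin_dim_Zc A fA subspace_Bc BA lin])
    fix z assume "z \<in> Zc n J q i d"
    then show "?f z \<in> ?A" using delta_in[OF _ q] by (simp add: sh_lmc)
  next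
    fix a assume "a \<in> ?A"
    then show "\<exists>z\<in>Zc n J q i d. a - ?f z \<in> Bc n J (Suc q) i (Suc d)"
      using delta_onto[OF _ _ q] by blast
  qed
  moreover have "{z \<in> Zc n J q i d. ?f z \<in> Bc n J (Suc q) i (Suc d)} = sh q ` Zc n J q (Suc i) (Suc d)"
    using delta_kernel[OF _ q] sh_Zc[OF _ q] by blast
  ultimately show ?thesis unfolding kdm_def by simp
qed

text \<open>Rank-nullity for \<open>sh q\<close> on cycles and on boundaries. On cycles the image
  misses all of \<open>Zc n J q i d\<close> by \<open>kdm n J q i d\<close>; on boundaries the
  kernel exceeds \<open>Bc\<close> at level \<open>Suc q\<close> by
  \<open>kdm n J q (Suc i) d\<close>. These are the two correction terms.\<close>

theorem hdm_recursion:
  assumes q: "q < n"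
  shows "hdm n J q (Suc i) (Suc d) = hdm n J (Suc q) (Suc i) (Suc d) + hdm n J q i d
     - kdm n J q i d - kdm n J q (Suc i) d"
proof -
  have "cv.dim (Zc n J q (Suc i) (Suc d))
      = cv.dim (Zc n J (Suc q) (Suc i) (Suc d)) + cv.dim (sh q ` Zc n J q (Suc i) (Suc d))"
    unfolding Zc_Suc by (rule cc.rank_nullity(1)[OF subspace_Zc fin_dim_Zc lin_sh])
  moreover have "cv.dim (Bc n J q (Suc i) (Suc d))
      = cv.dim {b \<in> Bc n J q (Suc i) (Suc d). sh q b = 0} + cv.dim (Bc n J q i d)"
    using cc.rank_nullity(1)[OF subspace_Bc fin_dim_Bc lin_sh, of q "Suc i" "Suc d" q]
    by (simp add: sh_Bc_image[OF q])
  ultimately show ?thesis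
    using delta_dim[OF q, of "Suc i" d] unfolding hdm_def kdm_def by linarith
qed

lemma hdm_nonneg: "0 \<le> hdm n J q i d"
  unfolding hdm_def using cv.fin_dim_dim_mono[OF fin_dim_Zc Bc_Zc, of q i d] by simp

lemma hdm_0_iff: "hdm n J q i d = 0 \<longleftrightarrow> Zc n J q i d = Bc n J q i d"
  using cv.fin_dim_subspace_eq[OF fin_dim_Zc Bc_Zc subspace_Bc, of q i d]
  by (auto simp: hdm_def)

lemma kdm_nonneg: "q < n \<Longrightarrow> 0 \<le> kdm n J q i d"
proof -
  assume q: "q < n"
  have "sh q ` Zc n J q (Suc i) (Suc d) \<subseteq> Zc n J q i d" using sh_Zc[OF _ q] by blast
  then show ?thesis unfolding kdm_def using cv.fin_dim_dim_mono[OF fin_dim_Zc] by simp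
qed

lemma kdm_le_hdm: "q < n \<Longrightarrow> kdm n J q i d \<le> hdm n J q i d"
proof -
  assume q: "q < n"
  have "Bc n J q i d \<subseteq> sh q ` Zc n J q (Suc i) (Suc d)"
    using sh_Bc_onto[OF _ q] Bc_Zc by blast
  moreover have "cv.fin_dim (sh q ` Zc n J q (Suc i) (Suc d))"
    by (rule cv.fin_dim_mono[OF fin_dim_Zc[of q i d]]) (use sh_Zc[OF _ q] in auto)
  ultimately show ?thesis
    unfolding kdm_def hdm_def using cv.fin_dim_dim_mono by simp
qed

text \<open>A rank is bounded by the dimension of the target; \<open>kdm_le_hdm\<close> is the bound
  by the source.\<close>

lemma kdm_le_hdm_Suc: "q < n \<Longrightarrow> kdm n J q i d \<le> hdm n J (Suc q) i (Suc d)"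
proof -
  assume q: "q < n"
  have "{b \<in> Bc n J q i (Suc d). sh q b = 0} \<subseteq> Zc n J (Suc q) i (Suc d)"
    unfolding Zc_Suc using Bc_Zc by blast
  then show ?thesis unfolding delta_dim[OF q] hdm_def
    using cv.fin_dim_dim_mono[OF fin_dim_Zc] by fastforce
qed

lemma hdm_top: "n \<le> q \<Longrightarrow> hdm n J q (Suc i) d = 0"
proof -
  assume "n \<le> q"
  then have "Zc n J q (Suc i) d \<subseteq> {0}" using Zc_Ch Ch_n_trivial by blast
  moreover have "0 \<in> Bc n J q (Suc i) d" by (rule cv.subspace_0[OF subspace_Bc])
  ultimately show ?thesis unfolding hdm_0_iff using Bc_Zc by blast
qed

lemma hdm_low: "d < i \<Longrightarrow> hdm n J q i d = 0"
proof -
  assume "d < i"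
  then have "Zc n J q i d \<subseteq> {0}" using Zc_Ch Ch_trivial by blast
  moreover have "0 \<in> Bc n J q i d" by (rule cv.subspace_0[OF subspace_Bc])
  ultimately show ?thesis unfolding hdm_0_iff using Bc_Zc by blast
qed

lemma Zc_0: "Zc n J q 0 d = Ch n q 0 d"
  unfolding Zc_def using J_0 by (auto simp: cdf_Ch0)

text \<open>The right end of the long exact sequence: the contraction vanishes on 0-chains, so the
  cokernel of the connecting map is the degree zero homology at level \<open>q\<close>. Hence
  \<open>kdm\<close> in homological degree 0 is determined by \<open>hdm\<close> in homological
  degree 0.\<close>

lemma kdm_0: "q < n \<Longrightarrow> kdm n J q 0 d = hdm n J (Suc q) 0 (Suc d) - hdm n J q 0 (Suc d)"
proof -
  assume q: "q < n"
  have z: "sh q c = 0" if c: "c \<in> Ch n q 0 (Suc d)" for c :: "'k chain"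
  proof -
    have "\<not> valid_mi n 0 (b(q := Suc (b q)))" for b
      using q unfolding valid_mi_def by (auto simp: sum_eq_0_iff)
    then show ?thesis using c unfolding Ch_def sh_def fun_eq_iff by fastforce
  qed
  have "{b \<in> Bc n J q 0 (Suc d). sh q b = 0} = Bc n J q 0 (Suc d)" using z Bc_Zc Zc_Ch by blast
  moreover have "Zc n J (Suc q) 0 (Suc d) = Zc n J q 0 (Suc d)"
    unfolding Zc_Suc using z Zc_Ch by blast
  ultimately show ?thesis unfolding delta_dim[OF q] hdm_def by simp
qed

end


section \<open>A contracting homotopy of the Cartan complex, and stable monomial ideals\<close>

abbreviation msupp :: "(nat \<Rightarrow> nat) \<Rightarrow> nat set" where
  "msupp a \<equiv> {j. a j \<noteq> 0}"

text \<open>A contracting homotopy: with \<open>p\<close> the largest index occurring in \<open>e_S x^(a)\<close>, a factor \<open>e_p\<close>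
  is replaced by \<open>x_p\<close>. What remains after subtracting the boundary has no \<open>e_p\<close>.\<close>

definition Kh :: "'k::field chain \<Rightarrow> 'k chain" where
  "Kh c = (\<lambda>b R. if R \<union> msupp b \<noteq> {} \<and> Max (R \<union> msupp b) \<notin> R
     then sg (Max (R \<union> msupp b)) R *
       c (b(Max (R \<union> msupp b) := b (Max (R \<union> msupp b)) - 1)) (insert (Max (R \<union> msupp b)) R)
     else 0)"

definition reduced :: "'k::field chain \<Rightarrow> bool" where
  "reduced y \<longleftrightarrow> (\<forall>a S. finite S \<longrightarrow> finite (msupp a) \<longrightarrow> Max (S \<union> msupp a) \<in> S \<longrightarrow> y a S = 0)"

lemma Ch_finite:
  assumes "c \<in> Ch n q i d" "c a S \<noteq> 0"
  shows "valid_mi n i a" "finite S" "S \<subseteq> {..<n}" "msupp a \<subseteq> {..<n}" "finite (msupp a)"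
    "card S + i = d" "msupp a \<subseteq> {q..}"
proof -
  have *: "valid_mi n i a" "\<forall>j<q. a j = 0" "S \<subseteq> {..<n}" "card S + i = d"
    using assms unfolding Ch_def by blast+
  show "valid_mi n i a" "S \<subseteq> {..<n}" "card S + i = d" by fact+
  show "finite S" using *(3) finite_subset by blast
  show m: "msupp a \<subseteq> {..<n}" using *(1) unfolding valid_mi_def by auto
  then show "finite (msupp a)" using finite_subset by blast
  show "msupp a \<subseteq> {q..}"
  proof
    fix j assume "j \<in> msupp a"
    then show "j \<in> {q..}" using *(2) by (cases "j < q") auto
  qed
qed

lemma valid_mi_msupp: "valid_mi n i a \<Longrightarrow> 0 < i \<Longrightarrow> msupp a \<noteq> {}"
  unfolding valid_mi_def by (metis (mono_tags, lifting) mem_Collect_eq empty_iff sum.neutral less_irrefl)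

text \<open>The homotopy raises the exponent of \<open>x_p\<close>, so \<open>p\<close> must be at
  least \<open>q\<close>. A variable already present ensures this if \<open>0 < i\<close>; for
  \<open>i = 0\<close> it has to come from an index of \<open>S\<close> outside
  \<open>{..<q}\<close>.\<close>

lemma Kh_Ch_general:
  assumes c: "c \<in> Ch n q i d"
    and qi: "\<And>a S. c a S \<noteq> 0 \<Longrightarrow> q = 0 \<or> 0 < i \<or> \<not> S \<subseteq> {..<q}"
  shows "Kh c \<in> Ch n q (Suc i) d"
proof -
  have "valid_mi n (Suc i) b \<and> (\<forall>j<q. b j = 0) \<and> R \<subseteq> {..<n} \<and> card R + Suc i = d"
    if nz: "Kh c b R \<noteq> 0" for b R
  proof -
    define p where "p = Max (R \<union> msupp b)"
    define a where "a = b(p := b p - 1)"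
    have ne: "R \<union> msupp b \<noteq> {}" and pR: "p \<notin> R" and ca: "c a (insert p R) \<noteq> 0"
      using nz unfolding Kh_def p_def a_def by (auto split: if_splits)
    note f = Ch_finite[OF c, OF ca]
    have "msupp b \<subseteq> insert p (msupp a)" unfolding a_def by auto
    then have "finite (R \<union> msupp b)" using f(2,5) by (meson finite_Un finite_insert finite_subset)
    then have pin: "p \<in> R \<union> msupp b" and max: "\<And>k. k \<in> R \<union> msupp b \<Longrightarrow> k \<le> p"
      unfolding p_def by (rule Max_in[OF _ ne], rule Max_ge)
    from pin have bp: "b p \<noteq> 0" using pR by blast
    then have ab: "b = a(p := Suc (a p))" unfolding a_def by auto
    have pn: "p < n" using f(3) by auto
    have v: "valid_mi n (Suc i) b" using valid_mi_Suc[OF pn, of i a] f(1) ab by simp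
    have qp: "q \<le> p"
    proof (cases "0 < i")
      case True
      then obtain k where k: "k \<in> msupp a" using valid_mi_msupp[OF f(1)] by blast
      then have "q \<le> k" using f(7) by auto
      moreover have "k \<in> msupp b" using k unfolding a_def by (auto split: if_splits)
      ultimately show ?thesis using max[of k] by simp
    next
      case False
      have "\<not> insert p R \<subseteq> {..<q}" if "q \<noteq> 0" using qi[OF ca] False that by blast
      then show ?thesis using max by (metis UnI1 insert_subset le_trans lessThan_iff linorder_not_le subsetI zero_le)
    qed
    have "b j = 0" if "j < q" for j
    proof -
      have "j \<noteq> p" "j \<notin> msupp a" using that qp f(7) by (auto simp del: mem_Collect_eq)
      then show ?thesis unfolding a_def by simp
    qed
    moreover have "card (insert p R) = Suc (card R)" using f(2) pR by simp
    ultimately show ?thesis using v f(3,6) by auto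
  qed
  then show ?thesis unfolding Ch_def by blast
qed

lemma Kh_Ch:
  assumes "c \<in> Ch n q i d" "q = 0 \<or> 0 < i"
  shows "Kh c \<in> Ch n q (Suc i) d"
  using assms by (intro Kh_Ch_general) auto

lemma cdf_apply: "cdf n c b T = (\<Sum>j<n. if j \<in> T then sg j T * c (b(j := Suc (b j))) (T - {j}) else 0)"
  unfolding cdf_def sum_fun_apply lm_def ..

text \<open>Trading some \<open>e_j\<close> for \<open>x_j\<close> leaves the set of occurring
  indices and thus its maximum \<open>p\<close> unchanged. If \<open>p\<close> lies in
  \<open>S\<close>, only the summand \<open>j = p\<close> of the differential survives, and it
  returns the coefficient of \<open>c\<close>.\<close>

lemma reduced_Kh:
  assumes c: "c \<in> Ch n q i d"
  shows "reduced (c - cdf n (Kh c))"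
  unfolding reduced_def
proof (intro allI impI)
  fix a S assume fin: "finite S" "finite (msupp a)" and m: "Max (S \<union> msupp a) \<in> S"
  define p where "p = Max (S \<union> msupp a)"
  have pS: "p \<in> S" using m by (simp add: p_def)
  have un: "(S - {j}) \<union> msupp (a(j := Suc (a j))) = S \<union> msupp a" if "j \<in> S" for j
    using that by auto
  have K: "Kh c (a(j := Suc (a j))) (S - {j}) = (if j = p then sg p S * c a S else 0)"
    if j: "j \<in> S" for j
  proof -
    have "S \<union> msupp a \<noteq> {}" using pS by blast
    then show ?thesis using pS j unfolding Kh_def un[OF j] p_def[symmetric]
      by (auto simp: insert_absorb)
  qed
  have "cdf n (Kh c) a S = (\<Sum>j<n. if j = p then c a S else 0)"
    unfolding cdf_apply by (rule sum.cong[OF refl]) (use K pS in auto)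
  also have "\<dots> = (if p < n then c a S else 0)" by simp
  also have "\<dots> = c a S" using Ch_finite(3)[OF c, of a S] pS by auto
  finally show "(c - cdf n (Kh c)) a S = 0" by simp
qed

text \<open>On reduced chains the differential is triangular: a coefficient reappears where one
  \<open>x_p\<close> is traded back for \<open>e_p\<close>. All other summands are taken at
  positions whose largest index is \<open>p\<close> in the exterior part, where a reduced chain
  vanishes.\<close>

lemma reduced_cdf:
  assumes y: "reduced y" and fin: "finite S" "finite (msupp a)" and ne: "S \<union> msupp a \<noteq> {}"
    and p: "p = Max (S \<union> msupp a)" "p \<notin> S" "p < n"
  shows "cdf n y (a(p := a p - 1)) (insert p S) = sg p S * y a S"
proof -
  have pin: "p \<in> S \<union> msupp a"
    unfolding p(1) by (rule Max_in[OF finite_UnI[OF fin] ne])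
  have max: "\<And>k. k \<in> S \<union> msupp a \<Longrightarrow> k \<le> p"
    unfolding p(1) by (rule Max_ge[OF finite_UnI[OF fin]])
  define a' where "a' = a(p := a p - 1)"
  have ap: "a'(p := Suc (a' p)) = a" using pin p(2) unfolding a'_def by auto
  have "y (a'(j := Suc (a' j))) (insert p S - {j}) = 0" if j: "j \<in> S" "j \<noteq> p" for j
  proof -
    let ?U = "(insert p S - {j}) \<union> msupp (a'(j := Suc (a' j)))"
    have sub: "?U \<subseteq> S \<union> msupp a" using pin j unfolding a'_def by (auto split: if_splits)
    have fU: "finite ?U" using finite_subset[OF sub] fin by simp
    have "Max ?U = p" using j sub max fU by (intro Max_eqI) auto
    then have "Max ?U \<in> insert p S - {j}" using j by simp
    moreover have "finite (insert p S - {j})" "finite (msupp (a'(j := Suc (a' j))))"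
      using fU by (simp_all only: finite_Un)
    ultimately show ?thesis using y unfolding reduced_def by blast
  qed
  then have "cdf n y a' (insert p S) = (\<Sum>j<n. if j = p then sg p S * y a S else 0)"
    unfolding cdf_apply using p(2)
    by (intro sum.cong[OF refl]) (auto simp: ap)
  also have "\<dots> = sg p S * y a S" using p(3) by simp
  finally show ?thesis unfolding a'_def .
qed

lemma reduced_cdf_Ch:
  assumes y: "reduced y" "y \<in> Ch n q i d" "0 < d" and nz: "y a S \<noteq> 0"
  obtains p where "p = Max (S \<union> msupp a)" "p \<notin> S" "p < n" "p \<in> msupp a"
    "cdf n y (a(p := a p - 1)) (insert p S) \<noteq> 0"
proof -
  note f = Ch_finite[OF y(2), OF nz]
  define p where "p = Max (S \<union> msupp a)"
  have ne: "S \<union> msupp a \<noteq> {}"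
    using f(6) y(3) valid_mi_msupp[OF f(1)] by (cases "i = 0") auto
  have pS: "p \<notin> S" using y(1) f(2,5) nz unfolding reduced_def p_def by blast
  have "p \<in> S \<union> msupp a" unfolding p_def using f(2,5) ne by (intro Max_in) auto
  then have pa: "p \<in> msupp a" using pS by blast
  then have pn: "p < n" using f(4) by blast
  have "cdf n y (a(p := a p - 1)) (insert p S) \<noteq> 0"
    using reduced_cdf[OF y(1) f(2,5) ne p_def pS pn] nz by simp
  then show ?thesis using that p_def pS pn pa by blast
qed

text \<open>A reduced cycle of positive total degree is zero by \<open>reduced_cdf_Ch\<close>, so
  \<open>c\<close> is the boundary of \<open>Kh c\<close>. The condition \<open>0 < d\<close>
  excludes the class of the unit; \<open>q = 0\<close> or \<open>0 < i\<close> keeps the homotopy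
  within the allowed variables.\<close>

lemma cartan_exact:
  assumes c: "c \<in> Ch n q i d" and d: "0 < d" and qi: "q = 0 \<or> 0 < i" and z: "cdf n c = 0"
  shows "\<exists>w\<in>Ch n q (Suc i) d. c = cdf n w"
proof -
  define y where "y = c - cdf n (Kh c)"
  have K: "Kh c \<in> Ch n q (Suc i) d" by (rule Kh_Ch[OF c qi])
  have yC: "y \<in> Ch n q i d" unfolding y_def
    using cv.subspace_diff[OF subspace_Ch c cdf_Ch[OF K]] .
  have dy: "cdf n y = 0" unfolding y_def by (simp add: cdf_diff z)
  have "y a S = 0" for a S
  proof (rule ccontr)
    assume "y a S \<noteq> 0"
    from reduced_cdf_Ch[OF reduced_Kh[OF c, folded y_def] yC d this] dy
    show False by simp
  qed
  then have "y = 0" by (simp add: fun_eq_iff)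
  then show ?thesis using K unfolding y_def by auto
qed

definition mono_ideal :: "nat \<Rightarrow> nat set set \<Rightarrow> 'k::field ext set" where
  "mono_ideal n M = {f \<in> ext_carrier n. \<forall>S. f S \<noteq> 0 \<longrightarrow> S \<in> M}"

definition up_closed :: "nat \<Rightarrow> nat set set \<Rightarrow> bool" where
  "up_closed n M \<longleftrightarrow> (\<forall>S\<in>M. \<forall>j<n. insert j S \<in> M)"

definition stable :: "nat set set \<Rightarrow> bool" where
  "stable M \<longleftrightarrow> (\<forall>S\<in>M. S \<noteq> {} \<longrightarrow> (\<forall>j<Max S. j \<notin> S \<longrightarrow> insert j (S - {Max S}) \<in> M))"

lemma lid_mono_ideal:
  assumes "up_closed n M"
  shows "lid n (mono_ideal n M :: 'k::field ext set)"
proof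
  fix f g :: "'k ext" and r :: 'k and j
  show "f \<in> mono_ideal n M \<Longrightarrow> g \<in> mono_ideal n M \<Longrightarrow> f + g \<in> mono_ideal n M"
    unfolding mono_ideal_def ext_carrier_def by auto (metis add_cancel_right_left subsetD lessThan_iff, metis add_cancel_right_left)
  show "f \<in> mono_ideal n M \<Longrightarrow> fsc r f \<in> mono_ideal n M"
    unfolding mono_ideal_def ext_carrier_def by auto
  assume f: "f \<in> mono_ideal n M" and j: "j < n"
  have "T \<in> M" if "lm j f T \<noteq> 0" for T
  proof -
    have "j \<in> T" "f (T - {j}) \<noteq> 0" using that by (auto simp: lm_def split: if_splits)
    then have "T - {j} \<in> M" using f unfolding mono_ideal_def by blast
    then have "insert j (T - {j}) \<in> M" using j assms unfolding up_closed_def by blast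
    then show ?thesis using \<open>j \<in> T\<close> by (simp add: insert_absorb)
  qed
  then show "lm j f \<in> mono_ideal n M" using f j lm_carrier unfolding mono_ideal_def by blast
qed (auto simp: mono_ideal_def ext_carrier_def)

lemma Ch_carrier: "c \<in> Ch n q i d \<Longrightarrow> c b \<in> ext_carrier n"
  unfolding Ch_def ext_carrier_def by blast

text \<open>Up to a boundary, the \<open>x_q\<close>-free part of a cycle can be replaced by a
  reduced chain \<open>y\<close>. Each monomial of \<open>y\<close> times its largest
  \<open>e_p\<close> occurs in the boundary and hence lies in \<open>M\<close>; stability allows
  \<open>q\<close> in place of \<open>p\<close>, so multiplication by \<open>e_q\<close> moves
  \<open>y\<close> into the ideal and the connecting map is zero.\<close>

theorem kdm_stable:
  assumes up: "up_closed n M" and st: "stable M" and i: "0 < i" and q: "q < n"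
  shows "kdm n (mono_ideal n M :: 'k::field ext set) q i d = 0"
proof -
  let ?I = "mono_ideal n M :: 'k ext set"
  interpret I: lid n ?I by (rule lid_mono_ideal[OF up])
  have "lmc q (rs q z) \<in> Bc n ?I (Suc q) i (Suc d)" if z: "z \<in> Zc n ?I q i d" for z
  proof (cases "d = 0")
    case True
    then have "z = 0" using z Zc_Ch Ch_trivial[of d i] i by blast
    then show ?thesis using cv.subspace_0[OF I.subspace_Bc] by simp
  next
    case False
    have zC: "z \<in> Ch n q i d" using z Zc_Ch by blast
    \<comment> \<open>Terms containing \<open>e_q\<close> are killed by \<open>lmc q\<close>.
      Dropping them keeps \<open>q\<close> out of the monomials to which the exchange is
      applied.\<close>
    define c where "c = (\<lambda>a S. if q \<in> S then 0 else rs q z a S)"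
    have cC: "c \<in> Ch n (Suc q) i d" using rs_Ch[OF zC] unfolding c_def Ch_def by auto
    have lc: "lmc q c = lmc q (rs q z)" unfolding lmc_def lm_def c_def by (auto simp: fun_eq_iff)
    \<comment> \<open>Where the boundary of \<open>c\<close> is nonzero, neither \<open>e_q\<close>
      nor \<open>x_q\<close> occurs, and there it agrees with the boundary of
      \<open>z\<close>.\<close>
    have dc: "T \<in> M" if nz: "cdf n c b T \<noteq> 0" for b T
    proof -
      have "\<exists>j<n. j \<in> T \<and> c (b(j := Suc (b j))) (T - {j}) \<noteq> 0"
      proof (rule ccontr)
        assume "\<not> ?thesis"
        then have "cdf n c b T = 0" unfolding cdf_apply by (intro sum.neutral) auto
        then show False using nz by simp
      qed
      then obtain j where j: "j \<in> T" and cj: "c (b(j := Suc (b j))) (T - {j}) \<noteq> 0" by blast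
      have 1: "q \<notin> T - {j}" using cj unfolding c_def by presburger
      have 2: "(b(j := Suc (b j))) q = 0"
      proof (rule ccontr)
        assume "(b(j := Suc (b j))) q \<noteq> 0"
        then have "c (b(j := Suc (b j))) (T - {j}) = 0" unfolding c_def rs_def by (simp only: if_False zero_fun_apply if_cancel)
        then show False using cj by blast
      qed
      have "j \<noteq> q" using 2 by (metis fun_upd_same nat.distinct(1))
      then have qT: "q \<notin> T" and bq: "b q = 0" using 1 2 by simp_all
      have "cdf n c b T = cdf n z b T" unfolding cdf_apply c_def rs_def
        using qT bq by (intro sum.cong[OF refl]) auto
      then show "T \<in> M" using nz z unfolding Zc_def mono_ideal_def by auto
    qed
    define y where "y = c - cdf n (Kh c)"
    have K: "Kh c \<in> Ch n (Suc q) (Suc i) d" using Kh_Ch[OF cC] i by blast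
    have yC: "y \<in> Ch n (Suc q) i d" unfolding y_def
      using cv.subspace_diff[OF subspace_Ch cC cdf_Ch[OF K]] .
    have dy: "cdf n y = cdf n c" unfolding y_def by (simp add: cdf_diff)
    have red: "reduced y" unfolding y_def by (rule reduced_Kh[OF cC])
    have lyC: "lmc q y \<in> Ch n (Suc q) i (Suc d)" by (rule lmc_Ch[OF yC q])
    have "T \<in> M" if nz: "lmc q y a T \<noteq> 0" for a T
    proof -
      have qT: "q \<in> T" and ya: "y a (T - {q}) \<noteq> 0"
        using nz by (auto simp: lmc_def lm_def split: if_splits)
      define S where "S = T - {q}"
      from reduced_cdf_Ch[OF red yC _ ya[folded S_def]] False
      obtain p where p: "p = Max (S \<union> msupp a)" "p \<notin> S" "p < n" "p \<in> msupp a"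
        "cdf n y (a(p := a p - 1)) (insert p S) \<noteq> 0" by blast
      have M: "insert p S \<in> M" using dc p(5) unfolding dy by blast
      have f: "finite S" "finite (msupp a)" "msupp a \<subseteq> {Suc q..}" using Ch_finite[OF yC, OF ya] S_def by auto
      have "Max (insert p S) = p" using f p(1) by (intro Max_eqI) auto
      moreover have "q < p" using f(3) p(4) by auto
      moreover have "q \<notin> insert p S" using \<open>q < p\<close> S_def by auto
      ultimately have "insert q (insert p S - {p}) \<in> M" using st M unfolding stable_def by auto
      moreover have "insert q (insert p S - {p}) = T" using p(2) qT unfolding S_def by auto
      ultimately show ?thesis by simp
    qed
    then have "lmc q y \<in> Jc n ?I (Suc q) i (Suc d)"
      using lyC Ch_carrier[OF lyC] unfolding Jc_def mono_ideal_def by auto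
    moreover have "- lmc q (Kh c) \<in> Ch n (Suc q) (Suc i) (Suc d)"
      using cv.subspace_neg[OF subspace_Ch lmc_Ch[OF K q]] .
    moreover have "lmc q (rs q z) = cdf n (- lmc q (Kh c)) + lmc q y"
      unfolding lc[symmetric] y_def by (simp add: cdf_neg cdf_lmc lmc_diff)
    ultimately show ?thesis unfolding Bc_def by blast
  qed
  then have "sh q ` Zc n ?I q (Suc i) (Suc d) = Zc n ?I q i d"
    using I.delta_kernel[OF _ q] I.sh_Zc[OF _ q] by blast
  then show ?thesis unfolding kdm_def by simp
qed


section \<open>Leading monomials in the revlex order and homology in degree zero\<close>

text \<open>A larger monomial in the revlex order has a smaller binary encoding.\<close>

abbreviation enc :: "nat set \<Rightarrow> nat" where "enc \<equiv> set_encode"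

lemma set_encode_less:
  assumes fin: "finite S" "finite T" and m: "m \<in> T" "m \<notin> S"
    and above: "\<And>k. m < k \<Longrightarrow> k \<in> S \<longleftrightarrow> k \<in> T"
  shows "enc S < enc T"
proof -
  have split: "enc X = sum ((^) 2) {k\<in>X. k < m} + sum ((^) 2) {k\<in>X. m \<le> k}" if "finite X" for X
  proof -
    have "X = {k\<in>X. k < m} \<union> {k\<in>X. m \<le> k}" by auto
    then show ?thesis unfolding set_encode_def using that
      by (metis (no_types, lifting) sum.union_disjoint finite_Un disjoint_iff mem_Collect_eq not_less)
  qed
  have "sum ((^) 2) {k\<in>S. k < m} \<le> sum ((^) (2::nat)) {..<m}"
    by (rule sum_mono2) auto
  also have "\<dots> < 2 ^ m" by (induct m) auto
  finally have 1: "sum ((^) 2) {k\<in>S. k < m} < (2::nat) ^ m" .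
  have "{k\<in>T. m \<le> k} = insert m {k\<in>S. m \<le> k}"
    using m above by (auto simp: le_less)
  then have "sum ((^) (2::nat)) {k\<in>T. m \<le> k} = 2 ^ m + sum ((^) 2) {k\<in>S. m \<le> k}"
    using fin m by simp
  then show ?thesis using split[OF fin(1)] split[OF fin(2)] 1 by linarith
qed

lemma revlex_gt_enc:
  assumes "finite S" "finite T"
  shows "revlex_gt S T \<longleftrightarrow> enc S < enc T"
proof (cases "S = T")
  case False
  define m where "m = Max ((S - T) \<union> (T - S))"
  have ne: "(S - T) \<union> (T - S) \<noteq> {}" and fin: "finite ((S - T) \<union> (T - S))" using False assms by auto
  have mi: "m \<in> (S - T) \<union> (T - S)" unfolding m_def by (rule Max_in[OF fin ne])
  have ab: "k \<in> S \<longleftrightarrow> k \<in> T" if "m < k" for k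
  proof (rule ccontr)
    assume "\<not> (k \<in> S \<longleftrightarrow> k \<in> T)"
    then have "k \<le> m" unfolding m_def using fin by (intro Max_ge) auto
    then show False using that by simp
  qed
  show ?thesis
  proof (cases "m \<in> T")
    case True
    then have "enc S < enc T" using set_encode_less[OF assms True] mi ab by blast
    then show ?thesis using True False unfolding revlex_gt_def m_def by simp
  next
    case nT: False
    then have "enc T < enc S" using set_encode_less[OF assms(2,1), of m] mi ab by blast
    then show ?thesis using nT False unfolding revlex_gt_def m_def by simp
  qed
qed (simp add: revlex_gt_def)

definition leads :: "'k::field ext set \<Rightarrow> nat set set" where
  "leads U = {S. \<exists>f\<in>U. is_lead f S}"

definition hpart :: "nat \<Rightarrow> 'k::field ext set \<Rightarrow> 'k ext set" where
  "hpart d J = {f \<in> J. homogeneous d f}"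

lemma carrier_finite: "f \<in> ext_carrier n \<Longrightarrow> f S \<noteq> 0 \<Longrightarrow> S \<subseteq> {..<n} \<and> finite S"
  unfolding ext_carrier_def using finite_subset by blast

lemma is_lead_enc:
  assumes "f \<in> ext_carrier n"
  shows "is_lead f S \<longleftrightarrow> f S \<noteq> 0 \<and> (\<forall>T. T \<noteq> S \<longrightarrow> f T \<noteq> 0 \<longrightarrow> enc S < enc T)"
proof (cases "f S = 0")
  case False
  then have "finite S" using carrier_finite[OF assms] by blast
  then have "revlex_gt S T \<longleftrightarrow> enc S < enc T" if "f T \<noteq> 0" for T
    using revlex_gt_enc carrier_finite[OF assms that] by blast
  then show ?thesis unfolding is_lead_def by blast
qed (simp add: is_lead_def)

lemma is_lead_ge: 
  assumes "f \<in> ext_carrier n" "is_lead f S" "f T \<noteq> 0"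
  shows "enc S \<le> enc T"
  using assms is_lead_enc[OF assms(1)] by (cases "T = S") (auto simp: less_imp_le)

lemma leads_subset: "U \<subseteq> ext_carrier n \<Longrightarrow> leads U \<subseteq> Pow {..<n}"
  unfolding leads_def is_lead_def ext_carrier_def by auto

lemma dim_singleton_span: "v \<noteq> 0 \<Longrightarrow> fv.dim (fv.span {v}) = 1"
  using fv.dim_span_eq_card_independent[of "{v}"] by simp

lemma fv_subspace_restrict:
  "fv.subspace U \<Longrightarrow> fv.subspace {f \<in> U. f x = 0}"
  unfolding fv.subspace_def by auto

text \<open>Induction on the possible support. For the largest monomial \<open>x\<close> of
  \<open>X\<close>, evaluation at \<open>x\<close> is either zero on \<open>U\<close> or has rank
  one; in the second case its kernel loses exactly the leading monomial \<open>x\<close>.\<close>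

lemma dim_leads:
  assumes "finite X" "X \<subseteq> Pow {..<n}" "fv.subspace (U :: 'k::field ext set)"
    "\<And>f S. f \<in> U \<Longrightarrow> f S \<noteq> 0 \<Longrightarrow> S \<in> X"
  shows "fv.dim U = card (leads U) \<and> fv.fin_dim U"
  using assms
proof (induct "card X" arbitrary: X U)
  case 0
  then have X: "X = {}" by simp
  have "U = {0}"
  proof
    have "f = 0" if "f \<in> U" for f
    proof
      fix S show "f S = 0 S" using 0(5)[OF that, of S] unfolding X by auto
    qed
    then show "U \<subseteq> {0}" by blast
    show "{0} \<subseteq> U" using fv.subspace_0[OF 0(4)] by simp
  qed
  moreover have "leads {0::'k ext} = {}" unfolding leads_def is_lead_def by auto
  moreover have "fv.fin_dim ({0} :: 'k ext set)"
    unfolding fv.fin_dim_def by (intro exI[of _ "{}"] conjI) (auto simp: fv.span_zero)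
  ultimately show ?case using fv.dim_subspace_0 by (simp only: card.empty)
next
  case (Suc m)
  then have ne: "X \<noteq> {}" by auto
  define x where "x = arg_min_on enc X"
  have xX: "x \<in> X" and xmin: "\<And>y. y \<in> X \<Longrightarrow> enc x \<le> enc y"
    unfolding x_def using arg_min_if_finite(1)[OF Suc(3) ne] arg_min_least[OF Suc(3) ne] by auto
  have xmin': "enc x < enc y" if "y \<in> X" "y \<noteq> x" for y
  proof -
    have "finite x" "finite y" using xX that(1) Suc(4) by (auto intro: finite_subset)
    then show ?thesis using xmin[OF that(1)] that(2) set_encode_eq[of x y] by force
  qed
  have carr: "U \<subseteq> ext_carrier n" using Suc(4,6) unfolding ext_carrier_def by blast
  let ?V = "{f \<in> U. f x = 0}"
  define p where "p = (\<lambda>f::'k ext. fsc (f x) (ext_mono x))"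
  have linp: "Vector_Spaces.linear fsc fsc p"
    by unfold_locales (auto simp: p_def fun_eq_iff algebra_simps)
  have mono_nz: "ext_mono x \<noteq> (0::'k ext)" by (auto simp: ext_mono_def fun_eq_iff)
  then have p0: "p f = 0 \<longleftrightarrow> f x = 0" for f unfolding p_def by simp
  have IH: "fv.dim ?V = card (leads ?V) \<and> fv.fin_dim ?V"
  proof (rule Suc(1)[of "X - {x}"])
    show "m = card (X - {x})" using Suc(2,3) xX by simp
    show "fv.subspace ?V" by (rule fv_subspace_restrict[OF Suc(5)])
  qed (use Suc(3,4,6) in auto)
  have lead_x: "is_lead f x" if "f \<in> U" "f x \<noteq> 0" for f
    using is_lead_enc[of f n x] carr that Suc(6) xmin' by blast
  show ?case
  proof (cases "\<exists>f\<in>U. f x \<noteq> 0")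
    case False
    then have "?V = U" by auto
    then show ?thesis using IH by simp
  next
    case True
    then obtain g where g: "g \<in> U" "g x \<noteq> 0" by blast
    have im: "p ` U = fv.span {ext_mono x}"
    proof
      show "p ` U \<subseteq> fv.span {ext_mono x}" unfolding p_def by (auto intro: fv.span_scale fv.span_base)
      show "fv.span {ext_mono x} \<subseteq> p ` U"
      proof
        fix h assume "h \<in> fv.span {ext_mono x :: 'k ext}"
        then obtain c where h: "h = fsc c (ext_mono x)" by (auto simp: fv.span_singleton)
        have "p (fsc (c / g x) g) = h" unfolding h p_def using g(2) by simp
        then show "h \<in> p ` U" using fv.subspace_scale[OF Suc(5) g(1)] by (metis imageI)
      qed
    qed
    have V0: "{f \<in> U. p f = 0} = ?V" using p0 by auto
    obtain B where B: "finite B" "?V \<subseteq> fv.span B" using IH unfolding fv.fin_dim_def by blast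
    have "U \<subseteq> fv.span (insert g B)"
    proof
      fix f assume f: "f \<in> U"
      let ?h = "f - fsc (f x / g x) g"
      have "?h \<in> ?V" using g f fv.subspace_diff[OF Suc(5) f fv.subspace_scale[OF Suc(5) g(1)]] by simp
      then have "?h \<in> fv.span (insert g B)" using B(2) fv.span_mono[of B "insert g B"] by blast
      moreover have "fsc (f x / g x) g \<in> fv.span (insert g B)"
        by (intro fv.span_scale fv.span_base) simp
      ultimately have "?h + fsc (f x / g x) g \<in> fv.span (insert g B)" by (rule fv.span_add)
      then show "f \<in> fv.span (insert g B)" by (simp only: diff_add_cancel)
    qed
    then have fd: "fv.fin_dim U" unfolding fv.fin_dim_def using B(1) by (intro exI[of _ "insert g B"]) auto
    have d: "fv.dim U = fv.dim ?V + 1"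
      using ff.rank_nullity(1)[OF Suc(5) fd linp] unfolding V0 im dim_singleton_span[OF mono_nz] .
    have "leads U = insert x (leads ?V)"
    proof
      show "leads U \<subseteq> insert x (leads ?V)"
      proof
        fix S assume "S \<in> leads U"
        then obtain f where f: "f \<in> U" "is_lead f S" unfolding leads_def by blast
        show "S \<in> insert x (leads ?V)"
        proof (cases "f x = 0")
          case True then show ?thesis using f unfolding leads_def by blast
        next
          case False
          have fS: "f S \<noteq> 0" using f(2) unfolding is_lead_def by blast
          have "enc x \<le> enc S" using xmin Suc(6)[OF f(1) fS] by blast
          moreover have "enc S \<le> enc x" using is_lead_ge[OF _ f(2) False] f(1) carr by blast
          ultimately show ?thesis using xmin'[of S] Suc(6)[OF f(1) fS] by auto
        qed
      qed
      show "insert x (leads ?V) \<subseteq> leads U" using lead_x[OF g] g(1) unfolding leads_def by blast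
    qed
    moreover have "x \<notin> leads ?V" unfolding leads_def is_lead_def by auto
    moreover have "finite (leads ?V)"
      by (rule finite_subset[OF leads_subset[of ?V n]]) (use carr in auto)
    ultimately show ?thesis using d IH fd by simp
  qed
qed

definition restr :: "(nat set \<Rightarrow> bool) \<Rightarrow> 'k::field ext \<Rightarrow> 'k ext" where
  "restr P f = (\<lambda>S. if P S then f S else 0)"

lemma lin_restr: "Vector_Spaces.linear fsc fsc (restr P)"
  by unfold_locales (auto simp: restr_def fun_eq_iff)

text \<open>\<open>P\<close> contains with a monomial all larger ones, so truncation deletes only
  terms smaller than those kept; a leading monomial either survives as such or the whole element is
  cut to zero.\<close>

lemma leads_restr:
  assumes J: "J \<subseteq> ext_carrier n"
    and P: "\<And>S T. finite S \<Longrightarrow> finite T \<Longrightarrow> P T \<Longrightarrow> enc S < enc T \<Longrightarrow> P S"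
  shows "leads (restr P ` J) = {S \<in> leads J. P S}"
proof
  have lc: "restr P f \<in> ext_carrier n" if "f \<in> J" for f
    using that J unfolding restr_def ext_carrier_def by auto
  show "{S \<in> leads J. P S} \<subseteq> leads (restr P ` J)"
  proof
    fix S assume "S \<in> {S \<in> leads J. P S}"
    then obtain f where f: "f \<in> J" "is_lead f S" and S: "P S" unfolding leads_def by blast
    have "is_lead (restr P f) S" using f(2) S unfolding is_lead_def restr_def by auto
    then show "S \<in> leads (restr P ` J)" using f(1) unfolding leads_def by blast
  qed
  show "leads (restr P ` J) \<subseteq> {S \<in> leads J. P S}"
  proof
    fix S assume "S \<in> leads (restr P ` J)"
    then obtain f where f: "f \<in> J" "is_lead (restr P f) S" unfolding leads_def by blast
    have fc: "f \<in> ext_carrier n" using f(1) J by blast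
    have S: "P S" "f S \<noteq> 0" using f(2) unfolding is_lead_def restr_def by (auto split: if_splits)
    have finS: "finite S" using carrier_finite[OF fc S(2)] by simp
    have "enc S < enc T" if T: "T \<noteq> S" "f T \<noteq> 0" for T
    proof (cases "P T")
      case True
      then show ?thesis using f(2) T is_lead_enc[OF lc[OF f(1)]] unfolding restr_def by auto
    next
      case False
      have fT: "finite T" using carrier_finite[OF fc T(2)] by simp
      have "\<not> enc T < enc S" using P[OF fT finS S(1)] False by blast
      moreover have "enc T \<noteq> enc S" using set_encode_eq[OF fT finS] T(1) by simp
      ultimately show ?thesis by simp
    qed
    then have "is_lead f S" using is_lead_enc[OF fc] S(2) by blast
    then show "S \<in> {S \<in> leads J. P S}" using f(1) S(1) unfolding leads_def by blast
  qed
qed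

text \<open>The property that distinguishes the reverse lexicographic order: whatever is larger than
  a monomial in the variables below \<open>q\<close> also uses only these. It makes leading terms
  compatible with reduction modulo the last variables.\<close>

lemma set_encode_less_below:
  assumes "finite S" "finite T" "T \<subseteq> {..<q}" "enc S < enc T"
  shows "S \<subseteq> {..<q}"
proof (rule ccontr)
  assume "\<not> S \<subseteq> {..<q}"
  then obtain k where k: "k \<in> S" "q \<le> k" by (metis lessThan_iff not_less subsetI)
  have "enc T < enc {k}" using set_encode_less[of T "{k}" k] assms(2,3) k(2) by fastforce
  also have "enc {k} \<le> enc S" unfolding set_encode_def using assms(1) k(1)
    by (auto intro!: member_le_sum)
  finally show False using assms(4) by simp
qed

abbreviation lowpart :: "nat \<Rightarrow> 'k::field ext \<Rightarrow> 'k ext" where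
  "lowpart q \<equiv> restr (\<lambda>S. S \<subseteq> {..<q})"

lemma leads_lowpart:
  assumes "J \<subseteq> ext_carrier n"
  shows "leads (lowpart q ` J) = {S \<in> leads J. S \<subseteq> {..<q}}"
  by (rule leads_restr[OF assms]) (rule set_encode_less_below)

lemma Ch_0_eq:
  "Ch n q 0 d = {\<lambda>a. if a = (\<lambda>_. 0) then f else 0 | f. f \<in> hpart d (ext_carrier n)}"
  (is "_ = ?R")
proof
  have v0: "valid_mi n 0 a \<longleftrightarrow> a = (\<lambda>_. 0)" for a
  proof
    assume a: "valid_mi n 0 a"
    show "a = (\<lambda>_. 0)"
    proof
      fix j
      have "(\<Sum>j<n. a j) = 0" using a unfolding valid_mi_def by blast
      then show "a j = 0" using a unfolding valid_mi_def by (cases "j < n") auto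
    qed
  qed (simp add: valid_mi_def)
  show "Ch n q 0 d \<subseteq> ?R"
  proof
    fix c :: "'a chain" assume c: "c \<in> Ch n q 0 d"
    have "c (\<lambda>_. 0) \<in> hpart d (ext_carrier n)"
      using c unfolding Ch_def hpart_def ext_carrier_def homogeneous_def by auto
    moreover have "c = (\<lambda>a. if a = (\<lambda>_. 0) then c (\<lambda>_. 0) else 0)"
    proof (intro ext)
      fix a S
      show "c a S = (if a = (\<lambda>_. 0) then c (\<lambda>_. 0) else 0) S"
        using c v0[of a] unfolding Ch_def by (cases "c a S = 0") auto
    qed
    ultimately show "c \<in> ?R" by blast
  qed
  show "?R \<subseteq> Ch n q 0 d"
  proof
    fix c :: "'a chain" assume "c \<in> ?R"
    then obtain f where f: "f \<in> hpart d (ext_carrier n)"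
      and c: "c = (\<lambda>a. if a = (\<lambda>_. 0) then f else 0)" by blast
    have "a = (\<lambda>_. 0) \<and> f S \<noteq> 0" if "c a S \<noteq> 0" for a S
      using that unfolding c by (cases "a = (\<lambda>_. 0)") auto
    then show "c \<in> Ch n q 0 d"
      using f v0 unfolding Ch_def hpart_def ext_carrier_def homogeneous_def by fastforce
  qed
qed

lemma hpart_subspace: "fv.subspace J \<Longrightarrow> fv.subspace (hpart d J)"
  unfolding fv.subspace_def hpart_def homogeneous_def
  by auto (metis add_cancel_right_left)

context lid begin

text \<open>Homology in degree 0 is \<open>E\<close> modulo \<open>J\<close> and the variables from
  \<open>q\<close> on. The map \<open>lowpart q\<close> realizes the reduction modulo these
  variables, and the dimension of the image of \<open>J\<close> is counted by leading
  monomials.\<close>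

lemma hdm_0:
  assumes q: "q \<le> n"
  shows "hdm n J q 0 d = int (card {S. S \<subseteq> {..<q} \<and> card S = d})
    - int (card {S \<in> leads (hpart d J). S \<subseteq> {..<q}})"
proof -
  define p where "p = (\<lambda>c::'k chain. lowpart q (c (\<lambda>_. 0)))"
  have lin: "Vector_Spaces.linear csc fsc p"
    by unfold_locales (auto simp: p_def restr_def fun_eq_iff)
  have pC: "p ` Ch n q 0 d = lowpart q ` hpart d (ext_carrier n)"
  proof
    show "p ` Ch n q 0 d \<subseteq> lowpart q ` hpart d (ext_carrier n)"
      unfolding Ch_0_eq p_def by auto
    have "lowpart q f \<in> p ` Ch n q 0 d" if "f \<in> hpart d (ext_carrier n)" for f
      using that unfolding Ch_0_eq p_def
      by (intro image_eqI[of _ _ "\<lambda>a. if a = (\<lambda>_. 0) then f else 0"]) auto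
    then show "lowpart q ` hpart d (ext_carrier n) \<subseteq> p ` Ch n q 0 d" by blast
  qed
  have pB: "p ` Bc n J q 0 d = lowpart q ` hpart d J"
  proof
    have pd: "p (cdf n w) = 0" if w: "w \<in> Ch n q (Suc 0) d" for w
    proof -
      have "cdf n w (\<lambda>_. 0) S = 0" if S: "S \<subseteq> {..<q}" for S
        unfolding cdf_apply
      proof (rule sum.neutral, intro ballI)
        fix j assume "j \<in> {..<n}"
        have "w ((\<lambda>_. 0)(j := Suc 0)) (S - {j}) = 0" if "j \<in> S"
        proof (rule ccontr)
          assume "w ((\<lambda>_. 0)(j := Suc 0)) (S - {j}) \<noteq> 0"
          then have "\<forall>i<q. ((\<lambda>_. 0)(j := Suc 0)) i = 0" using w unfolding Ch_def by blast
          then show False using S that by auto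
        qed
        then show "(if j \<in> S then sg j S * w ((\<lambda>_. 0)(j := Suc 0)) (S - {j}) else 0) = 0" by simp
      qed
      then show ?thesis unfolding p_def restr_def by (auto simp: fun_eq_iff)
    qed
    show "p ` Bc n J q 0 d \<subseteq> lowpart q ` hpart d J"
    proof
      fix x assume "x \<in> p ` Bc n J q 0 d"
      then obtain w l where w: "w \<in> Ch n q (Suc 0) d" and l: "l \<in> Jc n J q 0 d"
        and x: "x = p (cdf n w + l)" unfolding Bc_def by blast
      have "x = p l" unfolding x using pd[OF w] cf.linear_add[OF lin] by simp
      moreover have "l (\<lambda>_. 0) \<in> hpart d J"
        using l unfolding Jc_def Ch_def hpart_def homogeneous_def by auto
      ultimately show "x \<in> lowpart q ` hpart d J" unfolding p_def by blast
    qed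
    show "lowpart q ` hpart d J \<subseteq> p ` Bc n J q 0 d"
    proof
      fix x assume "x \<in> lowpart q ` hpart d J"
      then obtain f where f: "f \<in> hpart d J" "x = lowpart q f" by blast
      define l where "l = (\<lambda>a::nat\<Rightarrow>nat. if a = (\<lambda>_. 0) then f else 0)"
      have "f \<in> hpart d (ext_carrier n)" using f(1) J_carrier unfolding hpart_def by blast
      then have "l \<in> Ch n q 0 d" unfolding Ch_0_eq l_def by blast
      then have "l \<in> Jc n J q 0 d" using f(1) J_0 unfolding Jc_def l_def hpart_def by auto
      then show "x \<in> p ` Bc n J q 0 d" using Jc_Bc f(2) unfolding p_def
        by (intro image_eqI[of _ _ l]) (auto simp: l_def)
    qed
  qed
  \<comment> \<open>Every term of such a chain has an index at least \<open>q\<close>, so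
    \<open>Kh\<close> stays within the allowed variables; at exponent zero a reduced chain can only
    have a constant term, which is absent here.\<close>
  have ker: "{c \<in> Ch n q 0 d. p c = 0} \<subseteq> Bc n J q 0 d"
  proof
    fix c assume "c \<in> {c \<in> Ch n q 0 d. p c = 0}"
    then have c: "c \<in> Ch n q 0 d" and pc: "p c = 0" by auto
    have a0: "a = (\<lambda>_. 0)" if "c a S \<noteq> 0" for a S
    proof (rule ccontr)
      assume "a \<noteq> (\<lambda>_. 0)"
      then have "c a S = 0" using c unfolding Ch_0_eq by auto
      then show False using that by simp
    qed
    have low: "\<not> S \<subseteq> {..<q}" if "c a S \<noteq> 0" for a S
    proof
      assume S: "S \<subseteq> {..<q}"
      have "p c S = c (\<lambda>_. 0) S" using S by (simp add: p_def restr_def)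
      then show False using pc that a0[OF that] by simp
    qed
    have K: "Kh c \<in> Ch n q (Suc 0) d" by (rule Kh_Ch_general[OF c]) (use low in blast)
    have KC: "cdf n (Kh c) \<in> Ch n q 0 d" by (rule cdf_Ch[OF K])
    have "c a S = cdf n (Kh c) a S" for a S
    proof (rule ccontr)
      assume ne: "c a S \<noteq> cdf n (Kh c) a S"
      define y where "y = c - cdf n (Kh c)"
      have y: "y \<in> Ch n q 0 d" unfolding y_def by (rule cv.subspace_diff[OF subspace_Ch c KC])
      have nz: "y a S \<noteq> 0" using ne unfolding y_def by simp
      note f = Ch_finite[OF y, OF nz]
      have "a = (\<lambda>_. 0)"
      proof (rule ccontr)
        assume "a \<noteq> (\<lambda>_. 0)"
        then have "y a S = 0" using y unfolding Ch_0_eq by auto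
        then show False using nz by simp
      qed
      then have m0: "msupp a = {}" by simp
      show False
      proof (cases "S = {}")
        case True
        then have "c a S = 0" using low[of a S] by auto
        moreover have "cdf n (Kh c) a S = 0" unfolding cdf_apply True by simp
        ultimately show False using ne by simp
      next
        case False
        then have "Max (S \<union> msupp a) \<in> S" using f(2) Max_in[of S] unfolding m0 by simp
        then show False using reduced_Kh[OF c] nz f(2,5) unfolding reduced_def y_def by blast
      qed
    qed
    then have "c = cdf n (Kh c)" by (simp add: fun_eq_iff)
    then show "c \<in> Bc n J q 0 d" using cdf_Bc[OF K] by simp
  qed
  have "{c \<in> Bc n J q 0 d. p c = 0} = {c \<in> Ch n q 0 d. p c = 0}"
    using ker Bc_Zc Zc_Ch by blast
  then have h: "hdm n J q 0 d = int (fv.dim (lowpart q ` hpart d (ext_carrier n :: 'k ext set)))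
      - int (fv.dim (lowpart q ` hpart d J))"
    using cf.rank_nullity(1)[OF subspace_Ch fin_dim_Ch lin, of n q 0 d]
      cf.rank_nullity(1)[OF subspace_Bc fin_dim_Bc lin, of q 0 d]
    unfolding hdm_def Zc_0 pC pB by simp
  have dl: "fv.dim (lowpart q ` hpart d U) = card {S \<in> leads (hpart d U). S \<subseteq> {..<q}}"
    if U: "fv.subspace U" "U \<subseteq> ext_carrier n" for U :: "'k ext set"
  proof -
    have hU: "hpart d U \<subseteq> ext_carrier n" using U(2) unfolding hpart_def by blast
    have "fv.dim (lowpart q ` hpart d U) = card (leads (lowpart q ` hpart d U))"
    proof (rule dim_leads[THEN conjunct1])
      show "finite (Pow {..<n})" "Pow {..<n} \<subseteq> Pow {..<n}" by auto
      show "fv.subspace (lowpart q ` hpart d U)"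
        by (rule ff.linear_subspace_image[OF lin_restr hpart_subspace[OF U(1)]])
      fix f S assume "f \<in> lowpart q ` hpart d U" "f S \<noteq> 0"
      then obtain g where "g \<in> hpart d U" "g S \<noteq> 0"
        unfolding restr_def by (auto split: if_splits)
      then show "S \<in> Pow {..<n}" using hU carrier_finite by blast
    qed
    then show ?thesis using leads_lowpart[OF hU] by simp
  qed
  have E: "fv.subspace (ext_carrier n :: 'k ext set)"
    unfolding fv.subspace_def ext_carrier_def by auto (metis add_cancel_right_left lessThan_iff subsetD)
  have "{S \<in> leads (hpart d (ext_carrier n :: 'k ext set)). S \<subseteq> {..<q}} = {S. S \<subseteq> {..<q} \<and> card S = d}"
  proof
    show "{S \<in> leads (hpart d (ext_carrier n :: 'k ext set)). S \<subseteq> {..<q}} \<subseteq> {S. S \<subseteq> {..<q} \<and> card S = d}"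
      unfolding leads_def hpart_def is_lead_def homogeneous_def by auto
    have "S \<in> leads (hpart d (ext_carrier n :: 'k ext set))" if "S \<subseteq> {..<q}" "card S = d" for S
    proof -
      have "(ext_mono S :: 'k ext) \<in> hpart d (ext_carrier n)"
        using that q unfolding hpart_def ext_carrier_def homogeneous_def ext_mono_def by auto
      moreover have "is_lead (ext_mono S :: 'k ext) S" unfolding is_lead_def ext_mono_def by simp
      ultimately show ?thesis unfolding leads_def by blast
    qed
    then show "{S. S \<subseteq> {..<q} \<and> card S = d} \<subseteq> {S \<in> leads (hpart d (ext_carrier n :: 'k ext set)). S \<subseteq> {..<q}}"
      by blast
  qed
  then show ?thesis using h dl[OF E subset_refl] dl[OF subspace_J J_carrier] by simp
qed

end


subsection \<open>Ideals and initial ideals\<close>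

lemma ext_mult_apply_finite_0:
  assumes "\<And>S. S \<subseteq> T \<Longrightarrow> f S = 0 \<or> g (T - S) = 0"
  shows "ext_mult f g T = 0"
  unfolding ext_mult_def by (rule sum.neutral) (use assms in auto)

lemma ext_mult_scalar:
  assumes "f \<in> ext_carrier n"
  shows "ext_mult (fsc r (ext_mono {})) f = fsc r f"
proof
  fix T
  show "ext_mult (fsc r (ext_mono {})) f T = fsc r f T"
  proof (cases "finite T")
    case True
    have "ext_mult (fsc r (ext_mono {})) f T = (\<Sum>S\<in>Pow T. if S = {} then r * f T else 0)"
      unfolding ext_mult_def by (rule sum.cong) (auto simp: ext_mono_def ext_sign_def)
    then show ?thesis using True by simp
  next
    case False
    then have "f T = 0" using carrier_finite[OF assms] by blast
    then show ?thesis using False by (simp add: ext_mult_def)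
  qed
qed

lemma ext_mono_carrier: "S \<subseteq> {..<n} \<Longrightarrow> ext_mono S \<in> ext_carrier n"
  unfolding ext_mono_def ext_carrier_def by auto

lemma subspace_ext_carrier: "fv.subspace (ext_carrier n :: 'k::field ext set)"
  unfolding fv.subspace_def ext_carrier_def by auto (metis add_cancel_right_left lessThan_iff subsetD)

lemma ext_ideal_lid:
  assumes I: "ext_ideal n I"
  shows "lid n I"
proof
  have c: "I \<subseteq> ext_carrier n" and m: "\<And>f a. f \<in> I \<Longrightarrow> a \<in> ext_carrier n \<Longrightarrow> ext_mult a f \<in> I"
    using I unfolding ext_ideal_def by auto
  show "I \<subseteq> ext_carrier n" "0 \<in> I" using I unfolding ext_ideal_def by auto
  show "f \<in> I \<Longrightarrow> g \<in> I \<Longrightarrow> f + g \<in> I" for f g using I unfolding ext_ideal_def by auto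
  show "fsc r f \<in> I" if f: "f \<in> I" for f r
  proof -
    have "ext_mult (fsc r (ext_mono {})) f \<in> I"
      by (rule m[OF f]) (intro fv.subspace_scale[OF subspace_ext_carrier] ext_mono_carrier, simp)
    then show ?thesis using ext_mult_scalar f c by (metis subsetD)
  qed
  show "lm j f \<in> I" if f: "f \<in> I" and j: "j < n" for f j
  proof -
    have "ext_mult (ext_mono {j}) f \<in> I" by (rule m[OF f]) (use j in \<open>auto intro: ext_mono_carrier\<close>)
    then show ?thesis using ext_mult_mono_left f c by (metis subsetD)
  qed
qed

lemma carrier_expand:
  assumes "f \<in> ext_carrier n"
  shows "f = (\<Sum>S\<in>Pow {..<n}. fsc (f S) (ext_mono S))"
proof
  fix T
  have "(\<Sum>S\<in>Pow {..<n}. fsc (f S) (ext_mono S)) T = (\<Sum>S\<in>Pow {..<n}. if S = T then f T else 0)"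
    unfolding sum_fun_apply by (rule sum.cong) (auto simp: ext_mono_def)
  also have "\<dots> = f T" using assms unfolding ext_carrier_def by auto
  finally show "f T = (\<Sum>S\<in>Pow {..<n}. fsc (f S) (ext_mono S)) T" by simp
qed

lemma up_closed_superset:
  assumes "up_closed n M" "S \<in> M" "R \<subseteq> {..<n}"
  shows "R \<union> S \<in> M"
proof -
  have "finite R" using assms(3) finite_subset by blast
  then show ?thesis using assms(3)
    by (induct R) (use assms in \<open>auto simp: up_closed_def\<close>)
qed

lemma ext_ideal_mono_ideal:
  assumes up: "up_closed n M"
  shows "ext_ideal n (mono_ideal n M :: 'k::field ext set)"
proof -
  interpret I: lid n "mono_ideal n M :: 'k ext set" by (rule lid_mono_ideal[OF up])
  have mult: "ext_mult f g \<in> mono_ideal n M"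
    if f: "f \<in> ext_carrier n" and g: "g \<in> ext_carrier n" and fg: "f \<in> mono_ideal n M \<or> g \<in> mono_ideal n M"
    for f g :: "'k ext"
  proof -
    have "T \<subseteq> {..<n} \<and> T \<in> M" if nz: "ext_mult f g T \<noteq> 0" for T
    proof -
      obtain S where S: "S \<subseteq> T" "f S \<noteq> 0" "g (T - S) \<noteq> 0"
        using nz ext_mult_apply_finite_0[of T f g] by blast
      have s: "S \<subseteq> {..<n}" "T - S \<subseteq> {..<n}" using S f g unfolding ext_carrier_def by auto
      have "S \<in> M \<or> T - S \<in> M" using S(2,3) fg unfolding mono_ideal_def by auto
      then have "(T - S) \<union> S \<in> M \<or> S \<union> (T - S) \<in> M"
        using up_closed_superset[OF up _ s(1)] up_closed_superset[OF up _ s(2)] by metis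
      moreover have e: "(T - S) \<union> S = T" "S \<union> (T - S) = T" using S(1) by auto
      moreover have "T \<subseteq> {..<n}" using s e by (metis Un_least)
      ultimately show ?thesis by simp
    qed
    then show ?thesis unfolding mono_ideal_def ext_carrier_def by blast
  qed
  show ?thesis unfolding ext_ideal_def using mult I.J_carrier I.J_0 I.J_add by blast
qed

lemma mono_ideal_generated:
  assumes up: "up_closed n M" and M: "M \<subseteq> Pow {..<n}"
  shows "ideal_gen n (ext_mono ` M) = (mono_ideal n M :: 'k::field ext set)"
proof
  have "(ext_mono S :: 'k ext) \<in> mono_ideal n M" if S: "S \<in> M" for S
  proof -
    have "(ext_mono S :: 'k ext) \<in> ext_carrier n" using S M by (intro ext_mono_carrier) auto
    moreover have "T \<in> M" if "(ext_mono S :: 'k ext) T \<noteq> 0" for T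
      using that S unfolding ext_mono_def by (cases "T = S") auto
    ultimately show ?thesis unfolding mono_ideal_def by blast
  qed
  then have "ext_mono ` M \<subseteq> (mono_ideal n M :: 'k ext set)" by blast
  then show "ideal_gen n (ext_mono ` M) \<subseteq> (mono_ideal n M :: 'k ext set)"
    unfolding ideal_gen_def using ext_ideal_mono_ideal[OF up] by blast
  have "f \<in> I" if f: "f \<in> mono_ideal n M" and I: "ext_ideal n I" "ext_mono ` M \<subseteq> I" for f :: "'k ext" and I
  proof -
    interpret I: lid n I by (rule ext_ideal_lid[OF I(1)])
    have "(\<Sum>S\<in>Pow {..<n}. fsc (f S) (ext_mono S)) \<in> I"
    proof (rule I.J_sum)
      fix S
      show "fsc (f S) (ext_mono S) \<in> I"
      proof (cases "f S = 0")
        case True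
        then have "fsc (f S) (ext_mono S :: 'k ext) = 0" by simp
        then show ?thesis using I.J_0 by (simp only:)
      next
        case False
        then show ?thesis using f I(2) I.J_fsc unfolding mono_ideal_def by blast
      qed
    qed
    then show ?thesis using carrier_expand[of f n] f unfolding mono_ideal_def by simp
  qed
  then show "(mono_ideal n M :: 'k ext set) \<subseteq> ideal_gen n (ext_mono ` M)"
    unfolding ideal_gen_def by blast
qed

definition hleads :: "'k::field ext set \<Rightarrow> nat set set" where
  "hleads J = (\<Union>d. leads (hpart d J))"

lemma hleads_iff: "S \<in> hleads J \<longleftrightarrow> (\<exists>f\<in>J. \<exists>k. homogeneous k f \<and> is_lead f S)"
  unfolding hleads_def leads_def hpart_def by auto

lemma leads_hpart: "leads (hpart d J) = {S \<in> hleads J. card S = d}"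
  unfolding hleads_def leads_def hpart_def is_lead_def homogeneous_def by auto

lemma homogeneous_lm:
  assumes "f \<in> ext_carrier n" "homogeneous d f"
  shows "homogeneous (Suc d) (lm j f)"
  unfolding homogeneous_def
proof (intro allI impI)
  fix T assume "lm j f T \<noteq> 0"
  then have j: "j \<in> T" and f: "f (T - {j}) \<noteq> 0" by (auto simp: lm_def split: if_splits)
  have "finite (T - {j})" using carrier_finite[OF assms(1) f] by blast
  then have "finite T" by simp
  then have "card T = Suc (card (T - {j}))" by (rule card.remove[OF _ j])
  then show "card T = Suc d" using f assms(2) unfolding homogeneous_def by simp
qed

text \<open>The terms of \<open>lm j f\<close> arise by adding \<open>j\<close> to terms of
  \<open>f\<close> that lack it, which adds the same \<open>2 ^ j\<close> to all their
  codes.\<close>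

lemma is_lead_lm:
  assumes f: "f \<in> ext_carrier n" "is_lead f S" and j: "j \<notin> S" "j < n"
  shows "is_lead (lm j f) (insert j S)"
proof -
  have fS: "f S \<noteq> 0" using f(2) unfolding is_lead_def by blast
  have finS: "finite S" using carrier_finite[OF f(1) fS] by blast
  have "enc (insert j S) < enc T" if T: "T \<noteq> insert j S" "lm j f T \<noteq> 0" for T
  proof -
    have jT: "j \<in> T" and fT: "f (T - {j}) \<noteq> 0" using T(2) by (auto simp: lm_def split: if_splits)
    have ne: "T - {j} \<noteq> S" using T(1) jT by blast
    have fin: "finite (T - {j})" using carrier_finite[OF f(1) fT] by blast
    have "enc S < enc (T - {j})" using is_lead_enc[OF f(1), of S] f(2) ne fT by simp
    moreover have "enc (insert j (T - {j})) = 2 ^ j + enc (T - {j})" using fin by (intro set_encode_insert) auto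
    moreover have "enc (insert j S) = 2 ^ j + enc S" using finS j by simp
    ultimately show ?thesis using jT by (simp add: insert_absorb)
  qed
  moreover have "lm j f (insert j S) \<noteq> 0" using fS j by (simp add: lm_def)
  ultimately show ?thesis using is_lead_enc[OF lm_carrier[OF f(1) j(2)]] by blast
qed

context lid begin

lemma hleads_subset: "hleads J \<subseteq> Pow {..<n}"
  using J_carrier carrier_finite unfolding hleads_iff[abs_def] subset_iff
  by (auto simp: hleads_iff is_lead_def) (use carrier_finite in blast)

lemma up_closed_hleads: "up_closed n (hleads J)"
  unfolding up_closed_def
proof (intro ballI allI impI)
  fix S j assume S: "S \<in> hleads J" and j: "j < n"
  then obtain f k where f: "f \<in> J" "homogeneous k f" "is_lead f S" unfolding hleads_iff by blast
  have fc: "f \<in> ext_carrier n" using f(1) J_carrier by blast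
  show "insert j S \<in> hleads J"
  proof (cases "j \<in> S")
    case True
    then show ?thesis using S by (simp add: insert_absorb)
  next
    case False
    then show ?thesis unfolding hleads_iff
      using J_lm[OF f(1) j] homogeneous_lm[OF fc f(2)] is_lead_lm[OF fc f(3) False j] by blast
  qed
qed

text \<open>The leading monomials of homogeneous elements are closed under multiplication already,
  so generating an ideal adds no monomial.\<close>

lemma in_ideal_eq: "in_ideal n J = mono_ideal n (hleads J)"
proof -
  have "{ext_mono S |S f k. f \<in> J \<and> homogeneous k f \<and> is_lead f S} = (ext_mono ` hleads J :: 'k ext set)"
    unfolding image_def using hleads_iff[of _ J] by blast
  then show ?thesis unfolding in_ideal_def
    using mono_ideal_generated[OF up_closed_hleads hleads_subset] by simp
qed

end

lemma hleads_mono_ideal: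
  assumes "M \<subseteq> Pow {..<n}"
  shows "hleads (mono_ideal n M :: 'k::field ext set) = M"
proof
  show "hleads (mono_ideal n M :: 'k ext set) \<subseteq> M"
    unfolding subset_iff hleads_iff mono_ideal_def is_lead_def by blast
  show "M \<subseteq> hleads (mono_ideal n M :: 'k ext set)"
  proof
    fix S assume S: "S \<in> M"
    have "(ext_mono S :: 'k ext) \<in> mono_ideal n M"
      using S assms unfolding mono_ideal_def ext_mono_def ext_carrier_def by auto
    moreover have "homogeneous (card S) (ext_mono S :: 'k ext)" "is_lead (ext_mono S :: 'k ext) S"
      unfolding homogeneous_def is_lead_def ext_mono_def by auto
    ultimately show "S \<in> hleads (mono_ideal n M :: 'k ext set)" unfolding hleads_iff by blast
  qed
qed

subsection \<open>Linear substitutions\<close>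

definition lmg :: "nat \<Rightarrow> (nat \<Rightarrow> nat \<Rightarrow> 'k::field) \<Rightarrow> nat \<Rightarrow> 'k ext \<Rightarrow> 'k ext" where
  "lmg n g j p = (\<Sum>k<n. fsc (g k j) (lm k p))"

definition mmul :: "nat \<Rightarrow> (nat \<Rightarrow> nat \<Rightarrow> 'k::field) \<Rightarrow> (nat \<Rightarrow> nat \<Rightarrow> 'k) \<Rightarrow> nat \<Rightarrow> nat \<Rightarrow> 'k" where
  "mmul n h g = (\<lambda>i j. \<Sum>k<n. h i k * g k j)"

text \<open>Matrices are functions on all pairs of natural numbers; only the block of indices below
  \<open>n\<close> has a meaning, so being the identity is tested there.\<close>

definition is_one :: "nat \<Rightarrow> (nat \<Rightarrow> nat \<Rightarrow> 'k::field) \<Rightarrow> bool" where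
  "is_one n g \<longleftrightarrow> (\<forall>i<n. \<forall>j<n. g i j = (if i = j then 1 else 0))"

lemma ext_mult_lin_form:
  assumes "p \<in> ext_carrier n"
  shows "ext_mult (lin_form n g j) p = lmg n g j p"
proof
  fix T
  have lf: "lin_form n g j S = (\<Sum>k<n. g k j * ext_mono {k} S)" for S
    unfolding lin_form_def ext_mono_def by (rule sum.cong) auto
  have "ext_mult (lin_form n g j) p T = (\<Sum>S\<in>Pow T. \<Sum>k<n. g k j * (ext_sign S (T - S) * ext_mono {k} S * p (T - S)))"
    unfolding ext_mult_def lf by (simp add: sum_distrib_left sum_distrib_right mult.assoc mult.left_commute)
  also have "\<dots> = (\<Sum>k<n. g k j * ext_mult (ext_mono {k}) p T)"
    unfolding ext_mult_def by (subst sum.swap) (simp add: sum_distrib_left)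
  also have "\<dots> = lmg n g j p T"
    unfolding lmg_def sum_fun_apply ext_mult_mono_left[OF assms] by simp
  finally show "ext_mult (lin_form n g j) p T = lmg n g j p T" .
qed

lemma lmg_add: "lmg n g j (p + q) = lmg n g j p + lmg n g j q"
  unfolding lmg_def by (simp add: lm_add sum.distrib fv.scale_right_distrib)

lemma lmg_fsc: "lmg n g j (fsc r p) = fsc r (lmg n g j p)"
  unfolding lmg_def by (simp add: lm_fsc fv.scale_sum_right mult.commute)

lemma lin_lmg: "Vector_Spaces.linear fsc fsc (lmg n g j)"
  by unfold_locales (simp_all add: lmg_add lmg_fsc)

lemma lmg_lmg_expand:
  "lmg n g i (lmg n g j p) = (\<Sum>k<n. \<Sum>l<n. lm k (lm l (fsc (g k i * g l j) p)))"
  unfolding lmg_def by (simp add: lm_sum lm_fsc fv.scale_sum_right)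

lemma lmg_self [simp]: "lmg n g j (lmg n g j p) = 0"
  unfolding lmg_lmg_expand by (rule lm_sq_sum) (auto simp: mult.commute)

lemma lmg_anticomm: "lmg n g i (lmg n g j p) = - lmg n g j (lmg n g i p)"
proof -
  have "lmg n g j (lmg n g i p) = (\<Sum>k<n. \<Sum>l<n. lm l (lm k (fsc (g l j * g k i) p)))"
    unfolding lmg_lmg_expand by (rule sum.swap)
  also have "\<dots> = - lmg n g i (lmg n g j p)"
    unfolding lmg_lmg_expand sum_negf[symmetric]
    by (intro sum.cong refl) (metis lm_anticomm mult.commute)
  finally show ?thesis by simp
qed

lemma lmg_carrier: "p \<in> ext_carrier n \<Longrightarrow> lmg n g j p \<in> ext_carrier n"
  unfolding lmg_def by (intro fv.subspace_sum[OF subspace_ext_carrier] fv.subspace_scale[OF subspace_ext_carrier] lm_carrier) auto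

lemma homogeneous_subspace: "fv.subspace {f. homogeneous d f}"
  unfolding fv.subspace_def homogeneous_def by auto (metis add_cancel_right_left)

lemma homogeneous_lmg:
  assumes "p \<in> ext_carrier n" "homogeneous d p"
  shows "homogeneous (Suc d) (lmg n g j p)"
proof -
  have "lmg n g j p \<in> {f. homogeneous (Suc d) f}"
    unfolding lmg_def
    by (intro fv.subspace_sum[OF homogeneous_subspace] fv.subspace_scale[OF homogeneous_subspace])
      (simp add: homogeneous_lm[OF assms])
  then show ?thesis by simp
qed

definition eprod :: "nat \<Rightarrow> (nat \<Rightarrow> nat \<Rightarrow> 'k::field) \<Rightarrow> nat list \<Rightarrow> 'k ext" where
  "eprod n g xs = foldr (lmg n g) xs (ext_mono {})"

lemma eprod_simps [simp]: "eprod n g [] = ext_mono {}" "eprod n g (x # xs) = lmg n g x (eprod n g xs)"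
  by (simp_all add: eprod_def)

lemma eprod_carrier: "eprod n g xs \<in> ext_carrier n"
  by (induct xs) (simp_all add: lmg_carrier ext_mono_carrier)

lemma eprod_homogeneous: "homogeneous (length xs) (eprod n g xs)"
proof (induct xs)
  case Nil
  show ?case by (auto simp: homogeneous_def ext_mono_def)
qed (simp add: homogeneous_lmg eprod_carrier)

lemma eprod_eq: "foldr (\<lambda>j p. ext_mult (lin_form n g j) p) xs (ext_mono {}) = eprod n g xs"
  by (induct xs) (simp_all add: ext_mult_lin_form[OF eprod_carrier])

lemma ext_act_eq:
  "ext_act n g f = (\<Sum>S\<in>Pow {..<n}. fsc (f S) (eprod n g (sorted_list_of_set S)))"
  unfolding ext_act_def eprod_eq ext_scale_def fsc_def ..

lemma lin_ext_act: "Vector_Spaces.linear fsc fsc (ext_act n g)"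
  by unfold_locales
    (simp_all add: ext_act_eq sum.distrib fv.scale_left_distrib fv.scale_sum_right)

lemmas ext_act_fsc = ff.linear_scale[OF lin_ext_act]
  and ext_act_sum = ff.linear_sum[OF lin_ext_act] and ext_act_0 = ff.linear_0[OF lin_ext_act]

lemma ext_act_carrier: "ext_act n g f \<in> ext_carrier n"
  unfolding ext_act_eq
  by (intro fv.subspace_sum[OF subspace_ext_carrier] fv.subspace_scale[OF subspace_ext_carrier] eprod_carrier)

lemma ext_act_homogeneous:
  assumes "homogeneous d f"
  shows "homogeneous d (ext_act n g f)"
proof -
  have "ext_act n g f \<in> {f. homogeneous d f}"
    unfolding ext_act_eq
  proof (intro fv.subspace_sum[OF homogeneous_subspace])
    fix S assume S: "S \<in> Pow {..<n}"
    show "fsc (f S) (eprod n g (sorted_list_of_set S)) \<in> {f. homogeneous d f}"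
    proof (cases "f S = 0")
      case True
      then show ?thesis by (simp add: homogeneous_def)
    next
      case False
      then have "card S = d" using assms unfolding homogeneous_def by blast
      then have "homogeneous d (eprod n g (sorted_list_of_set S))"
        using eprod_homogeneous[of "sorted_list_of_set S" n g] by simp
      then show ?thesis by (simp add: homogeneous_def)
    qed
  qed
  then show ?thesis by simp
qed

lemma hom_comp_sum_eq:
  assumes "f \<in> ext_carrier n"
  shows "f = (\<Sum>k\<le>n. hom_comp k f)"
proof
  fix S
  have "(\<Sum>k\<le>n. hom_comp k f) S = (\<Sum>k\<le>n. if k = card S then f S else 0)"
    unfolding sum_fun_apply hom_comp_def by (rule sum.cong) auto
  also have "\<dots> = (if card S \<le> n then f S else 0)" by simp
  also have "\<dots> = f S"
  proof (cases "f S = 0")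
    case False
    then have "card S \<le> card {..<n}" using carrier_finite[OF assms] by (intro card_mono) auto
    then show ?thesis by simp
  qed simp
  finally show "f S = (\<Sum>k\<le>n. hom_comp k f) S" by simp
qed

lemma hom_comp_homogeneous: "homogeneous k (hom_comp k f)"
  unfolding homogeneous_def hom_comp_def by auto

lemma hom_comp_of_homogeneous: "homogeneous d f \<Longrightarrow> hom_comp k f = (if k = d then f else 0)"
  unfolding homogeneous_def hom_comp_def by (auto simp: fun_eq_iff)

lemma hom_comp_sum: "hom_comp k (sum f A) = (\<Sum>x\<in>A. hom_comp k (f x))"
  by (auto simp: hom_comp_def fun_eq_iff sum_fun_apply)

lemma hom_comp_ext_act:
  assumes "f \<in> ext_carrier n"
  shows "hom_comp k (ext_act n g f) = ext_act n g (hom_comp k f)"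
proof -
  have "hom_comp k (ext_act n g f) = (\<Sum>i\<le>n. hom_comp k (ext_act n g (hom_comp i f)))"
    by (subst hom_comp_sum_eq[OF assms]) (simp only: ext_act_sum hom_comp_sum)
  also have "\<dots> = (\<Sum>i\<le>n. if i = k then ext_act n g (hom_comp k f) else 0)"
    by (intro sum.cong refl)
      (auto simp: hom_comp_of_homogeneous[OF ext_act_homogeneous[OF hom_comp_homogeneous]])
  also have "\<dots> = (if k \<le> n then ext_act n g (hom_comp k f) else 0)" by simp
  also have "\<dots> = ext_act n g (hom_comp k f)"
  proof -
    have "hom_comp k f = 0" if k: "\<not> k \<le> n"
    proof
      fix S
      have "f S = 0" if "card S = k"
      proof (rule ccontr)
        assume "f S \<noteq> 0"
        then have "card S \<le> card {..<n}" using carrier_finite[OF assms] by (intro card_mono) auto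
        then show False using k that by simp
      qed
      then show "hom_comp k f S = 0 S" unfolding hom_comp_def by simp
    qed
    then show ?thesis by (simp add: ext_act_0)
  qed
  finally show ?thesis .
qed

lemma lmg_eprod_insort:
  fixes g :: "nat \<Rightarrow> nat \<Rightarrow> 'k::field"
  assumes "sorted xs" "distinct xs"
  shows "lmg n g j (eprod n g xs) = (if j \<in> set xs then 0 else fsc (sg j (set xs)) (eprod n g (insort j xs)))"
  using assms
proof (induct xs)
  case Nil
  show ?case by (simp add: sg_def)
next
  case (Cons x xs)
  show ?case
  proof (cases j x rule: linorder_cases)
    case less
    then have e: "{r \<in> set (x # xs). r < j} = {}" using Cons by auto
    have "sg j (set (x # xs)) = (1::'k)" unfolding sg_def e by simp
    moreover have "j \<notin> set (x # xs)" using less Cons by auto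
    ultimately show ?thesis using less by simp
  next
    case equal
    then show ?thesis by simp
  next
    case greater
    have "x \<notin> set xs" using Cons by simp
    then have "sg j (insert x (set xs)) = - (sg j (set xs) :: 'k)"
    proof -
      have "sg j (insert x (set xs) - {x}) = - (sg j (insert x (set xs)) :: 'k)"
        using sg_remove[of x "insert x (set xs)" j] greater by simp
      moreover have "insert x (set xs) - {x} = set xs" using \<open>x \<notin> set xs\<close> by blast
      ultimately show ?thesis by simp
    qed
    then show ?thesis using greater Cons
      by (simp add: lmg_anticomm[of n g j x] lmg_fsc ff.linear_0[OF lin_lmg])
  qed
qed

text \<open>Together with linearity, this multiplicativity against the generators is all that is
  used of the fact that \<open>ext_act\<close> is an algebra homomorphism.\<close>

lemma ext_act_lm:
  assumes f: "f \<in> ext_carrier n" and j: "j < n"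
  shows "ext_act n g (lm j f) = lmg n g j (ext_act n g f)"
proof -
  let ?E = "\<lambda>S. eprod n g (sorted_list_of_set S)"
  have L: "lmg n g j (?E S) = (if j \<in> S then 0 else fsc (sg j S) (?E (insert j S)))"
    if "S \<in> Pow {..<n}" for S
  proof -
    have "finite S" using that finite_subset by auto
    then show ?thesis using lmg_eprod_insort[of "sorted_list_of_set S" n g j]
      by (simp add: sorted_list_of_set.fold_insort_key.insert)
  qed
  have "lmg n g j (ext_act n g f) = (\<Sum>S\<in>Pow {..<n}. fsc (f S) (lmg n g j (?E S)))"
    unfolding ext_act_eq ff.linear_sum[OF lin_lmg] lmg_fsc ..
  also have "\<dots> = (\<Sum>S\<in>Pow {..<n}. if j \<in> S then 0 else fsc (f S * sg j S) (?E (insert j S)))"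
    by (intro sum.cong refl) (simp add: L)
  also have "\<dots> = (\<Sum>S\<in>{S\<in>Pow {..<n}. j \<notin> S}. fsc (f S * sg j S) (?E (insert j S)))"
    by (intro sum.mono_neutral_cong_right) auto
  also have "\<dots> = (\<Sum>T\<in>{T\<in>Pow {..<n}. j \<in> T}. fsc (lm j f T) (?E T))"
    by (rule sum.reindex_bij_witness[of _ "\<lambda>T. T - {j}" "insert j"])
      (use j in \<open>auto simp: lm_def insert_absorb mult.commute\<close>)
  also have "\<dots> = (\<Sum>T\<in>Pow {..<n}. fsc (lm j f T) (?E T))"
    by (intro sum.mono_neutral_left) (auto simp: lm_def)
  finally show ?thesis unfolding ext_act_eq by simp
qed

lemma lmg_mmul: "(\<Sum>k<n. fsc (g k j) (lmg n h k p)) = lmg n (mmul n h g) j p"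
proof -
  have "(\<Sum>k<n. fsc (g k j) (lmg n h k p)) = (\<Sum>k<n. \<Sum>l<n. fsc (h l k * g k j) (lm l p))"
    unfolding lmg_def fv.scale_sum_right by (simp add: mult.commute)
  also have "\<dots> = (\<Sum>l<n. \<Sum>k<n. fsc (h l k * g k j) (lm l p))" by (rule sum.swap)
  also have "\<dots> = lmg n (mmul n h g) j p"
    unfolding lmg_def mmul_def fv.scale_sum_left ..
  finally show ?thesis .
qed

lemma ext_act_lmg:
  assumes "p \<in> ext_carrier n"
  shows "ext_act n h (lmg n g j p) = lmg n (mmul n h g) j (ext_act n h p)"
proof -
  have "ext_act n h (lmg n g j p) = (\<Sum>k<n. fsc (g k j) (lmg n h k (ext_act n h p)))"
    unfolding lmg_def[of n g] ext_act_sum ext_act_fsc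
    by (intro sum.cong refl) (simp add: ext_act_lm[OF assms])
  then show ?thesis by (simp add: lmg_mmul)
qed

lemma ext_act_one_elem: "ext_act n g (ext_mono {}) = ext_mono {}"
proof -
  have "ext_act n g (ext_mono {}) = (\<Sum>S\<in>Pow {..<n}. if S = {} then ext_mono {} else 0)"
    unfolding ext_act_eq by (intro sum.cong refl) (auto simp: ext_mono_def fun_eq_iff)
  then show ?thesis by simp
qed

lemma ext_act_eprod: "ext_act n h (eprod n g xs) = eprod n (mmul n h g) xs"
  by (induct xs) (simp_all add: ext_act_one_elem ext_act_lmg[OF eprod_carrier])

lemma ext_act_ext_act: "ext_act n h (ext_act n g f) = ext_act n (mmul n h g) f"
  unfolding ext_act_eq[of n g] ext_act_eq[of n "mmul n h g"] ext_act_sum ext_act_fsc ext_act_eprod ..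

lemma eprod_is_one:
  fixes g :: "nat \<Rightarrow> nat \<Rightarrow> 'k::field"
  assumes "is_one n g" "sorted xs" "distinct xs" "set xs \<subseteq> {..<n}"
  shows "eprod n g xs = ext_mono (set xs)"
  using assms(2-)
proof (induct xs)
  case (Cons x xs)
  have "lmg n g x p = lm x p" for p
  proof -
    have "lmg n g x p = (\<Sum>k<n. if k = x then lm x p else 0)"
      unfolding lmg_def using assms(1) Cons(4) by (intro sum.cong refl) (auto simp: is_one_def fun_eq_iff)
    then show ?thesis using Cons(4) by simp
  qed
  moreover have "lm x (ext_mono (set xs) :: 'k ext) = ext_mono (insert x (set xs))"
  proof
    fix T
    have e: "{r \<in> insert x (set xs). r < x} = {}" using Cons by auto
    have "sg x (insert x (set xs)) = (1::'k)" unfolding sg_def e by simp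
    have x: "x \<notin> set xs" using Cons by simp
    show "lm x (ext_mono (set xs) :: 'k ext) T = ext_mono (insert x (set xs)) T"
    proof (cases "T = insert x (set xs)")
      case True
      then have "T - {x} = set xs" using x by blast
      then show ?thesis using True \<open>sg x (insert x (set xs)) = (1::'k)\<close>
        by (simp add: lm_def ext_mono_def)
    next
      case False
      then have "x \<in> T \<longrightarrow> T - {x} \<noteq> set xs" using x by blast
      then show ?thesis using False by (simp add: lm_def ext_mono_def)
    qed
  qed
  ultimately show ?case using Cons by simp
qed simp

lemma ext_act_is_one:
  assumes "is_one n g" "f \<in> ext_carrier n"
  shows "ext_act n g f = f"
proof -
  have "ext_act n g f = (\<Sum>S\<in>Pow {..<n}. fsc (f S) (ext_mono S))"
    unfolding ext_act_eq
  proof (intro sum.cong refl)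
    fix S assume S: "S \<in> Pow {..<n}"
    then have "finite S" using finite_subset by auto
    then show "fsc (f S) (eprod n g (sorted_list_of_set S)) = fsc (f S) (ext_mono S)"
      using eprod_is_one[OF assms(1), of "sorted_list_of_set S"] S by simp
  qed
  then show ?thesis using carrier_expand[OF assms(2)] by simp
qed


subsection \<open>Coordinate changes on the Cartan complex\<close>

text \<open>A chain is a functional on polynomials in the dual variables; \<open>tch n g\<close> composes it with the
  linear substitution given by \<open>g\<close>, and \<open>gch n g\<close> also substitutes in the coefficients.\<close>

definition pwl :: "(nat \<Rightarrow> 'c \<Rightarrow> 'c) \<Rightarrow> (nat \<Rightarrow> nat) \<Rightarrow> nat list \<Rightarrow> 'c \<Rightarrow> 'c" where
  "pwl L a xs = foldr (\<lambda>m F. (L m ^^ a m) \<circ> F) xs id"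

lemma pwl_simps [simp]:
  "pwl L a [] c = c" "pwl L a (x # xs) c = (L x ^^ a x) (pwl L a xs c)"
  by (simp_all add: pwl_def)

lemma funpow_hom: "(\<And>c. L (F c) = F (L' c)) \<Longrightarrow> (L ^^ k) (F c) = F ((L' ^^ k) c)"
  by (induct k) simp_all

lemma pwl_hom:
  assumes "\<And>m c. m \<in> set xs \<Longrightarrow> L m (F c) = F (L' m c)"
  shows "pwl L a xs (F c) = F (pwl L' a xs c)"
  using assms
proof (induct xs)
  case (Cons x xs)
  have "pwl L a xs (F c) = F (pwl L' a xs c)" by (rule Cons(1)) (use Cons(2) in auto)
  moreover have "(L x ^^ a x) (F (pwl L' a xs c)) = F ((L' x ^^ a x) (pwl L' a xs c))"
    by (rule funpow_hom) (use Cons(2) in auto)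
  ultimately show ?case by simp
qed simp

lemma pwl_cong: "(\<And>m. m \<in> set xs \<Longrightarrow> a m = a' m) \<Longrightarrow> pwl L a xs c = pwl L a' xs c"
  by (induct xs) auto

lemma pwl_Suc:
  assumes "distinct xs" "j \<in> set xs" and comm: "\<And>m k c. L m (L k c) = L k (L m c)"
  shows "pwl L (a(j := Suc (a j))) xs c = L j (pwl L a xs c)"
  using assms(1,2)
proof (induct xs)
  case (Cons x xs)
  show ?case
  proof (cases "x = j")
    case True
    then have "pwl L (a(j := Suc (a j))) xs c = pwl L a xs c" using Cons by (intro pwl_cong) auto
    then show ?thesis using True by (simp only: True pwl_simps fun_upd_same funpow.simps comp_apply)
  next
    case False
    then have "pwl L (a(j := Suc (a j))) xs c = L j (pwl L a xs c)"
      by (intro Cons(1)) (use Cons(2,3) in auto)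
    moreover have "(L x ^^ a x) (L j d) = L j ((L x ^^ a x) d)" for d
      by (rule funpow_hom) (rule comm)
    moreover have "(a(j := Suc (a j))) x = a x" using False by simp
    ultimately show ?thesis by (simp only: pwl_simps)
  qed
qed simp

lemma pwl_zero: "(\<And>m. m \<in> set xs \<Longrightarrow> a m = 0) \<Longrightarrow> pwl L a xs c = c"
  by (induct xs) auto

lemma sh_funpow: "(sh m ^^ k) c b = c (b(m := b m + k))"
  by (induct k arbitrary: b) (auto simp: sh_def)

lemma pwl_sh:
  assumes "distinct xs"
  shows "pwl sh a xs c b = c (\<lambda>j. if j \<in> set xs then b j + a j else b j)"
  using assms
proof (induct xs arbitrary: b)
  case (Cons x xs)
  have "(\<lambda>j. if j \<in> set xs then (b(x := b x + a x)) j + a j else (b(x := b x + a x)) j)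
      = (\<lambda>j. if j \<in> set (x # xs) then b j + a j else b j)"
    using Cons(2) by (auto simp: fun_eq_iff)
  then show ?case using Cons by (simp add: sh_funpow)
qed simp

definition lsh :: "nat \<Rightarrow> (nat \<Rightarrow> nat \<Rightarrow> 'k::field) \<Rightarrow> nat \<Rightarrow> 'k chain \<Rightarrow> 'k chain" where
  "lsh n g m c = (\<Sum>k<n. csc (g m k) (sh k c))"

definition cw :: "('k::field ext \<Rightarrow> 'k ext) \<Rightarrow> 'k chain \<Rightarrow> 'k chain" where
  "cw f c = (\<lambda>a. f (c a))"

definition tch :: "nat \<Rightarrow> (nat \<Rightarrow> nat \<Rightarrow> 'k::field) \<Rightarrow> 'k chain \<Rightarrow> 'k chain" where
  "tch n g c = (\<lambda>a. if msupp a \<subseteq> {..<n} then pwl (lsh n g) a [0..<n] c (\<lambda>_. 0) else 0)"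

definition gch :: "nat \<Rightarrow> (nat \<Rightarrow> nat \<Rightarrow> 'k::field) \<Rightarrow> 'k chain \<Rightarrow> 'k chain" where
  "gch n g c = cw (ext_act n g) (tch n g c)"

lemma lsh_add: "lsh n g m (c + c') = lsh n g m c + lsh n g m c'"
  unfolding lsh_def by (simp add: sh_add cv.scale_right_distrib sum.distrib)
lemma lsh_csc: "lsh n g m (csc r c) = csc r (lsh n g m c)"
  unfolding lsh_def by (simp add: sh_csc cv.scale_sum_right mult.commute)
lemma lsh_comm: "lsh n g m (lsh n g k c) = lsh n g k (lsh n g m c)"
proof -
  have "lsh n g m (lsh n g k c) = (\<Sum>i<n. \<Sum>j<n. csc (g m i * g k j) (sh i (sh j c)))" for m k
    unfolding lsh_def by (simp add: cc.linear_sum[OF lin_sh] sh_csc cv.scale_sum_right)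
  note e = this
  have "lsh n g m (lsh n g k c) = (\<Sum>j<n. \<Sum>i<n. csc (g m i * g k j) (sh i (sh j c)))"
    unfolding e by (rule sum.swap)
  also have "\<dots> = lsh n g k (lsh n g m c)"
    unfolding e by (intro sum.cong refl) (metis sh_comm mult.commute)
  finally show ?thesis .
qed

text \<open>The operators \<open>lsh\<close> commute, so raising the exponent of \<open>x_k\<close>
  is one more application of \<open>lsh n g k\<close> before evaluation at exponent 0. Values at all
  exponents follow from contractions, with no expansion of divided powers of linear forms, in every
  characteristic.\<close>

lemma sh_tch:
  assumes "k < n"
  shows "sh k (tch n g c) = tch n g (lsh n g k c)"
proof
  fix a
  have s: "msupp (a(k := Suc (a k))) \<subseteq> {..<n} \<longleftrightarrow> msupp a \<subseteq> {..<n}" using assms by auto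
  have "pwl (lsh n g) (a(k := Suc (a k))) [0..<n] c = lsh n g k (pwl (lsh n g) a [0..<n] c)"
    by (rule pwl_Suc) (use assms lsh_comm in auto)
  also have "\<dots> = pwl (lsh n g) a [0..<n] (lsh n g k c)"
    by (rule pwl_hom[where F = "lsh n g k" and L = "lsh n g" and L' = "lsh n g", symmetric]) (rule lsh_comm)
  finally show "sh k (tch n g c) a = tch n g (lsh n g k c) a"
    unfolding sh_def tch_def s by simp
qed

lemma tch_add: "tch n g (c + c') = tch n g c + tch n g c'"
proof -
  have "pwl (lsh n g) a xs (c + c') = pwl (lsh n g) a xs c + pwl (lsh n g) a xs c'" for a xs
  proof (induct xs)
    case (Cons x xs)
    have "(lsh n g x ^^ k) (d + d') = (lsh n g x ^^ k) d + (lsh n g x ^^ k) d'" for k d d'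
    proof (induct k)
      case (Suc k)
      then show ?case by (simp only: funpow.simps comp_apply lsh_add)
    qed simp
    then show ?case using Cons by (simp only: pwl_simps)
  qed simp
  then show ?thesis unfolding tch_def by (simp add: fun_eq_iff)
qed

lemma tch_csc: "tch n g (csc r c) = csc r (tch n g c)"
proof -
  have "pwl (lsh n g) a xs (csc r c) = csc r (pwl (lsh n g) a xs c)" for a xs
    by (rule pwl_hom[where F = "csc r" and L = "lsh n g" and L' = "lsh n g"]) (rule lsh_csc)
  then show ?thesis unfolding tch_def by (simp add: fun_eq_iff)
qed

lemma lin_tch: "Vector_Spaces.linear csc csc (tch n g)"
  by (rule linear_cscI[OF tch_add tch_csc])

lemma tch_at_0: "tch n g c (\<lambda>_. 0) = c (\<lambda>_. 0)"
  unfolding tch_def by (simp add: pwl_zero)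

lemma lin_cw:
  assumes "Vector_Spaces.linear fsc fsc f"
  shows "Vector_Spaces.linear csc csc (cw f)"
  by (rule linear_cscI)
    (auto simp: cw_def fun_eq_iff ff.linear_add[OF assms] csc_b ff.linear_scale[OF assms])

lemma sh_cw: "sh j (cw f c) = cw f (sh j c)" by (simp add: sh_def cw_def)

lemma cw_csc: "Vector_Spaces.linear fsc fsc f \<Longrightarrow> cw f (csc r c) = csc r (cw f c)"
  using cc.linear_scale[OF lin_cw] .

lemma lsh_cw:
  assumes "Vector_Spaces.linear fsc fsc f"
  shows "lsh n g m (cw f c) = cw f (lsh n g m c)"
  unfolding lsh_def by (simp add: sh_cw cc.linear_sum[OF lin_cw[OF assms]] cw_csc[OF assms])

lemma tch_cw:
  assumes f: "Vector_Spaces.linear fsc fsc f"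
  shows "tch n g (cw f c) = cw f (tch n g c)"
proof
  fix a
  have "pwl (lsh n g) a [0..<n] (cw f c) = cw f (pwl (lsh n g) a [0..<n] c)"
    by (rule pwl_hom[where F = "cw f" and L = "lsh n g" and L' = "lsh n g"]) (rule lsh_cw[OF f])
  then show "tch n g (cw f c) a = cw f (tch n g c) a"
    unfolding tch_def by (simp add: cw_def ff.linear_0[OF f])
qed

lemma lmc_cw: "lmc j = cw (lm j)" by (auto simp: lmc_def cw_def fun_eq_iff)

lemma lin_lm: "Vector_Spaces.linear fsc fsc (lm j)"
  by unfold_locales (simp_all add: lm_add lm_fsc)

lemma tch_carrier:
  assumes "\<And>a. c a \<in> J" "fv.subspace J"
  shows "tch n g c a \<in> J"
proof -
  have lshJ: "(\<forall>a. lsh n g m d a \<in> J)" if "\<forall>a. d a \<in> J" for d m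
  proof
    fix a
    have "lsh n g m d a = (\<Sum>k<n. fsc (g m k) (d (a(k := Suc (a k)))))"
      unfolding lsh_def sum_fun_apply csc_b sh_def ..
    also have "\<dots> \<in> J"
      by (intro fv.subspace_sum[OF assms(2)] fv.subspace_scale[OF assms(2)]) (use that in blast)
    finally show "lsh n g m d a \<in> J" .
  qed
  have "\<forall>b. (lsh n g m ^^ k) d b \<in> J" if "\<forall>a. d a \<in> J" for d m k
    by (induct k) (use that lshJ in auto)
  then have "\<forall>b. pwl (lsh n g) a xs c b \<in> J" for xs
    by (induct xs) (use assms(1) in auto)
  then show ?thesis unfolding tch_def using fv.subspace_0[OF assms(2)] by auto
qed

lemma lin_gch: "Vector_Spaces.linear csc csc (gch n g)"
  unfolding gch_def
  by (rule linear_cscI)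
    (simp_all add: tch_add tch_csc cc.linear_add[OF lin_cw[OF lin_ext_act]] cw_csc[OF lin_ext_act])

lemma sh_gch: "k < n \<Longrightarrow> sh k (gch n g c) = gch n g (lsh n g k c)"
  unfolding gch_def by (simp add: sh_cw sh_tch)

text \<open>The differential is invariant under coordinate changes: \<open>ext_act\<close> sends
  \<open>e_k\<close> to the sum of \<open>g j k\<close> times \<open>e_j\<close>, and contraction
  with \<open>x_j\<close> after substitution is the sum of \<open>g j k\<close> times contraction
  with \<open>x_k\<close>. Both sides are the same double sum.\<close>

lemma cdf_gch:
  assumes c: "\<And>a. c a \<in> ext_carrier n"
  shows "cdf n (gch n g c) = gch n g (cdf n c)"
proof -
  let ?P = "cw (ext_act n g)"
  note linP = lin_cw[OF lin_ext_act[of n g]]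
  have 1: "cdf n (gch n g c) = (\<Sum>j<n. \<Sum>k<n. csc (g j k) (lmc j (?P (tch n g (sh k c)))))"
    unfolding cdf_alt
  proof (intro sum.cong refl)
    fix j assume "j \<in> {..<n}"
    then have "sh j (gch n g c) = (\<Sum>k<n. csc (g j k) (?P (tch n g (sh k c))))"
      unfolding gch_def sh_cw by (simp add: sh_tch)
        (simp add: lsh_def cc.linear_sum[OF lin_tch] tch_csc cc.linear_sum[OF linP] cw_csc[OF lin_ext_act])
    then show "lmc j (sh j (gch n g c)) = (\<Sum>k<n. csc (g j k) (lmc j (?P (tch n g (sh k c)))))"
      by (simp add: cc.linear_sum[OF lin_lmc] lmc_csc)
  qed
  have 2: "?P (tch n g (lmc k (sh k c))) = (\<Sum>j<n. csc (g j k) (lmc j (?P (tch n g (sh k c)))))"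
    if k: "k < n" for k
  proof -
    have "?P (cw (lm k) d) a = (\<Sum>j<n. csc (g j k) (lmc j (?P d))) a"
      if d: "\<And>a. d a \<in> ext_carrier n" for d a
      unfolding cw_def sum_fun_apply csc_b lmc_def ext_act_lm[OF d k] lmg_def ..
    moreover have "tch n g (sh k c) a \<in> ext_carrier n" for a
      by (rule tch_carrier[OF _ subspace_ext_carrier]) (use c in \<open>simp add: sh_def\<close>)
    ultimately show ?thesis unfolding lmc_cw tch_cw[OF lin_lm] by (simp add: fun_eq_iff)
  qed
  have "gch n g (cdf n c) = (\<Sum>k<n. ?P (tch n g (lmc k (sh k c))))"
    unfolding gch_def cdf_alt by (simp add: cc.linear_sum[OF lin_tch] cc.linear_sum[OF linP])
  also have "\<dots> = (\<Sum>k<n. \<Sum>j<n. csc (g j k) (lmc j (?P (tch n g (sh k c)))))"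
    by (intro sum.cong refl) (simp add: 2)
  also have "\<dots> = cdf n (gch n g c)" unfolding 1 by (rule sum.swap)
  finally show ?thesis by simp
qed

lemma lsh_tch:
  assumes "is_one n (mmul n h g)" "m < n"
  shows "lsh n h m (tch n g c) = tch n g (sh m c)"
proof -
  have "lsh n h m (tch n g c) = (\<Sum>k<n. csc (h m k) (tch n g (lsh n g k c)))"
    unfolding lsh_def[of n h] by (intro sum.cong refl) (simp add: sh_tch)
  also have "\<dots> = tch n g (\<Sum>k<n. csc (h m k) (lsh n g k c))"
    by (simp add: cc.linear_sum[OF lin_tch] tch_csc)
  also have "(\<Sum>k<n. csc (h m k) (lsh n g k c)) = (\<Sum>k<n. \<Sum>l<n. csc (h m k * g k l) (sh l c))"
    unfolding lsh_def by (simp add: cv.scale_sum_right)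
  also have "\<dots> = (\<Sum>l<n. \<Sum>k<n. csc (h m k * g k l) (sh l c))" by (rule sum.swap)
  also have "\<dots> = (\<Sum>l<n. csc (mmul n h g m l) (sh l c))"
    unfolding mmul_def cv.scale_sum_left ..
  also have "\<dots> = (\<Sum>l<n. if l = m then sh m c else 0)"
    using assms by (intro sum.cong refl) (auto simp: is_one_def fun_eq_iff)
  also have "\<dots> = sh m c" using assms(2) by simp
  finally show ?thesis .
qed

lemma tch_tch:
  assumes one: "is_one n (mmul n h g)" and c: "\<And>a. \<not> msupp a \<subseteq> {..<n} \<Longrightarrow> c a = 0"
  shows "tch n h (tch n g c) = c"
proof
  fix a
  show "tch n h (tch n g c) a = c a"
  proof (cases "msupp a \<subseteq> {..<n}")
    case True
    have "pwl (lsh n h) a [0..<n] (tch n g c) = tch n g (pwl sh a [0..<n] c)"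
      by (rule pwl_hom[where F = "tch n g" and L = "lsh n h" and L' = sh]) (use lsh_tch[OF one] in auto)
    then have "tch n h (tch n g c) a = pwl sh a [0..<n] c (\<lambda>_. 0)"
      using True by (simp add: tch_def[of n h] tch_at_0)
    also have "\<dots> = c (\<lambda>j. if j < n then a j else 0)" by (simp add: pwl_sh cong: if_cong)
    also have "(\<lambda>j. if j < n then a j else 0) = a"
    proof
      fix j show "(if j < n then a j else 0) = a j" using True by auto
    qed
    finally show ?thesis .
  next
    case False
    then show ?thesis using c by (simp add: tch_def)
  qed
qed

lemma gch_gch:
  assumes one: "is_one n (mmul n h g)" and c: "c \<in> Ch n q i d"
  shows "gch n h (gch n g c) = c"
proof -
  have z: "c a = 0" if "\<not> msupp a \<subseteq> {..<n}" for a
    using Ch_finite(4)[OF c] that by (auto simp: fun_eq_iff)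
  have "gch n h (gch n g c) = cw (ext_act n h) (cw (ext_act n g) (tch n h (tch n g c)))"
    unfolding gch_def by (simp add: tch_cw[OF lin_ext_act])
  also have "tch n h (tch n g c) = c" by (rule tch_tch[OF one z])
  also have "cw (ext_act n h) (cw (ext_act n g) c) = c"
    unfolding cw_def ext_act_ext_act using ext_act_is_one[OF one Ch_carrier[OF c]] by simp
  finally show ?thesis .
qed

text \<open>The matrix preserves the span of the coordinates from \<open>q\<close> on. Then
  contractions along the rows below \<open>q\<close> only involve variables below \<open>q\<close>,
  which do not occur, so chains at level \<open>q\<close> are mapped to chains at level
  \<open>q\<close>.\<close>

definition blk :: "nat \<Rightarrow> nat \<Rightarrow> (nat \<Rightarrow> nat \<Rightarrow> 'k::field) \<Rightarrow> bool" where
  "blk n q g \<longleftrightarrow> (\<forall>k<n. \<forall>m<q. q \<le> k \<longrightarrow> g m k = 0)"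

lemma sh_below: 
  assumes "c \<in> Ch n q i d" "k < q"
  shows "sh k c = 0"
proof -
  have "c (b(k := Suc (b k))) S = 0" for b S
    using assms unfolding Ch_def by fastforce
  then show ?thesis by (simp add: sh_def fun_eq_iff)
qed

lemma lsh_below:
  assumes "c \<in> Ch n q i d" "m < q" "blk n q g"
  shows "lsh n g m c = 0"
  unfolding lsh_def
proof (rule sum.neutral, intro ballI)
  fix k assume k: "k \<in> {..<n}"
  show "csc (g m k) (sh k c) = 0"
  proof (cases "k < q")
    case True
    then show ?thesis using sh_below[OF assms(1)] by simp
  next
    case False
    then have "g m k = 0" using assms k unfolding blk_def by auto
    then show ?thesis by simp
  qed
qed

lemma lsh_Ch: "c \<in> Ch n q (Suc i) (Suc d) \<Longrightarrow> lsh n g m c \<in> Ch n q i d"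
  unfolding lsh_def by (intro Ch_sum Ch_csc sh_Ch) auto

lemma tch_nz_cases:
  assumes "tch n g c a S \<noteq> 0"
  shows "a = (\<lambda>_. 0) \<or> (\<exists>k<n. \<exists>a'. a = a'(k := Suc (a' k)) \<and> tch n g c a = tch n g (lsh n g k c) a')"
proof (cases "a = (\<lambda>_. 0)")
  case False
  then obtain k where k: "a k \<noteq> 0" by (auto simp: fun_eq_iff)
  have "msupp a \<subseteq> {..<n}" using assms unfolding tch_def by (auto split: if_splits)
  then have kn: "k < n" using k by auto
  define a' where "a' = a(k := a k - 1)"
  have a: "a = a'(k := Suc (a' k))" unfolding a'_def using k by auto
  have "tch n g c a = sh k (tch n g c) a'" unfolding sh_def using a by simp
  then show ?thesis using sh_tch[OF kn, of g c] kn a by metis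
qed simp

lemma tch_Ch:
  assumes "c \<in> Ch n q i d" "blk n q g"
  shows "tch n g c \<in> Ch n q i d"
  using assms(1)
proof (induct i arbitrary: c d)
  case 0
  have "valid_mi n 0 a \<and> (\<forall>j<q. a j = 0) \<and> S \<subseteq> {..<n} \<and> card S + 0 = d"
    if nz: "tch n g c a S \<noteq> 0" for a S
    using tch_nz_cases[OF nz]
  proof
    assume a: "a = (\<lambda>_. 0)"
    have "c (\<lambda>_. 0) S \<noteq> 0" using nz unfolding a tch_at_0 .
    then show ?thesis using 0 unfolding a Ch_def by blast
  next
    assume "\<exists>k<n. \<exists>a'. a = a'(k := Suc (a' k)) \<and> tch n g c a = tch n g (lsh n g k c) a'"
    then obtain k a' where k: "k < n" "tch n g c a = tch n g (lsh n g k c) a'" by blast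
    have "sh j c = 0" if "j < n" for j
    proof -
      have "\<not> valid_mi n 0 (b(j := Suc (b j)))" for b
        using that unfolding valid_mi_def by (auto simp: sum_eq_0_iff)
      then show ?thesis using 0 unfolding Ch_def sh_def fun_eq_iff by fastforce
    qed
    then have "lsh n g k c = 0" unfolding lsh_def by (intro sum.neutral) simp
    then show ?thesis using nz k by (simp add: cc.linear_0[OF lin_tch])
  qed
  then show ?case unfolding Ch_def by blast
next
  case (Suc i)
  show ?case
  proof (cases d)
    case 0
    then have c0: "c = 0" using Suc(2) Ch_trivial[of d "Suc i"] by auto
    show ?thesis unfolding c0 cc.linear_0[OF lin_tch] by (rule Ch_0)
  next
    case d: (Suc d')
    have "valid_mi n (Suc i) a \<and> (\<forall>j<q. a j = 0) \<and> S \<subseteq> {..<n} \<and> card S + Suc i = d"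
      if nz: "tch n g c a S \<noteq> 0" for a S
      using tch_nz_cases[OF nz]
    proof
      assume a: "a = (\<lambda>_. 0)"
      have "c (\<lambda>_. 0) S \<noteq> 0" using nz unfolding a tch_at_0 .
      then show ?thesis using Suc(2) unfolding a Ch_def by blast
    next
      assume "\<exists>k<n. \<exists>a'. a = a'(k := Suc (a' k)) \<and> tch n g c a = tch n g (lsh n g k c) a'"
      then obtain k a' where k: "k < n" "a = a'(k := Suc (a' k))"
        and e: "tch n g c a = tch n g (lsh n g k c) a'" by blast
      have "lsh n g k c \<in> Ch n q i d'" using lsh_Ch Suc(2) d by blast
      then have "tch n g (lsh n g k c) \<in> Ch n q i d'" by (rule Suc(1))
      moreover have "tch n g (lsh n g k c) a' S \<noteq> 0" using nz e by simp
      ultimately have h: "valid_mi n i a'" "\<forall>j<q. a' j = 0" "S \<subseteq> {..<n}" "card S + i = d'"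
        unfolding Ch_def by blast+
      have "\<not> k < q"
      proof
        assume "k < q"
        then have "lsh n g k c = 0" using lsh_below[OF Suc(2) _ assms(2)] by simp
        then show False using nz e by (simp add: cc.linear_0[OF lin_tch])
      qed
      then show ?thesis using h k d valid_mi_Suc[OF k(1), of i a'] by auto
    qed
    then show ?thesis unfolding Ch_def by blast
  qed
qed

lemma gch_Ch:
  assumes "c \<in> Ch n q i d" "blk n q g"
  shows "gch n g c \<in> Ch n q i d"
proof -
  have t: "tch n g c \<in> Ch n q i d" by (rule tch_Ch[OF assms])
  have "valid_mi n i a \<and> (\<forall>j<q. a j = 0) \<and> S \<subseteq> {..<n} \<and> card S + i = d"
    if nz: "gch n g c a S \<noteq> 0" for a S
  proof -
    have "tch n g c a \<noteq> 0" using nz unfolding gch_def cw_def by (auto simp: ext_act_0)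
    then obtain R where R: "tch n g c a R \<noteq> 0" by (auto simp: fun_eq_iff)
    have v: "valid_mi n i a" "\<forall>j<q. a j = 0" "card R + i = d"
      using t R unfolding Ch_def by blast+
    have "homogeneous (d - i) (tch n g c a)"
      using t unfolding Ch_def homogeneous_def by fastforce
    then have "card S = d - i" using ext_act_homogeneous nz unfolding gch_def cw_def homogeneous_def by blast
    moreover have "S \<subseteq> {..<n}" using ext_act_carrier[of n g "tch n g c a"] nz
      unfolding gch_def cw_def ext_carrier_def by blast
    ultimately show ?thesis using v by auto
  qed
  then show ?thesis unfolding Ch_def by blast
qed

definition inv_pair :: "nat \<Rightarrow> (nat \<Rightarrow> nat \<Rightarrow> 'k::field) \<Rightarrow> (nat \<Rightarrow> nat \<Rightarrow> 'k) \<Rightarrow> bool" where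
  "inv_pair n g h \<longleftrightarrow> is_one n (mmul n h g) \<and> is_one n (mmul n g h)"

lemma lid_ext_act:
  assumes J: "lid n J" and gh: "is_one n (mmul n g h)"
  shows "lid n (ext_act n g ` J)"
proof -
  interpret lid n J by fact
  have sub: "fv.subspace (ext_act n g ` J)"
    by (rule ff.linear_subspace_image[OF lin_ext_act subspace_J])
  show ?thesis
  proof
    show "ext_act n g ` J \<subseteq> ext_carrier n" using ext_act_carrier by blast
    show "0 \<in> ext_act n g ` J" by (rule fv.subspace_0[OF sub])
    show "f \<in> ext_act n g ` J \<Longrightarrow> f' \<in> ext_act n g ` J \<Longrightarrow> f + f' \<in> ext_act n g ` J" for f f'
      by (rule fv.subspace_add[OF sub])
    show "f \<in> ext_act n g ` J \<Longrightarrow> fsc r f \<in> ext_act n g ` J" for f r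
      by (rule fv.subspace_scale[OF sub])
    fix f j assume f: "f \<in> ext_act n g ` J" and j: "j < n"
    then obtain p where p: "p \<in> J" "f = ext_act n g p" by blast
    have pc: "p \<in> ext_carrier n" using p J_carrier by blast
    \<comment> \<open>Through the inverse matrix, \<open>e_j\<close> is a combination of the images
      of the generators, and multiplication by those images can be pulled back to
      \<open>J\<close>.\<close>
    have "lm j f = (\<Sum>k<n. fsc (h k j) (lmg n g k f))"
    proof -
      have "(\<Sum>k<n. fsc (h k j) (lmg n g k f)) = lmg n (mmul n g h) j f" by (rule lmg_mmul)
      also have "\<dots> = (\<Sum>k<n. if k = j then lm j f else 0)"
        unfolding lmg_def using gh j by (intro sum.cong refl) (auto simp: is_one_def fun_eq_iff)
      finally show ?thesis using j by simp
    qed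
    also have "\<dots> = ext_act n g (\<Sum>k<n. fsc (h k j) (lm k p))"
      unfolding ext_act_sum ext_act_fsc p(2)
      by (intro sum.cong refl) (simp add: ext_act_lm[OF pc])
    also have "\<dots> \<in> ext_act n g ` J"
      by (intro imageI J_sum J_fsc J_lm p(1)) auto
    finally show "lm j f \<in> ext_act n g ` J" .
  qed
qed

lemma ext_act_image_inverse:
  assumes "is_one n (mmul n h g)" "J \<subseteq> ext_carrier n"
  shows "ext_act n h ` ext_act n g ` J = J"
  using ext_act_is_one[OF assms(1)] assms(2) by (force simp: image_image ext_act_ext_act)

lemma gch_Zc:
  assumes J: "lid n J" and c: "c \<in> Zc n J q i d" and b: "blk n q g"
  shows "gch n g c \<in> Zc n (ext_act n g ` J) q i d"
proof -
  interpret lid n J by fact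
  have cC: "c \<in> Ch n q i d" using c Zc_Ch by blast
  have "cdf n (gch n g c) a \<in> ext_act n g ` J" for a
  proof -
    have "tch n g (cdf n c) a \<in> J"
      by (rule tch_carrier[OF _ subspace_J]) (use c in \<open>simp add: Zc_def\<close>)
    then show ?thesis unfolding cdf_gch[OF Ch_carrier[OF cC]] unfolding gch_def cw_def by blast
  qed
  then show ?thesis unfolding Zc_def using gch_Ch[OF cC b] by blast
qed

lemma gch_Bc:
  assumes J: "lid n J" and c: "c \<in> Bc n J q i d" and b: "blk n q g"
  shows "gch n g c \<in> Bc n (ext_act n g ` J) q i d"
proof -
  interpret lid n J by fact
  obtain w l where w: "w \<in> Ch n q (Suc i) d" and l: "l \<in> Jc n J q i d" and ce: "c = cdf n w + l"
    using c unfolding Bc_def by blast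
  have "gch n g c = cdf n (gch n g w) + gch n g l"
    unfolding ce by (simp add: cc.linear_add[OF lin_gch] cdf_gch[OF Ch_carrier[OF w]])
  moreover have "gch n g l \<in> Jc n (ext_act n g ` J) q i d"
  proof -
    have "tch n g l a \<in> J" for a
      by (rule tch_carrier[OF _ subspace_J]) (use l in \<open>simp add: Jc_def\<close>)
    then show ?thesis using l gch_Ch[OF _ b] unfolding Jc_def gch_def cw_def by blast
  qed
  ultimately show ?thesis unfolding Bc_def using gch_Ch[OF w b] by blast
qed

lemma gch_inj:
  assumes "is_one n (mmul n h g)" "c \<in> Ch n q i d" "gch n g c = 0"
  shows "c = 0"
proof -
  have "gch n h (gch n g c) = c" by (rule gch_gch[OF assms(1,2)])
  then show ?thesis by (simp add: assms(3) cc.linear_0[OF lin_gch])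
qed

lemma gch_Zc_image:
  assumes J: "lid n J" and gh: "inv_pair n g h" and b: "blk n q g" "blk n q h"
  shows "gch n g ` Zc n J q i d = Zc n (ext_act n g ` J) q i d"
proof
  interpret lid n J by fact
  show "gch n g ` Zc n J q i d \<subseteq> Zc n (ext_act n g ` J) q i d" using gch_Zc[OF J _ b(1)] by blast
  show "Zc n (ext_act n g ` J) q i d \<subseteq> gch n g ` Zc n J q i d"
  proof
    fix c assume c: "c \<in> Zc n (ext_act n g ` J) q i d"
    have J': "lid n (ext_act n g ` J)" using lid_ext_act[OF J] gh unfolding inv_pair_def by blast
    have "gch n h c \<in> Zc n J q i d"
      using gch_Zc[OF J' c b(2)] ext_act_image_inverse[OF _ J_carrier] gh unfolding inv_pair_def by metis
    moreover have "gch n g (gch n h c) = c"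
      using gch_gch[of n g h c q i d] gh c Zc_Ch unfolding inv_pair_def by blast
    ultimately show "c \<in> gch n g ` Zc n J q i d" by (metis imageI)
  qed
qed

lemma gch_Bc_image:
  assumes J: "lid n J" and gh: "inv_pair n g h" and b: "blk n q g" "blk n q h"
  shows "gch n g ` Bc n J q i d = Bc n (ext_act n g ` J) q i d"
proof
  interpret lid n J by fact
  show "gch n g ` Bc n J q i d \<subseteq> Bc n (ext_act n g ` J) q i d" using gch_Bc[OF J _ b(1)] by blast
  have J': "lid n (ext_act n g ` J)" using lid_ext_act[OF J] gh unfolding inv_pair_def by blast
  show "Bc n (ext_act n g ` J) q i d \<subseteq> gch n g ` Bc n J q i d"
  proof
    fix c assume c: "c \<in> Bc n (ext_act n g ` J) q i d"
    have cC: "c \<in> Ch n q i d" using c lid.Bc_Zc[OF J'] Zc_Ch by blast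
    have "gch n h c \<in> Bc n J q i d"
      using gch_Bc[OF J' c b(2)] ext_act_image_inverse[OF _ J_carrier] gh unfolding inv_pair_def by metis
    moreover have "gch n g (gch n h c) = c"
      using gch_gch[of n g h c q i d] gh cC unfolding inv_pair_def by blast
    ultimately show "c \<in> gch n g ` Bc n J q i d" by (metis imageI)
  qed
qed

lemma dim_gch:
  assumes "cv.subspace S" "S \<subseteq> Ch n q i d" "is_one n (mmul n h g)"
  shows "cv.dim (gch n g ` S) = cv.dim S"
  by (rule cc.dim_image_inj[OF assms(1) cv.fin_dim_mono[OF fin_dim_Ch assms(2)] lin_gch])
    (use gch_inj[OF assms(3)] assms(2) in blast)

lemma hdm_ext_act:
  assumes J: "lid n J" and gh: "inv_pair n g h" and b: "blk n q g" "blk n q h"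
  shows "hdm n (ext_act n g ` J) q i d = hdm n J q i d"
proof -
  interpret lid n J by fact
  have one: "is_one n (mmul n h g)" using gh unfolding inv_pair_def by blast
  show ?thesis
    unfolding hdm_def gch_Zc_image[OF assms, symmetric] gch_Bc_image[OF assms, symmetric]
    using dim_gch[OF subspace_Zc Zc_Ch one] dim_gch[OF subspace_Bc order_trans[OF Bc_Zc Zc_Ch] one]
    by simp
qed

text \<open>At level 0 every matrix qualifies; this is what transports Betti numbers to generic
  coordinates.\<close>

lemma blk_0 [simp]: "blk n 0 g" unfolding blk_def by simp


subsection \<open>Generic rank\<close>

definition indep :: "nat \<Rightarrow> (nat \<Rightarrow> 'x \<Rightarrow> 'k::field) \<Rightarrow> bool" where
  "indep m w \<longleftrightarrow> (\<forall>c. (\<forall>x. (\<Sum>i<m. c i * w i x) = 0) \<longrightarrow> (\<forall>i<m. c i = 0))"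

text \<open>Fraction-free Gaussian elimination instead of minors: \<open>u\<close> is a product of
  pivots that are nonzero at \<open>p0\<close>. The ring \<open>A\<close> is abstract so that the
  lemma serves both for polynomial functions of a matrix and for polynomials in one
  parameter.\<close>

lemma indep_open:
  fixes v :: "nat \<Rightarrow> 'p \<Rightarrow> 'x \<Rightarrow> 'k::field"
  assumes one: "(\<lambda>_. 1) \<in> A" and mult: "\<And>a b. a \<in> A \<Longrightarrow> b \<in> A \<Longrightarrow> (\<lambda>p. a p * b p) \<in> A"
    and diff: "\<And>a b. a \<in> A \<Longrightarrow> b \<in> A \<Longrightarrow> (\<lambda>p. a p - b p) \<in> A"
    and v: "\<And>i x. i < m \<Longrightarrow> (\<lambda>p. v i p x) \<in> A" and ind: "indep m (\<lambda>i. v i p0)"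
  shows "\<exists>u\<in>A. u p0 \<noteq> 0 \<and> (\<forall>p. u p \<noteq> 0 \<longrightarrow> indep m (\<lambda>i. v i p))"
  using v ind
proof (induct m arbitrary: v)
  case 0
  show ?case using one by (intro bexI[of _ "\<lambda>_. 1"]) (auto simp: indep_def)
next
  case (Suc m)
  have "\<exists>x. v m p0 x \<noteq> 0"
  proof (rule ccontr)
    assume "\<not> ?thesis"
    then have "\<forall>x. (\<Sum>i<Suc m. (if i = m then 1 else 0) * v i p0 x) = 0" by simp
    then have "\<forall>i<Suc m. (if i = m then 1 else 0 :: 'k) = 0"
      using Suc(3) unfolding indep_def by (elim allE[of _ "\<lambda>i. if i = m then 1 else 0"]) blast
    then show False by auto
  qed
  then obtain x where x: "v m p0 x \<noteq> 0" by blast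
  define u where "u = (\<lambda>p. v m p x)"
  \<comment> \<open>Cross-multiplication clears the pivot coordinate \<open>x\<close> without
    dividing, so the entries stay in \<open>A\<close>.\<close>
  define v' where "v' = (\<lambda>i p y. u p * v i p y - v i p x * v m p y)"
  have v'sum: "(\<Sum>i<m. c i * v' i p y) = u p * (\<Sum>i<m. c i * v i p y) - (\<Sum>i<m. c i * v i p x) * v m p y"
    for c p y
    unfolding v'_def by (simp add: right_diff_distrib sum_subtractf sum_distrib_left sum_distrib_right mult_ac)
  have "\<exists>u'\<in>A. u' p0 \<noteq> 0 \<and> (\<forall>p. u' p \<noteq> 0 \<longrightarrow> indep m (\<lambda>i. v' i p))"
  proof (rule Suc(1))
    show "(\<lambda>p. v' i p y) \<in> A" if "i < m" for i y
      unfolding v'_def u_def by (intro diff mult Suc(2)) (use that in auto)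
    show "indep m (\<lambda>i. v' i p0)"
      unfolding indep_def
    proof (intro allI impI)
      fix c i assume c: "\<forall>y. (\<Sum>i<m. c i * v' i p0 y) = 0" and i: "i < m"
      define c' where "c' = (\<lambda>i. if i < m then u p0 * c i else - (\<Sum>i<m. c i * v i p0 x))"
      have "(\<Sum>i<Suc m. c' i * v i p0 y) = 0" for y
      proof -
        have "(\<Sum>i<Suc m. c' i * v i p0 y) = u p0 * (\<Sum>i<m. c i * v i p0 y) - (\<Sum>i<m. c i * v i p0 x) * v m p0 y"
          by (simp add: c'_def sum_distrib_left mult.assoc)
        then show ?thesis using c v'sum by metis
      qed
      then have "c' i = 0" using Suc(3) i unfolding indep_def by simp
      then show "c i = 0" using i x by (simp add: c'_def u_def)
    qed
  qed
  then obtain u' where u': "u' \<in> A" "u' p0 \<noteq> 0" "\<And>p. u' p \<noteq> 0 \<Longrightarrow> indep m (\<lambda>i. v' i p)" by blast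
  have "indep (Suc m) (\<lambda>i. v i p)" if p: "u p * u' p \<noteq> 0" for p
    unfolding indep_def
  proof (intro allI impI)
    fix c i assume c: "\<forall>y. (\<Sum>i<Suc m. c i * v i p y) = 0" and i: "i < Suc m"
    have s: "(\<Sum>i<m. c i * v i p y) = - (c m * v m p y)" for y
      using c by (simp add: eq_neg_iff_add_eq_0)
    have "(\<Sum>i<m. c i * v' i p y) = 0" for y
      unfolding v'sum s by (simp add: u_def)
    then have z: "c i = 0" if "i < m" for i using u'(3)[of p] p that unfolding indep_def by simp
    have "(\<Sum>i<m. c i * v i p x) = 0" by (rule sum.neutral) (simp add: z)
    then have "c m = 0" using s[of x] p by (simp add: u_def)
    then show "c i = 0" using z i by (cases "i = m") auto
  qed
  then show ?case using u' x mult[of u u'] Suc(2)[of m x]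
    by (intro bexI[of _ "\<lambda>p. u p * u' p"]) (auto simp: u_def)
qed

lemma indep_dim:
  fixes w :: "nat \<Rightarrow> 'x \<Rightarrow> 'k::field"
  assumes ind: "indep m w" and w: "\<And>i. i < m \<Longrightarrow> w i \<in> U" and fd: "fv.fin_dim U"
  shows "m \<le> fv.dim U"
proof -
  have inj: "inj_on w {..<m}"
  proof (rule inj_onI, rule ccontr)
    fix i j assume ij: "i \<in> {..<m}" "j \<in> {..<m}" "w i = w j" "i \<noteq> j"
    define c where "c = (\<lambda>k. if k = i then 1  else if k = j then - 1 else (0::'k))"
    have "(\<Sum>k<m. c k * w k x) = 0" for x
    proof -
      have "(\<Sum>k<m. c k * w k x) = (\<Sum>k\<in>{i, j}. c k * w k x)"
        by (rule sum.mono_neutral_right) (use ij in \<open>auto simp: c_def\<close>)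
      then show ?thesis using ij by (simp add: c_def)
    qed
    then have "c i = 0" using ind ij unfolding indep_def by blast
    then show False by (simp add: c_def)
  qed
  have "fv.independent (w ` {..<m})"
  proof (rule fv.independent_if_scalars_zero)
    fix g y assume a: "(\<Sum>x\<in>w ` {..<m}. fsc (g x) x) = 0" and y: "y \<in> w ` {..<m}"
    have "(\<Sum>i<m. fsc (g (w i)) (w i)) = 0" using a by (simp add: sum.reindex[OF inj])
    then have "(\<Sum>i<m. fsc (g (w i)) (w i)) x = 0" for x by (simp add: fun_eq_iff)
    then have "(\<Sum>i<m. g (w i) * w i x) = 0" for x by (simp add: sum_fun_apply)
    then have "\<forall>i<m. g (w i) = 0" using ind[unfolded indep_def, rule_format, of "\<lambda>i. g (w i)"] by blast
    then show "g y = 0" using y by blast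
  qed simp
  from fv.independent_card_le_dim(2)[OF fd _ this] w card_image[OF inj] show ?thesis by auto
qed

text \<open>In a nontrivial relation, at the largest leading monomial among the members with nonzero
  coefficient only one of them has a nonzero value.\<close>

lemma indep_leads:
  assumes f: "\<And>i. i < m \<Longrightarrow> f i \<in> ext_carrier n" "\<And>i. i < m \<Longrightarrow> is_lead (f i) (s i)"
    and inj: "inj_on s {..<m}"
  shows "indep m f"
  unfolding indep_def
proof (intro allI impI, rule ccontr)
  fix c i assume c: "\<forall>x. (\<Sum>i<m. c i * f i x) = 0" and i: "i < m" "c i \<noteq> 0"
  let ?X = "{i. i < m \<and> c i \<noteq> 0}"
  have X: "finite ?X" "?X \<noteq> {}" using i by auto
  define k where "k = arg_min_on (\<lambda>i. enc (s i)) ?X"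
  have k: "k < m" "c k \<noteq> 0"
    using arg_min_if_finite(1)[OF X, of "\<lambda>i. enc (s i)"] unfolding k_def by auto
  have kmin: "enc (s k) \<le> enc (s j)" if "j < m" "c j \<noteq> 0" for j
    using arg_min_least[OF X, of j "\<lambda>i. enc (s i)"] that unfolding k_def by simp
  have "c j * f j (s k) = 0" if j: "j < m" "j \<noteq> k" for j
  proof (rule ccontr)
    assume nz: "c j * f j (s k) \<noteq> 0"
    have ne: "s k \<noteq> s j" using inj j k by (auto simp: inj_on_def)
    then have "enc (s j) < enc (s k)"
      using f(2)[OF j(1)] nz unfolding is_lead_enc[OF f(1)[OF j(1)]] by auto
    then show False using kmin[OF j(1)] nz by auto
  qed
  then have "(\<Sum>i<m. c i * f i (s k)) = (\<Sum>i<m. if i = k then c k * f k (s k) else 0)"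
    by (intro sum.cong refl) auto
  also have "\<dots> = c k * f k (s k)" using k by simp
  finally have "c k * f k (s k) = 0" using c by simp
  then show False using k f(2)[OF k(1)] unfolding is_lead_def by simp
qed

lemma polyfun_diff: "p \<in> polyfun n \<Longrightarrow> q \<in> polyfun n \<Longrightarrow> (\<lambda>g. p g - q g) \<in> polyfun n"
  using padd[OF _ pmult[OF pconst[of "- 1"]], of p n q] by simp

lemma polyfun_sum: "(\<And>i. i \<in> A \<Longrightarrow> (\<lambda>g. p i g) \<in> polyfun n) \<Longrightarrow> (\<lambda>g. \<Sum>i\<in>A. p i g) \<in> polyfun n"
  by (induct A rule: infinite_finite_induct) (auto intro: pconst padd)

lemma polyfun_eprod:
  "set xs \<subseteq> {..<n} \<Longrightarrow> (\<lambda>g. eprod n g xs T :: 'k::field) \<in> polyfun n"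
proof (induct xs arbitrary: T)
  case (Cons x xs)
  have "(\<lambda>g :: nat \<Rightarrow> nat \<Rightarrow> 'k. \<Sum>k<n. g k x * (if k \<in> T then sg k T * eprod n g xs (T - {k}) else 0)) \<in> polyfun n"
  proof (rule polyfun_sum)
    fix k assume "k \<in> {..<n}"
    moreover have s: "set xs \<subseteq> {..<n}" using Cons(2) by simp
    ultimately show "(\<lambda>g :: nat \<Rightarrow> nat \<Rightarrow> 'k. g k x * (if k \<in> T then sg k T * eprod n g xs (T - {k}) else 0)) \<in> polyfun n"
      using Cons(1)[OF s, of "T - {k}"] Cons(2) by (cases "k \<in> T") (auto intro!: pmult pvar pconst)
  qed
  then show ?case by (simp add: lmg_def lm_def sum_fun_apply)
qed (simp add: pconst)

lemma polyfun_ext_act: "(\<lambda>g. ext_act n g f T) \<in> polyfun n"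
proof -
  have "(\<lambda>g. \<Sum>S\<in>Pow {..<n}. f S * eprod n g (sorted_list_of_set S) T) \<in> polyfun n"
  proof (rule polyfun_sum)
    fix S assume S: "S \<in> Pow {..<n}"
    then have "finite S" using finite_subset by auto
    then show "(\<lambda>g. f S * eprod n g (sorted_list_of_set S) T) \<in> polyfun n"
      using S by (intro pmult pconst polyfun_eprod) simp
  qed
  then show ?thesis by (simp add: ext_act_eq sum_fun_apply)
qed

lemma polyfun_line:
  assumes "p \<in> polyfun n"
  shows "\<exists>P. \<forall>t. p (\<lambda>i j. a i j + t * b i j) = poly P t"
  using assms
proof induct
  case (pconst c)
  show ?case by (rule exI[of _ "[:c:]"]) simp
next
  case (pvar i j)
  show ?case by (rule exI[of _ "[:a i j, b i j:]"]) simp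
next
  case (padd p q)
  then obtain P Q where "\<forall>t. p (\<lambda>i j. a i j + t * b i j) = poly P t" "\<forall>t. q (\<lambda>i j. a i j + t * b i j) = poly Q t" by blast
  then show ?case by (intro exI[of _ "P + Q"]) simp
next
  case (pmult p q)
  then obtain P Q where "\<forall>t. p (\<lambda>i j. a i j + t * b i j) = poly P t" "\<forall>t. q (\<lambda>i j. a i j + t * b i j) = poly Q t" by blast
  then show ?case by (intro exI[of _ "P * Q"]) simp
qed

lemma poly_nonroot:
  assumes "infinite (UNIV :: 'k::field set)" "P \<noteq> (0 :: 'k poly)"
  shows "infinite {t. poly P t \<noteq> 0}"
proof
  assume "finite {t. poly P t \<noteq> 0}"
  then have "finite ({t. poly P t \<noteq> 0} \<union> {t. poly P t = 0})"
    using poly_roots_finite[OF assms(2)] by simp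
  moreover have "{t. poly P t \<noteq> 0} \<union> {t. poly P t = 0} = UNIV" by auto
  ultimately show False using assms(1) by simp
qed

text \<open>On the line through the two witnesses both functions restrict to nonzero polynomials in
  one variable, whose product has a non-root in an infinite field. So two nonempty open sets of
  matrices meet.\<close>

lemma polyfun_common:
  fixes p q :: "(nat \<Rightarrow> nat \<Rightarrow> 'k::field) \<Rightarrow> 'k"
  assumes inf: "infinite (UNIV :: 'k set)" and p: "p \<in> polyfun n" "p g1 \<noteq> 0" and q: "q \<in> polyfun n" "q g2 \<noteq> 0"
  shows "\<exists>g. p g \<noteq> 0 \<and> q g \<noteq> 0"
proof -
  define L where "L = (\<lambda>t i j. g1 i j + t * (g2 i j - g1 i j))"
  obtain P Q where P: "\<And>t. p (L t) = poly P t" and Q: "\<And>t. q (L t) = poly Q t"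
    using polyfun_line[OF p(1), of g1 "\<lambda>i j. g2 i j - g1 i j"]
      polyfun_line[OF q(1), of g1 "\<lambda>i j. g2 i j - g1 i j"] unfolding L_def by blast
  have "L 0 = g1" "L 1 = g2" unfolding L_def by auto
  then have "P \<noteq> 0" "Q \<noteq> 0" using P[of 0] Q[of 1] p q by auto
  then have "P * Q \<noteq> 0" by simp
  from poly_nonroot[OF inf this] obtain t where "poly (P * Q) t \<noteq> 0"
    using not_finite_existsD by auto
  then have "p (L t) \<noteq> 0" "q (L t) \<noteq> 0" using P Q by auto
  then show ?thesis by blast
qed

lemma polyfun_finite_common:
  fixes p :: "'i \<Rightarrow> (nat \<Rightarrow> nat \<Rightarrow> 'k::field) \<Rightarrow> 'k"
  assumes inf: "infinite (UNIV :: 'k set)" and fin: "finite A"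
    and p: "\<And>i. i \<in> A \<Longrightarrow> p i \<in> polyfun n" "\<And>i. i \<in> A \<Longrightarrow> \<exists>g. p i g \<noteq> 0"
  shows "\<exists>q\<in>polyfun n. (\<exists>g. q g \<noteq> 0) \<and> (\<forall>g. q g \<noteq> 0 \<longrightarrow> (\<forall>i\<in>A. p i g \<noteq> 0))"
  using fin p
proof (induct A)
  case empty
  show ?case by (intro bexI[of _ "\<lambda>_. 1"]) (auto intro: pconst)
next
  case (insert x A)
  then obtain q where q: "q \<in> polyfun n" "\<exists>g. q g \<noteq> 0" "\<forall>g. q g \<noteq> 0 \<longrightarrow> (\<forall>i\<in>A. p i g \<noteq> 0)" by auto
  have x: "p x \<in> polyfun n" "\<exists>g. p x g \<noteq> 0" using insert by auto
  have "\<exists>g. p x g * q g \<noteq> 0" using polyfun_common[OF inf x(1) _ q(1)] x(2) q(2) by auto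
  then show ?case using q x by (intro bexI[of _ "\<lambda>g. p x g * q g"]) (auto intro: pmult)
qed

subsection \<open>Generic initial ideals\<close>

locale gid = lid n J for n :: nat and J :: "'k::field ext set" +
  assumes hom: "f \<in> J \<Longrightarrow> hom_comp k f \<in> J"

text \<open>This is the rank of a matrix whose entries are polynomials in \<open>g\<close>, so it attains its maximum
  on a nonempty Zariski open set.\<close>

definition rk :: "nat \<Rightarrow> 'k::field ext set \<Rightarrow> (nat \<Rightarrow> nat \<Rightarrow> 'k) \<Rightarrow> nat \<Rightarrow> nat \<Rightarrow> nat" where
  "rk n J g d w = card {S \<in> leads (hpart d (ext_act n g ` J)). enc S < w}"

lemma rk_ge:
  assumes J: "fv.subspace J" and ind: "indep m (\<lambda>i. restr (\<lambda>S. enc S < w) (f i))"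
    and f: "\<And>i. i < m \<Longrightarrow> f i \<in> hpart d (ext_act n g ` J)"
  shows "m \<le> rk n J g d w"
proof -
  let ?H = "hpart d (ext_act n g ` J)"
  let ?U = "restr (\<lambda>S. enc S < w) ` ?H"
  have Hc: "?H \<subseteq> ext_carrier n" unfolding hpart_def using ext_act_carrier by blast
  have "fv.dim ?U = card (leads ?U) \<and> fv.fin_dim ?U"
  proof (rule dim_leads)
    show "finite (Pow {..<n})" "Pow {..<n} \<subseteq> Pow {..<n}" by auto
    show "fv.subspace ?U"
      by (rule ff.linear_subspace_image[OF lin_restr hpart_subspace[OF ff.linear_subspace_image[OF lin_ext_act J]]])
    fix h S assume "h \<in> ?U" "h S \<noteq> 0"
    then obtain h' where "h' \<in> ?H" "h' S \<noteq> 0" unfolding restr_def by (auto split: if_splits)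
    then show "S \<in> Pow {..<n}" using Hc carrier_finite by blast
  qed
  moreover have "leads ?U = {S \<in> leads ?H. enc S < w}" by (rule leads_restr[OF Hc]) auto
  moreover have "m \<le> fv.dim ?U" by (rule indep_dim[OF ind]) (use f calculation in auto)
  ultimately show ?thesis unfolding rk_def by simp
qed

lemma finite_leads_carrier: "U \<subseteq> ext_carrier n \<Longrightarrow> finite (leads U)"
  using finite_subset[OF leads_subset] by auto

context gid begin

lemma hpart_lift:
  assumes "f \<in> hpart d (ext_act n g ` J)"
  shows "\<exists>f'\<in>hpart d J. f = ext_act n g f'"
proof -
  obtain p where p: "p \<in> J" "f = ext_act n g p" "homogeneous d f" using assms unfolding hpart_def by blast
  have "ext_act n g (hom_comp d p) = f"
    using hom_comp_ext_act[of p n d g] p J_carrier hom_comp_of_homogeneous[OF p(3), of d] by auto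
  moreover have "hom_comp d p \<in> hpart d J" using hom[OF p(1)] hom_comp_homogeneous unfolding hpart_def by blast
  ultimately show ?thesis by blast
qed

lemma ext_act_hpart: "f \<in> hpart d J \<Longrightarrow> ext_act n g f \<in> hpart d (ext_act n g ` J)"
  unfolding hpart_def using ext_act_homogeneous by blast

lemma lead_family:
  "\<exists>s f. bij_betw s {..<rk n J g d w} {S \<in> leads (hpart d (ext_act n g ` J)). enc S < w} \<and>
    (\<forall>i<rk n J g d w. f i \<in> hpart d J \<and> is_lead (ext_act n g (f i)) (s i))"
proof -
  let ?H = "hpart d (ext_act n g ` J)"
  let ?X = "{S \<in> leads ?H. enc S < w}"
  have "?H \<subseteq> ext_carrier n" unfolding hpart_def using ext_act_carrier by blast
  then have "finite ?X" by (intro finite_subset[OF _ finite_leads_carrier[of ?H]]) auto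
  then obtain s where s: "bij_betw s {..<card ?X} ?X"
    using ex_bij_betw_nat_finite[of ?X] by (auto simp: atLeast0LessThan)
  have "\<exists>f\<in>hpart d J. is_lead (ext_act n g f) (s i)" if "i < card ?X" for i
  proof -
    have "s i \<in> leads ?H" using s that unfolding bij_betw_def by blast
    then obtain h where "h \<in> ?H" "is_lead h (s i)" unfolding leads_def by blast
    then show ?thesis using hpart_lift by blast
  qed
  then have "\<forall>i. \<exists>f. i < card ?X \<longrightarrow> f \<in> hpart d J \<and> is_lead (ext_act n g f) (s i)" by blast
  then obtain f where f: "\<And>i. i < card ?X \<Longrightarrow> f i \<in> hpart d J \<and> is_lead (ext_act n g (f i)) (s i)"
    using choice[of "\<lambda>i f. i < card ?X \<longrightarrow> f \<in> hpart d J \<and> is_lead (ext_act n g f) (s i)"] by blast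
  show ?thesis by (intro exI[of _ s] exI[of _ f]) (use s f in \<open>simp add: rk_def\<close>)
qed

lemma is_lead_restr: "is_lead f S \<Longrightarrow> P S \<Longrightarrow> is_lead (restr P f) S"
  unfolding is_lead_def restr_def by auto

lemma restr_carrier: "f \<in> ext_carrier n \<Longrightarrow> restr P f \<in> ext_carrier n"
  unfolding restr_def ext_carrier_def by auto

text \<open>Fixed elements of \<open>J\<close> whose truncated images under \<open>g0\<close> have
  distinct leading monomials stay independent under all nearby \<open>g\<close>, since the entries
  of the images are polynomial in \<open>g\<close>.\<close>

lemma rk_semicontinuous:
  "\<exists>p\<in>polyfun n. p g0 \<noteq> 0 \<and> (\<forall>g. p g \<noteq> 0 \<longrightarrow> rk n J g0 d w \<le> rk n J g d w)"
proof -
  let ?m = "rk n J g0 d w"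
  let ?r = "restr (\<lambda>S. enc S < w)"
  obtain s f where s: "bij_betw s {..<?m} {S \<in> leads (hpart d (ext_act n g0 ` J)). enc S < w}"
    and f: "\<And>i. i < ?m \<Longrightarrow> f i \<in> hpart d J" "\<And>i. i < ?m \<Longrightarrow> is_lead (ext_act n g0 (f i)) (s i)"
    using lead_family[of g0 d w] by blast
  have "indep ?m (\<lambda>i. ?r (ext_act n g0 (f i)))"
  proof (rule indep_leads)
    show "?r (ext_act n g0 (f i)) \<in> ext_carrier n" for i by (rule restr_carrier[OF ext_act_carrier])
    show "is_lead (?r (ext_act n g0 (f i))) (s i)" if "i < ?m" for i
    proof -
      have "enc (s i) < w" using bij_betwE[OF s] that by simp
      then show ?thesis using is_lead_restr[OF f(2)[OF that], of "\<lambda>S. enc S < w"] by simp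
    qed
    show "inj_on s {..<?m}" using s unfolding bij_betw_def by blast
  qed
  moreover have "(\<lambda>g. ?r (ext_act n g (f i)) S) \<in> polyfun n" for i S
    unfolding restr_def using polyfun_ext_act pconst by (cases "enc S < w") auto
  ultimately obtain p where p: "p \<in> polyfun n" "p g0 \<noteq> 0"
    "\<And>g. p g \<noteq> 0 \<Longrightarrow> indep ?m (\<lambda>i. ?r (ext_act n g (f i)))"
    using indep_open[of "polyfun n" ?m "\<lambda>i g. ?r (ext_act n g (f i))" g0] pconst[of 1 n] pmult polyfun_diff
    by blast
  have "?m \<le> rk n J g d w" if "p g \<noteq> 0" for g
    by (rule rk_ge[OF subspace_J p(3)[OF that]]) (use f ext_act_hpart in blast)
  then show ?thesis using p by blast
qed

lemma rk_bounded: "rk n J g d w \<le> card (Pow {..<n})"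
proof -
  have "hpart d (ext_act n g ` J) \<subseteq> ext_carrier n" unfolding hpart_def using ext_act_carrier by blast
  from leads_subset[OF this] show ?thesis unfolding rk_def by (intro card_mono) auto
qed

lemma rk_max:
  "\<exists>p\<in>polyfun n. (\<exists>g. p g \<noteq> 0) \<and> (\<forall>g g'. p g \<noteq> 0 \<longrightarrow> rk n J g' d w \<le> rk n J g d w)"
proof -
  obtain g0 where g0: "\<And>g'. rk n J g' d w \<le> rk n J g0 d w"
    using ex_has_greatest_nat[of "\<lambda>_. True" undefined "\<lambda>g. rk n J g d w" "Suc (card (Pow {..<n}))"]
      rk_bounded by (auto simp: less_Suc_eq_le)
  obtain p where "p \<in> polyfun n" "p g0 \<noteq> 0" "\<And>g. p g \<noteq> 0 \<Longrightarrow> rk n J g0 d w \<le> rk n J g d w"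
    using rk_semicontinuous by blast
  then show ?thesis using g0 by (meson order_trans)
qed

end

text \<open>Independence of the columns replaces the determinant. It makes the matrix injective on a
  finite-dimensional space, hence onto, which yields a right inverse; injectivity makes this inverse
  two-sided.\<close>

lemma invertible_open:
  "\<exists>p\<in>polyfun n. (\<exists>g. p g \<noteq> 0) \<and> (\<forall>g :: nat \<Rightarrow> nat \<Rightarrow> 'k::field. p g \<noteq> 0 \<longrightarrow> (\<exists>h. inv_pair n g h))"
proof -
  define v where "v = (\<lambda>j (g :: nat \<Rightarrow> nat \<Rightarrow> 'k) i. if i < n then g i j else 0)"
  define I where "I = (\<lambda>(i::nat) (j::nat). if i = j then 1 else (0::'k))"
  have "indep n (\<lambda>j. v j I)"
    unfolding indep_def
  proof (intro allI impI)
    fix c j assume c: "\<forall>x. (\<Sum>j<n. c j * v j I x) = 0" and j: "j < n"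
    have "(\<Sum>k<n. c k * v k I j) = (\<Sum>k<n. if k = j then c j else 0)"
      using j by (intro sum.cong refl) (auto simp: v_def I_def)
    then show "c j = 0" using c j by simp
  qed
  moreover have "(\<lambda>g. v j g i) \<in> polyfun n" if "j < n" for j i
    unfolding v_def using that by (cases "i < n") (auto intro: pvar pconst)
  ultimately obtain p where p: "p \<in> polyfun n" "p I \<noteq> 0" "\<And>g. p g \<noteq> 0 \<Longrightarrow> indep n (\<lambda>j. v j g)"
    using indep_open[of "polyfun n" n v I] pconst[of 1 n] pmult polyfun_diff by blast
  have "\<exists>h. inv_pair n g h" if g: "p g \<noteq> 0" for g
  proof -
    define V where "V = {f :: nat \<Rightarrow> 'k. \<forall>j\<ge>n. f j = 0}"
    define L where "L = (\<lambda>(f :: nat \<Rightarrow> 'k) i. if i < n then \<Sum>j<n. g i j * f j else 0)"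
    have V: "fv.subspace V" unfolding V_def fv.subspace_def by auto
    have linL: "Vector_Spaces.linear fsc fsc L"
      by unfold_locales (auto simp: L_def fun_eq_iff algebra_simps sum.distrib sum_distrib_left)
    define e where "e = (\<lambda>(j::nat) (i::nat). if i = j then 1 else (0::'k))"
    have "V \<subseteq> fv.span (e ` {..<n})"
    proof
      fix f assume f: "f \<in> V"
      have "f i = (\<Sum>j<n. fsc (f j) (e j)) i" for i
      proof -
        have "(\<Sum>j<n. fsc (f j) (e j)) i = (\<Sum>j<n. if j = i then f i else 0)"
          unfolding sum_fun_apply by (intro sum.cong refl) (auto simp: e_def)
        then show ?thesis using f by (auto simp: V_def not_less)
      qed
      then have "f = (\<Sum>j<n. fsc (f j) (e j))" by (intro ext)
      also have "\<dots> \<in> fv.span (e ` {..<n})" by (intro fv.span_sum fv.span_scale fv.span_base) auto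
      finally show "f \<in> fv.span (e ` {..<n})" .
    qed
    then have fdV: "fv.fin_dim V" unfolding fv.fin_dim_def by (intro exI[of _ "e ` {..<n}"]) auto
    have inj: "f = 0" if f: "f \<in> V" "L f = 0" for f
    proof -
      have "(\<Sum>j<n. f j * v j g i) = 0" for i
        using fun_cong[OF f(2), of i] by (cases "i < n") (simp_all add: v_def L_def mult.commute)
      then have "\<forall>j<n. f j = 0" using p(3)[OF g] unfolding indep_def by blast
      then show ?thesis using f(1) by (auto simp: V_def fun_eq_iff not_less[symmetric])
    qed
    have "fv.dim (L ` V) = fv.dim V" by (rule ff.dim_image_inj[OF V fdV linL inj])
    moreover have "L ` V \<subseteq> V" unfolding L_def V_def by auto
    ultimately have onto: "L ` V = V"
      using fv.fin_dim_subspace_eq[OF fdV _ ff.linear_subspace_image[OF linL V]] by simp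
    have "\<exists>f\<in>V. L f = e j" if "j < n" for j
    proof -
      have "e j \<in> V" using that unfolding e_def V_def by auto
      then show ?thesis using onto by (metis imageE)
    qed
    then obtain c where c: "\<And>j. j < n \<Longrightarrow> c j \<in> V \<and> L (c j) = e j" by metis
    define h where "h = (\<lambda>i j. c j i)"
    have gh: "is_one n (mmul n g h)"
      unfolding is_one_def
    proof (intro allI impI)
      fix i j assume ij: "i < n" "j < n"
      have "mmul n g h i j = L (c j) i" using ij(1) by (simp add: mmul_def L_def h_def)
      then show "mmul n g h i j = (if i = j then 1 else 0)" using c[OF ij(2)] by (simp add: e_def)
    qed
    have "is_one n (mmul n h g)"
      unfolding is_one_def
    proof (intro allI impI)
      fix i j assume ij: "i < n" "j < n"
      define f where "f = (\<lambda>i. if i < n then mmul n h g i j - (if i = j then 1 else 0) else 0)"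
      have "L f k = 0" for k
      proof (cases "k < n")
        case True
        have "(\<Sum>i<n. g k i * mmul n h g i j) = (\<Sum>i<n. \<Sum>l<n. g k i * h i l * g l j)"
          unfolding mmul_def by (simp add: sum_distrib_left mult.assoc)
        also have "\<dots> = (\<Sum>l<n. mmul n g h k l * g l j)"
          unfolding mmul_def sum_distrib_right by (rule sum.swap)
        also have "\<dots> = (\<Sum>l<n. if l = k then g k j else 0)"
          using gh True by (intro sum.cong refl) (auto simp: is_one_def)
        also have "\<dots> = g k j" using True by simp
        finally have 1: "(\<Sum>i<n. g k i * mmul n h g i j) = g k j" .
        have "(\<Sum>i<n. g k i * (if i = j then 1 else 0)) = (\<Sum>i<n. if i = j then g k j else 0)"
          by (intro sum.cong refl) auto
        then have 2: "(\<Sum>i<n. g k i * (if i = j then 1 else 0)) = g k j" using ij by simp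
        have "L f k = (\<Sum>i<n. g k i * mmul n h g i j - g k i * (if i = j then 1 else 0))"
          unfolding L_def f_def using True by (simp add: right_diff_distrib)
        then show ?thesis using 1 2 by (simp only: sum_subtractf) simp
      qed (simp add: L_def)
      then have "L f = 0" by (intro ext) simp
      moreover have "f \<in> V" unfolding V_def f_def by simp
      ultimately have "f = 0" using inj by blast
      then have "f i = 0" by simp
      then show "mmul n h g i j = (if i = j then 1 else 0)" using ij by (simp add: f_def)
    qed
    then show ?thesis using gh unfolding inv_pair_def by blast
  qed
  then show ?thesis using p by blast
qed

text \<open>Degrees exceed \<open>n\<close> for no monomial and codes stay below
  \<open>2 ^ n\<close>, so these are finitely many conditions and hold on a common nonempty open
  set.\<close>

definition generic :: "nat \<Rightarrow> 'k::field ext set \<Rightarrow> (nat \<Rightarrow> nat \<Rightarrow> 'k) \<Rightarrow> bool" where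
  "generic n J g \<longleftrightarrow> (\<exists>h. inv_pair n g h) \<and>
     (\<forall>d\<le>n. \<forall>w\<le>2 ^ n. \<forall>g'. rk n J g' d w \<le> rk n J g d w)"

lemma (in gid) generic_open:
  assumes inf: "infinite (UNIV :: 'k set)"
  shows "\<exists>p\<in>polyfun n. (\<exists>g. p g \<noteq> 0) \<and> (\<forall>g. p g \<noteq> 0 \<longrightarrow> generic n J g)"
proof -
  have "\<forall>d w. \<exists>p. p \<in> polyfun n \<and> (\<exists>g. p g \<noteq> 0) \<and> (\<forall>g g'. p g \<noteq> 0 \<longrightarrow> rk n J g' d w \<le> rk n J g d w)"
    using rk_max by blast
  then obtain P where P: "\<And>d w. P d w \<in> polyfun n" "\<And>d w. \<exists>g. P d w g \<noteq> 0"
    "\<And>d w g g'. P d w g \<noteq> 0 \<Longrightarrow> rk n J g' d w \<le> rk n J g d w" by metis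
 obtain q :: "(nat \<Rightarrow> nat \<Rightarrow> 'k) \<Rightarrow> 'k" where q: "q \<in> polyfun n" "\<exists>g. q g \<noteq> 0" "\<And>g. q g \<noteq> 0 \<Longrightarrow> \<exists>h. inv_pair n g h"
    using invertible_open[of n, where ?'k = 'k] by blast
  define F where "F = (\<lambda>x. case x of None \<Rightarrow> q | Some (d, w) \<Rightarrow> P d w)"
  have "\<exists>r\<in>polyfun n. (\<exists>g. r g \<noteq> 0) \<and>
      (\<forall>g. r g \<noteq> 0 \<longrightarrow> (\<forall>i\<in>insert None (Some ` ({..n} \<times> {..2 ^ n})). F i g \<noteq> 0))"
  proof (rule polyfun_finite_common[OF inf])
    show "F i \<in> polyfun n" for i using q(1) P(1) unfolding F_def by (auto split: option.splits)
    show "\<exists>g. F i g \<noteq> 0" for i using q(2) P(2) unfolding F_def by (auto split: option.splits)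
  qed auto
  then obtain r where r: "r \<in> polyfun n" "\<exists>g. r g \<noteq> 0"
    "\<And>g i. r g \<noteq> 0 \<Longrightarrow> i \<in> insert None (Some ` ({..n} \<times> {..2 ^ n})) \<Longrightarrow> F i g \<noteq> 0" by blast
  have "generic n J g" if g: "r g \<noteq> 0" for g
    unfolding generic_def
  proof (intro conjI allI impI)
    have "F None g \<noteq> 0" by (rule r(3)[OF g]) simp
    then show "\<exists>h. inv_pair n g h" using q(3) by (simp add: F_def)
    fix d w g' assume "d \<le> n" "w \<le> (2::nat) ^ n"
    then have "F (Some (d, w)) g \<noteq> 0" by (intro r(3)[OF g]) auto
    then show "rk n J g' d w \<le> rk n J g d w" using P(3) by (simp add: F_def)
  qed
  then show ?thesis using r by blast
qed


lemma enc_bound: "S \<subseteq> {..<n} \<Longrightarrow> enc S < 2 ^ n"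
proof -
  assume "S \<subseteq> {..<n}"
  then have "enc S \<le> sum ((^) (2::nat)) {..<n}" unfolding set_encode_def by (intro sum_mono2) auto
  also have "\<dots> < 2 ^ n" by (induct n) auto
  finally show ?thesis .
qed

text \<open>Membership of \<open>S\<close> is visible as the jump of the counting function between
  \<open>enc S\<close> and \<open>Suc (enc S)\<close>.\<close>

lemma count_determines:
  assumes A: "A \<subseteq> Pow {..<n}" "A' \<subseteq> Pow {..<n}"
    and eq: "\<And>w. w \<le> 2 ^ n \<Longrightarrow> card {S \<in> A. enc S < w} = card {S \<in> A'. enc S < w}"
  shows "A = A'"
proof -
  have iff: "S \<in> B \<longleftrightarrow> card {T \<in> B. enc T < Suc (enc S)} \<noteq> card {T \<in> B. enc T < enc S}"
    if B: "B \<subseteq> Pow {..<n}" and S: "S \<subseteq> {..<n}" for B S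
  proof -
    have fin: "finite {T \<in> B. enc T < enc S}" by (rule finite_subset[of _ "Pow {..<n}"]) (use B in auto)
    have eq: "enc T = enc S \<longleftrightarrow> T = S" if "T \<in> B" for T
      using that B S by (intro set_encode_eq) (auto intro: finite_subset)
    have "{T \<in> B. enc T < Suc (enc S)} = (if S \<in> B then insert S {T \<in> B. enc T < enc S} else {T \<in> B. enc T < enc S})"
      using eq by (auto simp: less_Suc_eq)
    then show ?thesis using fin by auto
  qed
  have "S \<in> A \<longleftrightarrow> S \<in> A'" if "S \<subseteq> {..<n}" for S
    using iff[OF A(1) that] iff[OF A(2) that] eq[of "enc S"] eq[of "Suc (enc S)"] enc_bound[OF that] by simp
  then show ?thesis using A by blast
qed

context gid begin

lemma generic_hleads:
  assumes g: "generic n J g" and g': "generic n J g'"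
  shows "hleads (ext_act n g ` J) = hleads (ext_act n g' ` J)"
proof -
  have sub: "leads (hpart d (ext_act n g ` J)) \<subseteq> Pow {..<n}" for d g
    by (rule leads_subset) (use ext_act_carrier in \<open>auto simp: hpart_def\<close>)
  have "leads (hpart d (ext_act n g ` J)) = leads (hpart d (ext_act n g' ` J))" for d
  proof (cases "d \<le> n")
    case True
    show ?thesis
    proof (rule count_determines[OF sub sub])
      fix w :: nat assume "w \<le> 2 ^ n"
      then have "rk n J g d w = rk n J g' d w"
        using g g' True unfolding generic_def by (meson order_antisym)
      then show "card {S \<in> leads (hpart d (ext_act n g ` J)). enc S < w}
          = card {S \<in> leads (hpart d (ext_act n g' ` J)). enc S < w}" unfolding rk_def .
    qed
  next
    case False
    have "leads (hpart d (ext_act n g ` J)) = {}" for g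
    proof -
      have "card S = d \<and> card S \<le> card {..<n}" if "S \<in> leads (hpart d (ext_act n g ` J))" for S
      proof
        show "card S = d" using that unfolding leads_hpart by simp
        show "card S \<le> card {..<n}" using that sub[of d g] by (intro card_mono) auto
      qed
      then show ?thesis using False by fastforce
    qed
    then show ?thesis by simp
  qed
  then show ?thesis unfolding hleads_def by simp
qed

lemma generic_lid: "generic n J g \<Longrightarrow> lid n (ext_act n g ` J)"
  unfolding generic_def inv_pair_def using lid_ext_act[OF lid_axioms] by blast

text \<open>The \<open>THE\<close> is well defined because two nonempty open sets of matrices meet,
  which forces the candidate ideals to agree.\<close>

lemma Gin_eq:
  assumes inf: "infinite (UNIV :: 'k set)" and g: "generic n J g"
  shows "Gin n J = mono_ideal n (hleads (ext_act n g ` J))"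
proof -
  obtain p where p: "p \<in> polyfun n" "\<exists>g. p g \<noteq> 0" "\<And>g. p g \<noteq> 0 \<Longrightarrow> generic n J g"
    using generic_open[OF inf] by blast
  let ?I = "mono_ideal n (hleads (ext_act n g ` J)) :: 'k ext set"
  have good: "invertible_mat n g' \<and> in_ideal n (ext_act n g' ` J) = ?I" if g': "generic n J g'" for g'
  proof
    show "invertible_mat n g'"
      using g' unfolding generic_def inv_pair_def invertible_mat_def is_one_def mmul_def by blast
    show "in_ideal n (ext_act n g' ` J) = ?I"
      unfolding lid.in_ideal_eq[OF generic_lid[OF g']] generic_hleads[OF g g'] ..
  qed
  show ?thesis unfolding Gin_def
  proof (rule the_equality)
    show "\<exists>p\<in>polyfun n. (\<exists>g. p g \<noteq> 0) \<and>
      (\<forall>g. p g \<noteq> 0 \<longrightarrow> invertible_mat n g \<and> in_ideal n (ext_act n g ` J) = ?I)"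
      using p good by blast
    fix I assume "\<exists>p\<in>polyfun n. (\<exists>g. p g \<noteq> 0) \<and>
      (\<forall>g. p g \<noteq> 0 \<longrightarrow> invertible_mat n g \<and> in_ideal n (ext_act n g ` J) = I)"
    then obtain q g1 where q: "q \<in> polyfun n" "q g1 \<noteq> 0"
      "\<And>g. q g \<noteq> 0 \<Longrightarrow> in_ideal n (ext_act n g ` J) = I" by blast
    obtain g2 where g2: "p g2 \<noteq> 0" using p(2) by blast
    obtain g' where "p g' \<noteq> 0" "q g' \<noteq> 0" using polyfun_common[OF inf p(1) g2 q(1,2)] by blast
    then show "I = ?I" using q(3) good p(3) by metis
  qed
qed

end

subsection \<open>Transvections and stability\<close>

definition elem :: "nat \<Rightarrow> nat \<Rightarrow> 'k::field \<Rightarrow> nat \<Rightarrow> nat \<Rightarrow> 'k" where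
  "elem l m t = (\<lambda>i j. (if i = j then 1 else 0) + (if i = l \<and> j = m then t else 0))"

text \<open>The interior product with the coordinate dual to \<open>e_m\<close>;
  \<open>cn_lm\<close> is its graded Leibniz rule.\<close>

definition cn :: "nat \<Rightarrow> 'k::field ext \<Rightarrow> 'k ext" where
  "cn m f = (\<lambda>T. if m \<in> T then 0 else sg m T * f (insert m T))"

lemma cn_lm:
  fixes f :: "'k::field ext"
  shows "cn m (lm j f) = (if j = m then f else 0) - lm j (cn m f)"
proof
  fix T
  show "cn m (lm j f) T = ((if j = m then f else 0) - lm j (cn m f)) T"
  proof (cases "m \<in> T")
    case True
    then have "insert m (T - {m}) = T" by blast
    then show ?thesis using True by (auto simp: cn_def lm_def insert_absorb)
  next
    case mT: False
    show ?thesis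
    proof (cases "j = m")
      case True
      then show ?thesis using mT by (simp add: cn_def lm_def)
    next
      case jm: False
      show ?thesis
      proof (cases "j \<in> T")
        case True
        have e: "insert m T - {j} = insert m (T - {j})" using jm by blast
        have "insert m T - {m} = T" using mT by blast
        then have 1: "sg j T = (if m < j then - sg j (insert m T) else sg j (insert m T) :: 'k)"
          using sg_remove[of m "insert m T" j] by simp
        show ?thesis
        proof (cases "m < j")
          case lt: True
          have "sg j (insert m T) = - (sg j T :: 'k)" "sg m (T - {j}) = (sg m T :: 'k)"
            using 1 lt sg_remove[OF True, of m] by simp_all
          then show ?thesis using jm mT True e by (simp add: cn_def lm_def mult_ac)
        next
          case ge: False
          then have "j < m" using jm by simp
          then have "sg j (insert m T) = (sg j T :: 'k)" "sg m (T - {j}) = - (sg m T :: 'k)"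
            using 1 ge sg_remove[OF True, of m] by simp_all
          then show ?thesis using jm mT True e by (simp add: cn_def lm_def mult_ac)
        qed
      next
        case False
        then show ?thesis using jm mT by (simp add: cn_def lm_def)
      qed
    qed
  qed
qed

lemma cn_add: "cn m (f + g) = cn m f + cn m g" by (auto simp: cn_def fun_eq_iff algebra_simps)
lemma cn_fsc: "cn m (fsc r f) = fsc r (cn m f)" by (auto simp: cn_def fun_eq_iff)

text \<open>A transvection alters at most one factor of a monomial, so its effect is linear in
  \<open>t\<close>: the identity plus \<open>t\<close> times the operator replacing
  \<open>e_m\<close> by \<open>e_l\<close>.\<close>

definition transv :: "nat \<Rightarrow> nat \<Rightarrow> 'k::field \<Rightarrow> 'k ext \<Rightarrow> 'k ext" where
  "transv l m t f = f + fsc t (lm l (cn m f))"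

lemma lin_transv: "Vector_Spaces.linear fsc fsc (transv l m t)"
  by unfold_locales
    (simp_all add: transv_def cn_add cn_fsc lm_add lm_fsc fv.scale_right_distrib mult.commute)

lemma lmg_elem:
  assumes "j < n" "l < n"
  shows "lmg n (elem l m t) j p = lm j p + (if j = m then fsc t (lm l p) else 0)"
proof -
  have "lmg n (elem l m t) j p = (\<Sum>k<n. (if k = j then lm j p else 0) + (if k = l then (if j = m then fsc t (lm l p) else 0) else 0))"
    unfolding lmg_def elem_def by (intro sum.cong refl) (auto simp: fun_eq_iff algebra_simps)
  also have "\<dots> = lm j p + (if j = m then fsc t (lm l p) else 0)"
    unfolding sum.distrib using assms by simp
  finally show ?thesis .
qed

lemma transv_lm:
  assumes "j < n" "l < n"
  shows "lmg n (elem l m t) j (transv l m t p) = transv l m t (lm j p)"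
proof -
  have a: "lm l (lm j (cn m p)) = - lm j (lm l (cn m p))" by (rule lm_anticomm)
  show ?thesis
  proof (cases "j = m")
    case True
    then show ?thesis unfolding lmg_elem[OF assms] transv_def cn_lm
      by (simp only: if_True lm_add lm_diff lm_fsc a[unfolded True] lm_lm True) (simp add: fun_eq_iff algebra_simps)
  next
    case False
    then show ?thesis unfolding lmg_elem[OF assms] transv_def cn_lm
      by (simp add: lm_add lm_neg lm_fsc a)
  qed
qed

lemma is_one_id: "is_one n (\<lambda>i j. if i = j then 1 else 0)" unfolding is_one_def by simp

lemma ext_act_elem:
  fixes f :: "'k::field ext"
  assumes f: "f \<in> ext_carrier n" and l: "l < n"
  shows "ext_act n (elem l m t) f = transv l m t f"
proof -
  have E: "eprod n (elem l m t) xs = transv l m t (ext_mono (set xs))"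
    if "sorted xs" "distinct xs" "set xs \<subseteq> {..<n}" for xs
    using that
  proof (induct xs)
    case Nil
    have "cn m (ext_mono {} :: 'k ext) = 0" by (auto simp: cn_def ext_mono_def fun_eq_iff)
    then show ?case by (simp add: transv_def)
  next
    case (Cons x xs)
    have x: "x < n" using Cons by simp
    have id: "is_one n (\<lambda>i j. if i = j then 1 else (0::'k))" by (rule is_one_id)
    have "(ext_mono (set (x # xs)) :: 'k ext) = lm x (ext_mono (set xs))"
    proof -
      have "(ext_mono (set (x # xs)) :: 'k ext) = eprod n (\<lambda>i j. if i = j then 1 else (0::'k)) (x # xs)"
        using eprod_is_one[OF id Cons(2,3,4)] by simp
      also have "\<dots> = lmg n (\<lambda>i j. if i = j then 1 else (0::'k)) x (ext_mono (set xs))"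
        using eprod_is_one[OF id, of xs] Cons by simp
      also have "\<dots> = (\<Sum>k<n. if k = x then lm x (ext_mono (set xs)) else 0)"
        unfolding lmg_def by (intro sum.cong refl) (auto simp: fun_eq_iff)
      finally show ?thesis using x by simp
    qed
    then show ?case using Cons transv_lm[OF x l] by simp
  qed
  have "ext_act n (elem l m t) f = (\<Sum>S\<in>Pow {..<n}. fsc (f S) (transv l m t (ext_mono S)))"
    unfolding ext_act_eq
  proof (intro sum.cong refl)
    fix S assume S: "S \<in> Pow {..<n}"
    then have "finite S" using finite_subset by auto
    then show "fsc (f S) (eprod n (elem l m t) (sorted_list_of_set S)) = fsc (f S) (transv l m t (ext_mono S))"
      using E[of "sorted_list_of_set S"] S by simp
  qed
  also have "\<dots> = transv l m t (\<Sum>S\<in>Pow {..<n}. fsc (f S) (ext_mono S))"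
    by (simp add: ff.linear_sum[OF lin_transv] ff.linear_scale[OF lin_transv])
  finally show ?thesis using carrier_expand[OF f] by simp
qed

text \<open>A transvection moves the leading term \<open>S\<close> to \<open>insert l (S - {m})\<close> and
  creates no larger term.\<close>

lemma restr_transv_lead:
  assumes f: "f \<in> ext_carrier n" "is_lead f S" and m: "m \<in> S" and l: "l \<notin> S" "l < m"
  shows "restr (\<lambda>R. enc R \<le> enc (insert l (S - {m}))) (transv l m t f)
    = fsc (t * (sg l (insert l (S - {m})) * (sg m (S - {m}) * f S))) (ext_mono (insert l (S - {m})))"
    (is "restr (\<lambda>R. enc R \<le> enc ?S') _ = ?rhs")
proof
  fix R
  have fS: "f S \<noteq> 0" using f(2) unfolding is_lead_def by blast
  have finS: "finite S" using carrier_finite[OF f(1) fS] by simp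
  \<comment> \<open>Exchanging \<open>m\<close> for \<open>l\<close> shifts all codes by the same
    amount, so the order among the monomials concerned is kept.\<close>
  have encT: "enc (insert l (T - {m})) + 2 ^ m = enc T + 2 ^ l" if "finite T" "m \<in> T" "l \<notin> T" for T
  proof -
    have "enc (insert m (T - {m})) = 2 ^ m + enc (T - {m})" using that by (intro set_encode_insert) auto
    moreover have "enc (insert l (T - {m})) = 2 ^ l + enc (T - {m})" using that by (intro set_encode_insert) auto
    moreover have "insert m (T - {m}) = T" using that by blast
    ultimately show ?thesis by simp
  qed
  have lt: "enc ?S' < enc S"
  proof -
    have "(2::nat) ^ l < 2 ^ m" using l(2) by simp
    then show ?thesis using encT[OF finS m l(1)] by linarith
  qed
  have lS': "l \<in> ?S'" "m \<notin> ?S'" using l by auto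
  have S'm: "insert m (?S' - {l}) = S" using m l by auto
  have nz: "lm l (cn m f) R = (if R = ?S' then sg l ?S' * (sg m (S - {m}) * f S) else 0)"
    if R: "enc R \<le> enc ?S'"
  proof (cases "R = ?S'")
    case True
    have "?S' - {l} = S - {m}" using l by auto
    then show ?thesis using True lS' S'm by (simp add: lm_def cn_def)
  next
    case False
    have "lm l (cn m f) R = 0"
    proof (rule ccontr)
      assume "lm l (cn m f) R \<noteq> 0"
      then have a: "l \<in> R" "m \<notin> R - {l}" "f (insert m (R - {l})) \<noteq> 0"
        unfolding lm_def cn_def by (auto split: if_splits)
      define T where "T = insert m (R - {l})"
      have T: "m \<in> T" "l \<notin> T" "f T \<noteq> 0" "insert l (T - {m}) = R"
        using a l(2) unfolding T_def by auto
      have finT: "finite T" using carrier_finite[OF f(1) T(3)] by simp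
      have "enc R + 2 ^ m = enc T + 2 ^ l" using encT[OF finT T(1,2)] T(4) by simp
      then have "enc T \<le> enc S" using R encT[OF finS m l(1)] by linarith
      then have "T = S" using is_lead_ge[OF f(1,2) T(3)] set_encode_eq[OF finT finS] by simp
      then show False using T(4) False by simp
    qed
    then show ?thesis using False by simp
  qed
  have fR: "f R = 0" if R: "enc R \<le> enc ?S'"
  proof (rule ccontr)
    assume "f R \<noteq> 0"
    then show False using is_lead_ge[OF f(1,2)] lt R by fastforce
  qed
  show "restr (\<lambda>R. enc R \<le> enc ?S') (transv l m t f) R = ?rhs R"
  proof (cases "enc R \<le> enc ?S'")
    case True
    then show ?thesis using nz fR by (simp add: restr_def transv_def ext_mono_def)
  next
    case False
    then have "R \<noteq> ?S'" by auto
    then show ?thesis using False by (simp add: restr_def ext_mono_def)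
  qed
qed

text \<open>If an exchanged monomial \<open>S'\<close> were missing among the leading ones, a
  transvection would bring it in as an additional independent truncated element and raise a rank
  beyond its generic value.\<close>

lemma (in gid) stable_generic:
  assumes inf: "infinite (UNIV :: 'k set)" and g: "generic n J g"
  shows "stable (hleads (ext_act n g ` J))"
  unfolding stable_def
proof (intro ballI impI allI, rule ccontr)
  fix S l
  let ?M = "hleads (ext_act n g ` J)"
  assume S: "S \<in> ?M" and Sne: "S \<noteq> {}" and l: "l < Max S" "l \<notin> S"
    and nM: "insert l (S - {Max S}) \<notin> ?M"
  define m where "m = Max S"
  define S' where "S' = insert l (S - {m})"
  define d where "d = card S"
  \<comment> \<open>The successor makes the strict bound in \<open>rk\<close> include
    \<open>S'\<close> itself.\<close>
  define w where "w = Suc (enc S')"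
  have Sn: "S \<subseteq> {..<n}" using lid.hleads_subset[OF generic_lid[OF g]] S by blast
  then have finS: "finite S" using finite_subset by blast
  have mS: "m \<in> S" unfolding m_def using finS Sne by (rule Max_in)
  have mn: "m < n" "l < n" using mS Sn l unfolding m_def by auto
  have S'n: "S' \<subseteq> {..<n}" unfolding S'_def using mn Sn by auto
  have dn: "d \<le> n" unfolding d_def using card_mono[OF _ Sn] by simp
  have "card S' = d"
  proof -
    have "card S = Suc (card (S - {m}))" by (rule card.remove[OF finS mS])
    moreover have "card S' = Suc (card (S - {m}))" unfolding S'_def using finS l by simp
    ultimately show ?thesis unfolding d_def by simp
  qed
  have "S \<in> leads (hpart d (ext_act n g ` J))" unfolding leads_hpart d_def using S by simp
  then obtain f0 where f0: "f0 \<in> hpart d J" "is_lead (ext_act n g f0) S"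
    unfolding leads_def using hpart_lift by blast
  let ?r = "rk n J g d w"
  obtain s f where s: "bij_betw s {..<?r} {S \<in> leads (hpart d (ext_act n g ` J)). enc S < w}"
    and f: "\<And>i. i < ?r \<Longrightarrow> f i \<in> hpart d J" "\<And>i. i < ?r \<Longrightarrow> is_lead (ext_act n g (f i)) (s i)"
    using lead_family[of g d w] by blast
  let ?R = "restr (\<lambda>R. enc R < w) :: 'k ext \<Rightarrow> 'k ext"
  \<comment> \<open>For \<open>t\<close> nonzero the last member is the truncation of the
    transformed \<open>f0\<close> after rescaling, which is exactly \<open>ext_mono S'\<close>. It
    extends to \<open>t = 0\<close>, where independence is read off from distinct leading monomials
    and then spreads to almost all \<open>t\<close>.\<close>
  define v where "v = (\<lambda>i t. if i < ?r then ?R (transv l m t (ext_act n g (f i))) else (ext_mono S' :: 'k ext))"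
  have sS': "s i \<noteq> S'" and sw: "enc (s i) < w" if "i < ?r" for i
  proof -
    have "s i \<in> {S \<in> leads (hpart d (ext_act n g ` J)). enc S < w}" using bij_betwE[OF s] that by simp
    then show "enc (s i) < w" and "s i \<noteq> S'" using nM unfolding leads_hpart S'_def m_def by auto
  qed
  have i0: "indep (Suc ?r) (\<lambda>i. v i 0)"
  proof (rule indep_leads[where s = "\<lambda>i. if i < ?r then s i else S'"])
    fix i
    show "v i 0 \<in> ext_carrier n"
      unfolding v_def transv_def by (auto intro: restr_carrier ext_act_carrier ext_mono_carrier[OF S'n])
    show "is_lead (v i 0) (if i < ?r then s i else S')"
    proof (cases "i < ?r")
      case True
      then show ?thesis
        using is_lead_restr[OF f(2)[OF True], of "\<lambda>R. enc R < w"] sw by (simp add: v_def transv_def)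
    next
      case False
      then show ?thesis by (simp add: v_def is_lead_def ext_mono_def)
    qed
    show "inj_on (\<lambda>i. if i < ?r then s i else S') {..<Suc ?r}"
    proof (rule inj_onI)
      fix i j assume ij: "i \<in> {..<Suc ?r}" "j \<in> {..<Suc ?r}"
        "(if i < ?r then s i else S') = (if j < ?r then s j else S')"
      have "inj_on s {..<?r}" using s unfolding bij_betw_def by blast
      then show "i = j" using ij sS'[of i] sS'[of j]
        by (cases "i < ?r"; cases "j < ?r") (auto simp: inj_on_def less_Suc_eq)
    qed
  qed
  define A where "A = range (poly :: 'k poly \<Rightarrow> 'k \<Rightarrow> 'k)"
  have "\<exists>u\<in>A. u 0 \<noteq> 0 \<and> (\<forall>t. u t \<noteq> 0 \<longrightarrow> indep (Suc ?r) (\<lambda>i. v i t))"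
  proof (rule indep_open)
    show "(\<lambda>_. 1) \<in> A" unfolding A_def by (intro image_eqI[of _ _ 1]) auto
    show "(\<lambda>p. a p * b p) \<in> A" if "a \<in> A" "b \<in> A" for a b
      using that unfolding A_def by (auto simp: fun_eq_iff intro: exI[of _ "_ * _"] image_eqI[of _ _ "_ * _"])
    show "(\<lambda>p. a p - b p) \<in> A" if "a \<in> A" "b \<in> A" for a b
      using that unfolding A_def by (auto simp: fun_eq_iff intro: image_eqI[of _ _ "_ - _"])
    show "(\<lambda>t. v i t x) \<in> A" for i x
    proof -
      have "(\<lambda>t. v i t x) = poly (if i < ?r then if enc x < w then
          [:ext_act n g (f i) x, lm l (cn m (ext_act n g (f i))) x:] else 0 else [:ext_mono S' x:])"
        by (auto simp: v_def restr_def transv_def fun_eq_iff)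
      then show ?thesis unfolding A_def by blast
    qed
  qed (rule i0)
  then obtain P where P: "poly P 0 \<noteq> 0" "\<And>t. poly P t \<noteq> 0 \<Longrightarrow> indep (Suc ?r) (\<lambda>i. v i t)"
    unfolding A_def by blast
  have "P \<noteq> 0" using P(1) by auto
  then have "infinite {t. poly P t \<noteq> 0}" by (rule poly_nonroot[OF inf])
  then have "{t. poly P t \<noteq> 0} - {0} \<noteq> {}" using finite_subset[of "{t. poly P t \<noteq> 0}" "{0}"] by auto
  then obtain t where t: "poly P t \<noteq> 0" "t \<noteq> 0" by blast
  have wle: "w \<le> 2 ^ n" unfolding w_def using enc_bound[OF S'n] by simp
  define c where "c = t * (sg l S' * (sg m (S - {m}) * ext_act n g f0 S))"
  have c0: "c \<noteq> 0" using t(2) f0(2) unfolding c_def is_lead_def by simp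
  have RF0: "?R (transv l m t (ext_act n g f0)) = fsc c (ext_mono S')"
    using restr_transv_lead[OF ext_act_carrier f0(2) mS l(2)] l(1)
    unfolding c_def S'_def w_def m_def by (simp add: less_Suc_eq_le)
  define g' where "g' = mmul n (elem l m t) g"
  have act: "ext_act n g' f = transv l m t (ext_act n g f)" for f
    unfolding g'_def ext_act_ext_act[symmetric] by (rule ext_act_elem[OF ext_act_carrier mn(2)])
  define h where "h = (\<lambda>i. if i < ?r then f i else fsc (1 / c) f0)"
  have hJ: "h i \<in> hpart d J" for i
    unfolding h_def using f(1) fv.subspace_scale[OF hpart_subspace[OF subspace_J] f0(1)] by auto
  have "v i t = ?R (ext_act n g' (h i))" for i
  proof (cases "i < ?r")
    case False
    have "?R (ext_act n g' (fsc (1 / c) f0)) = fsc (1 / c) (?R (transv l m t (ext_act n g f0)))"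
      unfolding act[symmetric] by (simp add: ext_act_fsc ff.linear_scale[OF lin_restr])
    also have "\<dots> = ext_mono S'" unfolding RF0 using c0 by (simp add: fun_eq_iff)
    finally show ?thesis using False by (simp add: v_def h_def)
  qed (simp add: v_def h_def act)
  then have "indep (Suc ?r) (\<lambda>i. ?R (ext_act n g' (h i)))" using P(2)[OF t(1)] by simp
  from rk_ge[OF subspace_J this, where d = d and n = n and g = g'] have "Suc ?r \<le> rk n J g' d w"
    using ext_act_hpart[OF hJ] by blast
  also have "\<dots> \<le> ?r" using g dn wle unfolding generic_def by blast
  finally show False by simp
qed


subsection \<open>Graded left ideals are two-sided\<close>

lemma ext_mult_ext_mono:
  assumes f: "f \<in> ext_carrier n"
  shows "ext_mult (ext_mono S) f T = (if finite T \<and> S \<subseteq> T then ext_sign S (T - S) * f (T - S) else 0)"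
proof (cases "finite T")
  case True
  have "ext_mult (ext_mono S) f T = (\<Sum>R\<in>Pow T. if R = S then ext_sign S (T - S) * f (T - S) else 0)"
    unfolding ext_mult_def by (rule sum.cong) (auto simp: ext_mono_def)
  then show ?thesis using True by simp
qed (simp add: ext_mult_def)

lemma ext_mult_mono_insert:
  assumes f: "f \<in> ext_carrier n" and S: "finite S" "\<And>a. a \<in> S \<Longrightarrow> j < a"
  shows "ext_mult (ext_mono (insert j S)) f = lm j (ext_mult (ext_mono S) f)"
proof
  fix T
  have jS: "j \<notin> S" using S(2) by blast
  show "ext_mult (ext_mono (insert j S)) f T = lm j (ext_mult (ext_mono S) f) T"
  proof (cases "finite T \<and> insert j S \<subseteq> T")
    case False
    then show ?thesis using jS by (auto simp: lm_def ext_mult_ext_mono[OF f])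
  next
    case True
    let ?X = "{r \<in> T. r < j}" and ?Y = "{(s, r). s \<in> S \<and> r \<in> T - {j} - S \<and> r < s}"
    have fin: "finite T" "finite ?X" using True by auto
    have "?Y \<subseteq> S \<times> T" by auto
    then have finY: "finite ?Y" using finite_subset S(1) fin(1) by blast
    have "{(s, r). s \<in> insert j S \<and> r \<in> T - insert j S \<and> r < s} = Pair j ` ?X \<union> ?Y"
      using S(2) by fastforce
    moreover have "card (Pair j ` ?X \<union> ?Y) = card (Pair j ` ?X) + card ?Y"
      by (rule card_Un_disjoint) (use fin finY jS in auto)
    moreover have "card (Pair j ` ?X) = card ?X" by (simp add: card_image inj_on_def)
    ultimately have "ext_sign (insert j S) (T - insert j S) = sg j T * (ext_sign S (T - {j} - S) :: 'a)"
      unfolding ext_sign_def sg_def by (simp add: power_add)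
    moreover have "T - insert j S = T - {j} - S" by blast
    moreover have "S \<subseteq> T - {j}" using True jS by blast
    ultimately show ?thesis using True by (simp add: lm_def ext_mult_ext_mono[OF f])
  qed
qed

text \<open>Each pair from \<open>T - R\<close> and \<open>R\<close> is an inversion for exactly one
  of the two orders of the factors, so the two inversion counts add up to the product of the
  cardinalities.\<close>

lemma ext_sign_swap:
  assumes fin: "finite T" and R: "R \<subseteq> T"
  shows "ext_sign (T - R) R = ((-1) ^ (card (T - R) * card R) * ext_sign R (T - R) :: 'k::field)"
proof -
  let ?A = "{(s, r). s \<in> T - R \<and> r \<in> R \<and> r < s}" and ?B = "{(s, r). s \<in> R \<and> r \<in> T - R \<and> r < s}"
  have "(T - R) \<times> R = ?A \<union> prod.swap ` ?B"
  proof
    show "(T - R) \<times> R \<subseteq> ?A \<union> prod.swap ` ?B"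
    proof
      fix x assume "x \<in> (T - R) \<times> R"
      then obtain s r where x: "x = (s, r)" "s \<in> T - R" "r \<in> R" by blast
      then have "s \<noteq> r" by blast
      then consider "r < s" | "s < r" by linarith
      then show "x \<in> ?A \<union> prod.swap ` ?B"
      proof cases
        case 2
        then have "(r, s) \<in> ?B" "x = prod.swap (r, s)" using x by auto
        then show ?thesis by blast
      qed (use x in auto)
    qed
  qed auto
  moreover have "card (?A \<union> prod.swap ` ?B) = card ?A + card (prod.swap ` ?B)"
  proof (rule card_Un_disjoint)
    have "finite (?A \<union> prod.swap ` ?B)"
      unfolding calculation[symmetric] using fin R by (intro finite_cartesian_product) (auto intro: finite_subset)
    then show "finite ?A" "finite (prod.swap ` ?B)" by (simp_all only: finite_Un)
  qed auto
  moreover have "card (prod.swap ` ?B) = card ?B" by (intro card_image) auto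
  ultimately have c: "card (T - R) * card R = card ?A + card ?B" by (simp only: card_cartesian_product[symmetric])
  show ?thesis unfolding ext_sign_def c by (simp add: power_add mult.assoc power_mult_distrib[symmetric])
qed

lemma ext_mult_sum_left: "ext_mult (sum F A) g = (\<Sum>x\<in>A. ext_mult (F x) g)"
proof
  fix T
  have "ext_mult (sum F A) g T = (\<Sum>S\<in>Pow T. \<Sum>x\<in>A. ext_sign S (T - S) * F x S * g (T - S))"
    unfolding ext_mult_def sum_fun_apply sum_distrib_left sum_distrib_right ..
  also have "\<dots> = (\<Sum>x\<in>A. ext_mult (F x) g) T"
    unfolding ext_mult_def sum_fun_apply by (rule sum.swap)
  finally show "ext_mult (sum F A) g T = (\<Sum>x\<in>A. ext_mult (F x) g) T" .
qed

lemma ext_mult_fsc_left: "ext_mult (fsc r f) g = fsc r (ext_mult f g)"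
proof
  fix T
  show "ext_mult (fsc r f) g T = fsc r (ext_mult f g) T"
    unfolding ext_mult_def fsc_apply sum_distrib_left by (rule sum.cong) (simp_all add: mult_ac)
qed

lemma ext_mult_homogeneous_right:
  assumes f: "f \<in> ext_carrier n" "homogeneous d f" and a: "a \<in> ext_carrier n"
  shows "ext_mult f a = ext_mult (\<lambda>R. (-1) ^ (d * card R) * a R) f"
proof
  fix T
  show "ext_mult f a T = ext_mult (\<lambda>R. (-1) ^ (d * card R) * a R) f T"
  proof (cases "finite T")
    case True
    have "ext_mult f a T = (\<Sum>R\<in>Pow T. ext_sign (T - R) (T - (T - R)) * f (T - R) * a (T - (T - R)))"
      unfolding ext_mult_def
      by (rule sum.reindex_bij_witness[of _ "\<lambda>R. T - R" "\<lambda>R. T - R"]) (auto simp: double_diff)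
    also have "\<dots> = (\<Sum>R\<in>Pow T. ext_sign R (T - R) * ((-1) ^ (d * card R) * a R) * f (T - R))"
    proof (intro sum.cong refl)
      fix R assume "R \<in> Pow T"
      then have R: "R \<subseteq> T" "T - (T - R) = R" by auto
      show "ext_sign (T - R) (T - (T - R)) * f (T - R) * a (T - (T - R))
          = ext_sign R (T - R) * ((-1) ^ (d * card R) * a R) * f (T - R)"
      proof (cases "f (T - R) = 0")
        case False
        then have "card (T - R) = d" using f(2) unfolding homogeneous_def by blast
        then show ?thesis unfolding R(2) ext_sign_swap[OF True R(1)] by simp
      qed simp
    qed
    finally show ?thesis unfolding ext_mult_def .
  qed (simp add: ext_mult_def)
qed

text \<open>Multiplying a homogeneous element by \<open>a\<close> from the right is multiplying it
  from the left by a sign-twisted \<open>a\<close>. This is needed for \<open>cid\<close>, because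
  \<open>ideal_gen\<close> intersects two-sided ideals.\<close>

lemma (in gid) ext_ideal: "ext_ideal n J"
proof -
  have mono: "ext_mult (ext_mono S) f \<in> J" if S: "S \<subseteq> {..<n}" and f: "f \<in> J" for S f
  proof -
    have fc: "f \<in> ext_carrier n" using f J_carrier by blast
    have "finite S" using S finite_subset by blast
    then show ?thesis using S
    proof (induct S rule: finite_linorder_min_induct)
      case empty
      have "ext_mult (ext_mono {}) f = f"
        using ext_mult_scalar[OF fc, of 1] by simp
      then show ?case using f by simp
    next
      case (insert b A)
      then show ?case using ext_mult_mono_insert[OF fc insert(1)] J_lm by simp
    qed
  qed
  have left: "ext_mult a f \<in> J" if a: "a \<in> ext_carrier n" and f: "f \<in> J" for a f
  proof -
    have "ext_mult a f = (\<Sum>S\<in>Pow {..<n}. fsc (a S) (ext_mult (ext_mono S) f))"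
      by (subst carrier_expand[OF a]) (simp add: ext_mult_sum_left ext_mult_fsc_left)
    then show ?thesis using mono[OF _ f] by (auto intro!: J_sum J_fsc)
  qed
  have right: "ext_mult f a \<in> J" if a: "a \<in> ext_carrier n" and f: "f \<in> J" for a f
  proof -
    have fc: "f \<in> ext_carrier n" using f J_carrier by blast
    have "ext_mult f a = (\<Sum>d\<le>n. ext_mult (hom_comp d f) a)"
      by (subst hom_comp_sum_eq[OF fc]) (simp add: ext_mult_sum_left)
    moreover have "ext_mult (hom_comp d f) a \<in> J" for d
    proof -
      have h: "hom_comp d f \<in> J" by (rule hom[OF f])
      have "(\<lambda>R. (-1) ^ (d * card R) * a R) \<in> ext_carrier n" using a unfolding ext_carrier_def by auto
      from left[OF this h] show ?thesis
        using ext_mult_homogeneous_right[OF _ hom_comp_homogeneous a] h J_carrier by (metis subsetD)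
    qed
    ultimately show ?thesis by (auto intro!: J_sum)
  qed
  show ?thesis unfolding ext_ideal_def using J_carrier J_0 J_add left right by blast
qed

lemma gid_graded_ideal: "graded_ideal n J \<Longrightarrow> gid n J"
  unfolding graded_ideal_def gid_def gid_axioms_def using ext_ideal_lid by blast

subsection \<open>The ideal generated by one homogeneous component\<close>

text \<open>Degree \<open>k + m\<close> of the ideal generated by the degree \<open>k\<close>
  component of \<open>J\<close>, built by repeated multiplication with generators so that each
  homogeneous component is explicit.\<close>

primrec layer :: "nat \<Rightarrow> 'k::field ext set \<Rightarrow> nat \<Rightarrow> nat \<Rightarrow> 'k ext set" where
  "layer n J k 0 = hpart k J"
| "layer n J k (Suc m) = {\<Sum>j<n. lm j (F j) | F. \<forall>j. F j \<in> layer n J k m}"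

definition cid :: "nat \<Rightarrow> 'k::field ext set \<Rightarrow> nat \<Rightarrow> 'k ext set" where
  "cid n J k = {f \<in> ext_carrier n. \<forall>d. hom_comp d f \<in> (if d < k then {0} else layer n J k (d - k))}"

context gid begin

lemma layer_subspace: "fv.subspace (layer n J k m)"
proof (induct m)
  case 0
  show ?case unfolding layer.simps by (rule hpart_subspace[OF subspace_J])
next
  case (Suc m)
  have 0: "0 \<in> layer n J k (Suc m)"
    using fv.subspace_0[OF Suc] by (auto intro!: exI[of _ "\<lambda>_. 0"])
  have add: "x + y \<in> layer n J k (Suc m)" if xy: "x \<in> layer n J k (Suc m)" "y \<in> layer n J k (Suc m)" for x y
  proof -
    obtain F G where "x = (\<Sum>j<n. lm j (F j))" "\<forall>j. F j \<in> layer n J k m"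
      "y = (\<Sum>j<n. lm j (G j))" "\<forall>j. G j \<in> layer n J k m" using xy by auto
    then have "x + y = (\<Sum>j<n. lm j (F j + G j))" "\<forall>j. F j + G j \<in> layer n J k m"
      using fv.subspace_add[OF Suc] by (auto simp: lm_add sum.distrib)
    then show ?thesis unfolding layer.simps by (intro CollectI exI[of _ "\<lambda>j. F j + G j"] conjI)
  qed
  have sc: "fsc r x \<in> layer n J k (Suc m)" if x: "x \<in> layer n J k (Suc m)" for x r
  proof -
    obtain F where "x = (\<Sum>j<n. lm j (F j))" "\<forall>j. F j \<in> layer n J k m" using x by auto
    then have "fsc r x = (\<Sum>j<n. lm j (fsc r (F j)))" "\<forall>j. fsc r (F j) \<in> layer n J k m"
      using fv.subspace_scale[OF Suc] by (auto simp: lm_fsc fv.scale_sum_right)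
    then show ?thesis unfolding layer.simps by (intro CollectI exI[of _ "\<lambda>j. fsc r (F j)"] conjI)
  qed
  show ?case unfolding fv.subspace_def using 0 add sc by blast
qed

lemma layer_hpart: "layer n J k m \<subseteq> hpart (k + m) J"
proof (induct m)
  case (Suc m)
  show ?case
  proof
    fix x assume "x \<in> layer n J k (Suc m)"
    then obtain F where x: "x = (\<Sum>j<n. lm j (F j))" and F: "\<And>j. F j \<in> hpart (k + m) J"
      using Suc by auto
    have "lm j (F j) \<in> hpart (k + Suc m) J" if "j < n" for j
      using F[of j] J_lm[OF _ that] J_carrier homogeneous_lm[of "F j" n "k + m" j]
      unfolding hpart_def by auto
    then show "x \<in> hpart (k + Suc m) J"
      unfolding x by (intro fv.subspace_sum[OF hpart_subspace[OF subspace_J]]) simp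
  qed
qed simp

lemma lm_layer:
  assumes "f \<in> layer n J k m" "j < n"
  shows "lm j f \<in> layer n J k (Suc m)"
proof -
  have "(\<Sum>i<n. lm i (if i = j then f else 0)) = (\<Sum>i<n. if i = j then lm j f else 0)"
    by (intro sum.cong refl) auto
  also have "\<dots> = lm j f" using assms(2) by simp
  finally have "lm j f = (\<Sum>i<n. lm i (if i = j then f else 0))" by simp
  moreover have "\<forall>i. (if i = j then f else 0) \<in> layer n J k m"
    using assms(1) fv.subspace_0[OF layer_subspace] by simp
  ultimately show ?thesis unfolding layer.simps
    by (intro CollectI exI[of _ "\<lambda>i. if i = j then f else 0"] conjI)
qed

lemma hom_comp_lm:
  assumes "f \<in> ext_carrier n"
  shows "hom_comp d (lm j f) = (case d of 0 \<Rightarrow> 0 | Suc d' \<Rightarrow> lm j (hom_comp d' f))"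
proof -
  have "lm j f = (\<Sum>i\<le>n. lm j (hom_comp i f))"
    by (subst hom_comp_sum_eq[OF assms]) (rule lm_sum)
  have hc: "hom_comp i f \<in> ext_carrier n" for i
    using assms unfolding hom_comp_def ext_carrier_def by auto
  have *: "hom_comp d (lm j (hom_comp i f)) = (if d = Suc i then lm j (hom_comp i f) else 0)" for i
    using hom_comp_of_homogeneous[OF homogeneous_lm[OF hc hom_comp_homogeneous]] by simp
  have "hom_comp d (lm j f) = (\<Sum>i\<le>n. if d = Suc i then lm j (hom_comp i f) else 0)"
    unfolding \<open>lm j f = _\<close> hom_comp_sum * ..
  also have "\<dots> = (case d of 0 \<Rightarrow> 0 | Suc d' \<Rightarrow> lm j (hom_comp d' f))"
  proof (cases d)
    case (Suc d')
    have "hom_comp d' f = 0" if "\<not> d' \<le> n"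
    proof -
      have "hom_comp d' (\<Sum>i\<le>n. hom_comp i f) = 0"
        unfolding hom_comp_sum
        by (rule sum.neutral) (use that in \<open>auto simp: hom_comp_of_homogeneous[OF hom_comp_homogeneous]\<close>)
      then show ?thesis using hom_comp_sum_eq[OF assms] by simp
    qed
    moreover have "(\<Sum>i\<le>n. if d = Suc i then lm j (hom_comp i f) else 0)
        = (\<Sum>i\<le>n. if i = d' then lm j (hom_comp d' f) else 0)"
      using Suc by (intro sum.cong refl) auto
    ultimately show ?thesis using Suc by auto
  qed simp
  finally show ?thesis .
qed

lemma cid_gid: "gid n (cid n J k)"
proof
  let ?W = "\<lambda>d. if d < k then {0} else layer n J k (d - k)"
  have W: "fv.subspace (?W d)" for d
    using layer_subspace by (auto simp: fv.subspace_def)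
  have hadd: "hom_comp d (f + g) = hom_comp d f + hom_comp d g" for d and f g :: "'k ext"
    by (auto simp: hom_comp_def fun_eq_iff)
  have hsc: "hom_comp d (fsc r f) = fsc r (hom_comp d f)" for d r and f :: "'k ext"
    by (auto simp: hom_comp_def fun_eq_iff)
  show "cid n J k \<subseteq> ext_carrier n" unfolding cid_def by blast
  have "hom_comp d 0 = (0 :: 'k ext)" for d by (auto simp: hom_comp_def fun_eq_iff)
  then show "0 \<in> cid n J k"
    unfolding cid_def using fv.subspace_0[OF W] fv.subspace_0[OF subspace_ext_carrier] by simp
  show "f \<in> cid n J k \<Longrightarrow> g \<in> cid n J k \<Longrightarrow> f + g \<in> cid n J k" for f g
    unfolding cid_def mem_Collect_eq hadd
    using fv.subspace_add[OF W] fv.subspace_add[OF subspace_ext_carrier] by metis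
  show "f \<in> cid n J k \<Longrightarrow> fsc r f \<in> cid n J k" for f r
    unfolding cid_def mem_Collect_eq hsc
    using fv.subspace_scale[OF W] fv.subspace_scale[OF subspace_ext_carrier] by metis
  show "lm j f \<in> cid n J k" if f: "f \<in> cid n J k" and j: "j < n" for f j
  proof -
    have fc: "f \<in> ext_carrier n" and fd: "\<And>d. hom_comp d f \<in> ?W d" using f unfolding cid_def by auto
    have "hom_comp d (lm j f) \<in> ?W d" for d
    proof (cases d)
      case 0
      then have e: "hom_comp d (lm j f) = 0" unfolding hom_comp_lm[OF fc] by simp
      show ?thesis unfolding e by (rule fv.subspace_0[OF W])
    next
      case (Suc d')
      have e: "hom_comp d (lm j f) = lm j (hom_comp d' f)" unfolding hom_comp_lm[OF fc] Suc by simp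
      show ?thesis
      proof (cases "d' < k")
        case True
        then have "hom_comp d' f = 0" using fd[of d'] by simp
        then have e0: "hom_comp d (lm j f) = 0" unfolding e by simp
        show ?thesis unfolding e0 by (rule fv.subspace_0[OF W])
      next
        case False
        then have "lm j (hom_comp d' f) \<in> layer n J k (Suc (d' - k))" using lm_layer[OF _ j] fd[of d'] by simp
        then show ?thesis using e Suc False by (simp add: Suc_diff_le)
      qed
    qed
    then show ?thesis unfolding cid_def using lm_carrier[OF fc j] by blast
  qed
  show "hom_comp m f \<in> cid n J k" if f: "f \<in> cid n J k" for f m
  proof -
    have "hom_comp m f \<in> ext_carrier n" using f unfolding cid_def ext_carrier_def hom_comp_def by auto
    moreover have "hom_comp d (hom_comp m f) \<in> ?W d" for d
    proof (cases "d = m")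
      case True
      have "hom_comp m f \<in> ?W m" using f unfolding cid_def by blast
      then show ?thesis using True by (simp only: hom_comp_of_homogeneous[OF hom_comp_homogeneous] if_True simp_thms)
    next
      case False
      have "0 \<in> ?W d" by (rule fv.subspace_0[OF W])
      then show ?thesis using False by (simp only: hom_comp_of_homogeneous[OF hom_comp_homogeneous] if_False)
    qed
    ultimately show ?thesis unfolding cid_def by blast
  qed
qed

lemma hpart_cid: "hpart d (cid n J k) = (if d < k then {0} else layer n J k (d - k))"
proof
  show "hpart d (cid n J k) \<subseteq> (if d < k then {0} else layer n J k (d - k))"
  proof
    fix f assume "f \<in> hpart d (cid n J k)"
    then have "f \<in> cid n J k" "hom_comp d f = f" using hom_comp_of_homogeneous[of d f d] unfolding hpart_def by auto
    then show "f \<in> (if d < k then {0} else layer n J k (d - k))"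
      unfolding cid_def mem_Collect_eq by metis
  qed
  interpret C: gid n "cid n J k" by (rule cid_gid)
  show "(if d < k then {0} else layer n J k (d - k)) \<subseteq> hpart d (cid n J k)"
  proof (cases "d < k")
    case True
    then show ?thesis using C.J_0 by (simp add: hpart_def homogeneous_def)
  next
    case False
    have "f \<in> hpart d (cid n J k)" if f: "f \<in> layer n J k (d - k)" for f
    proof -
      have h: "f \<in> hpart d J" using layer_hpart[of k "d - k"] f False by auto
      then have hd: "homogeneous d f" "f \<in> ext_carrier n" using J_carrier unfolding hpart_def by auto
      have "hom_comp e f \<in> (if e < k then {0} else layer n J k (e - k))" for e
        unfolding hom_comp_of_homogeneous[OF hd(1)] using f False fv.subspace_0[OF layer_subspace] by simp
      then show ?thesis using hd unfolding hpart_def cid_def by blast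
    qed
    then show ?thesis using False by auto
  qed
qed

lemma comp_ideal_eq: "comp_ideal n k J = cid n J k"
proof
  interpret C: gid n "cid n J k" by (rule cid_gid)
  have "hpart k (cid n J k) = hpart k J" by (simp add: hpart_cid)
  then have "{f \<in> J. homogeneous k f} \<subseteq> cid n J k" unfolding hpart_def by blast
  then show "comp_ideal n k J \<subseteq> cid n J k"
    unfolding comp_ideal_def ideal_gen_def using C.ext_ideal by blast
  have "f \<in> I" if f: "f \<in> cid n J k" and I: "ext_ideal n I" "{f \<in> J. homogeneous k f} \<subseteq> I" for f I
  proof -
    interpret I: lid n I by (rule ext_ideal_lid[OF I(1)])
    have lay: "layer n J k m \<subseteq> I" for m
    proof (induct m)
      case 0
      show ?case unfolding layer.simps hpart_def by (rule I(2))
    next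
      case (Suc m)
      have "(\<Sum>j<n. lm j (F j)) \<in> I" if "\<forall>j. F j \<in> layer n J k m" for F
        using that Suc by (intro I.J_sum I.J_lm) auto
      then show ?case by auto
    qed
    have "hom_comp d f \<in> I" for d
    proof -
      have "hom_comp d f \<in> (if d < k then {0} else layer n J k (d - k))" using f unfolding cid_def by blast
      then show ?thesis using lay[of "d - k"] I.J_0 by (auto split: if_splits)
    qed
    then have "(\<Sum>d\<le>n. hom_comp d f) \<in> I" by (intro I.J_sum)
    then show ?thesis using hom_comp_sum_eq[of f n] f unfolding cid_def by simp
  qed
  then show "cid n J k \<subseteq> comp_ideal n k J"
    unfolding comp_ideal_def ideal_gen_def by blast
qed

end

subsection \<open>Betti numbers\<close>

definition unc :: "'k chain \<Rightarrow> (nat \<Rightarrow> nat) \<times> nat set \<Rightarrow> 'k::field" where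
  "unc c = (\<lambda>(a, S). c a S)"

lemma lin_unc: "Vector_Spaces.linear csc fsc unc"
  by unfold_locales (auto simp: unc_def fun_eq_iff)

lemma unc_0_iff: "unc c = 0 \<longleftrightarrow> c = 0"
  by (auto simp: unc_def fun_eq_iff)

lemma cdim_eq:
  assumes "cv.subspace V" "cv.fin_dim V"
  shows "cdim V = cv.dim V"
proof -
  have "cdim V = fv.dim (unc ` V)" unfolding cdim_def vdim_def unc_def fsc_def ..
  also have "\<dots> = cv.dim V" by (rule cf.dim_image_inj[OF assms lin_unc]) (simp add: unc_0_iff)
  finally show ?thesis .
qed

lemma chains_eq:
  assumes "N \<subseteq> ext_carrier n"
  shows "chains n N i d = Jc n N 0 i d"
  using assms unfolding chains_def Jc_def Ch_def ext_carrier_def by blast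

lemma chains_carrier: "chains n (ext_carrier n) i d = Ch n 0 i d"
  unfolding chains_eq[OF subset_refl] Jc_def using Ch_carrier by blast

text \<open>The truncated subtraction in \<open>betti_gr\<close> is exact because boundaries are
  cycles; \<open>hdm\<close> is integer-valued so that the recursion may subtract.\<close>

lemma (in lid) betti_gr_eq: "int (betti_gr n (ext_carrier n) J (Suc i) d) = hdm n J 0 (Suc i) d"
proof -
  have "cartan_diff n c = cdf n c" if "c \<in> Ch n 0 (Suc i) d" for c :: "'k chain" and i
    using cartan_diff_eq[OF Ch_carrier[OF that]] .
  note cd = this
  have Z: "{c \<in> chains n (ext_carrier n) (Suc i) d. cartan_diff n c \<in> chains n J (Suc i - 1) d} = Zc n J 0 (Suc i) d"
    unfolding chains_carrier chains_eq[OF J_carrier] Zc_def Jc_def using cd[of _ i] cdf_Ch by auto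
  have B: "{cartan_diff n c + z |c z. c \<in> chains n (ext_carrier n) (Suc (Suc i)) d \<and> z \<in> chains n J (Suc i) d} = Bc n J 0 (Suc i) d"
    unfolding chains_carrier chains_eq[OF J_carrier] Bc_def using cd[of _ "Suc i"] by metis
  show ?thesis unfolding betti_gr_def Z B hdm_def
    using cdim_eq[OF subspace_Zc fin_dim_Zc, of 0 "Suc i" d] cdim_eq[OF subspace_Bc fin_dim_Bc, of 0 "Suc i" d]
      cv.fin_dim_dim_mono[OF fin_dim_Zc Bc_Zc, of 0 "Suc i" d] by simp
qed

lemma (in lid) betti_eq: "int (betti n (ext_carrier n) J (Suc i)) = (\<Sum>d\<le>Suc i + n. hdm n J 0 (Suc i) d)"
  unfolding betti_def by (simp add: betti_gr_eq)

context lid begin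

lemma betti_gr_self_0_iff:
  "betti_gr n J {0} i d = 0 \<longleftrightarrow> (\<forall>c\<in>Jc n J 0 i d. cdf n c = 0 \<longrightarrow> c \<in> cdf n ` Jc n J 0 (Suc i) d)"
proof -
  have cd: "cartan_diff n c = cdf n c" if "c \<in> Jc n J 0 i d" for c :: "'k chain" and i
  proof -
    have "c \<in> Ch n 0 i d" using that Jc_Ch by blast
    then show ?thesis by (rule cartan_diff_eq[OF Ch_carrier])
  qed
  have c0: "chains n {0} i d = ({0} :: 'k chain set)" for i
    unfolding chains_def by (auto simp: fun_eq_iff)
  define Z where "Z = {c \<in> Jc n J 0 i d. cdf n c = 0}"
  define B where "B = cdf n ` Jc n J 0 (Suc i) d"
  have Z: "{c \<in> chains n J i d. cartan_diff n c \<in> chains n {0} (i - 1) d} = Z"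
    unfolding chains_eq[OF J_carrier] Z_def c0 using cd[of _ i] by auto
  have B: "{cartan_diff n c + z |c z. c \<in> chains n J (Suc i) d \<and> z \<in> chains n {0} i d} = B"
    unfolding chains_eq[OF J_carrier] B_def c0 image_def using cd[of _ "Suc i"]
    by (auto) (metis add.right_neutral)
  have sZ: "cv.subspace Z" unfolding Z_def cv.subspace_def
    using subspace_Jc[of 0 i d] by (auto simp: cv.subspace_def cdf_add cdf_csc)
  have sB: "cv.subspace B" unfolding B_def by (rule cc.linear_subspace_image[OF lin_cdf subspace_Jc])
  have BZ: "B \<subseteq> Z"
  proof
    fix c assume "c \<in> B"
    then obtain w where w: "w \<in> Jc n J 0 (Suc i) d" "c = cdf n w" unfolding B_def by blast
    have "c \<in> Jc n J 0 i d" using w cdf_Ch cdf_in_J unfolding Jc_def by auto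
    then show "c \<in> Z" unfolding Z_def w(2) by simp
  qed
  have fZ: "cv.fin_dim Z" by (rule cv.fin_dim_mono[OF fin_dim_Ch[of n 0 i d]]) (auto simp: Z_def Jc_def)
  have fB: "cv.fin_dim B" by (rule cv.fin_dim_mono[OF fZ BZ])
  have "betti_gr n J {0} i d = cv.dim Z - cv.dim B"
    unfolding betti_gr_def Z B cdim_eq[OF sZ fZ] cdim_eq[OF sB fB] ..
  also have "\<dots> = 0 \<longleftrightarrow> Z \<subseteq> B"
    using cv.fin_dim_subspace_eq[OF fZ BZ sB] cv.fin_dim_dim_mono[OF fB, of Z] by auto
  finally show ?thesis unfolding Z_def B_def by blast
qed

text \<open>Since the complex of \<open>E\<close> is exact, homology of \<open>E/J\<close> in
  homological degree \<open>i + 1\<close> is that of \<open>J\<close> in degree \<open>i\<close>,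
  with exterior degree raised by one. From \<open>k \<le> c\<close> follows that
  \<open>c + 1\<close> differs from \<open>k\<close>, off the linear strand.\<close>

lemma linear_imp_hdm:
  assumes lin: "\<And>i j. j \<noteq> k \<Longrightarrow> betti_gr n J {0} i (i + j) = 0" and c: "k \<le> c"
  shows "hdm n J 0 (Suc i) (Suc i + c) = 0"
proof -
  have "z \<in> Bc n J 0 (Suc i) (Suc i + c)" if z: "z \<in> Zc n J 0 (Suc i) (Suc i + c)" for z
  proof -
    have zC: "z \<in> Ch n 0 (Suc i) (Suc i + c)" using z Zc_Ch by blast
    have "cdf n z \<in> Jc n J 0 i (i + Suc c)" using z cdf_Ch[OF zC] unfolding Zc_def Jc_def by simp
    moreover have "betti_gr n J {0} i (i + Suc c) = 0" by (rule lin) (use c in simp)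
    ultimately obtain l where l: "l \<in> Jc n J 0 (Suc i) (i + Suc c)" "cdf n z = cdf n l"
      unfolding betti_gr_self_0_iff by auto
    have l': "l \<in> Jc n J 0 (Suc i) (Suc i + c)" using l(1) by simp
    have "z - l \<in> Ch n 0 (Suc i) (Suc i + c)"
      using cv.subspace_diff[OF subspace_Ch zC] l' Jc_Ch by blast
    moreover have "cdf n (z - l) = 0" using l(2) by (simp add: cdf_diff)
    ultimately obtain w where w: "w \<in> Ch n 0 (Suc (Suc i)) (Suc i + c)" "z - l = cdf n w"
      using cartan_exact[of "z - l" n 0 "Suc i" "Suc i + c"] by auto
    have "z = cdf n w + l" using w(2) by (metis diff_add_cancel)
    then show ?thesis unfolding Bc_def using w(1) l' by blast
  qed
  then show ?thesis unfolding hdm_0_iff using Bc_Zc by blast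
qed

text \<open>The same shift read backwards for degrees above \<open>k\<close>; below \<open>k\<close>
  there are no chains because \<open>J\<close> has no elements there.\<close>

lemma hdm_imp_linear:
  assumes low: "\<And>d. d < k \<Longrightarrow> hpart d J = {0}"
    and h: "\<And>i c. k \<le> c \<Longrightarrow> hdm n J 0 (Suc i) (Suc i + c) = 0" and j: "j \<noteq> k"
  shows "betti_gr n J {0} i (i + j) = 0"
  unfolding betti_gr_self_0_iff
proof (intro ballI impI)
  fix z assume z: "z \<in> Jc n J 0 i (i + j)" and dz: "cdf n z = 0"
  have zC: "z \<in> Ch n 0 i (i + j)" using z Jc_Ch by blast
  show "z \<in> cdf n ` Jc n J 0 (Suc i) (i + j)"
  proof (cases "j < k")
    case True
    have "z a = 0" for a
    proof -
      have "homogeneous j (z a)" using zC unfolding Ch_def homogeneous_def by fastforce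
      then have "z a \<in> hpart j J" using z unfolding Jc_def hpart_def by blast
      then show ?thesis using low[OF True] by simp
    qed
    then have "z = 0" by (simp add: fun_eq_iff)
    then show ?thesis using cv.subspace_0[OF subspace_Jc] by (metis cdf_0 imageI)
  next
    case False
    then obtain c where c: "j = Suc c" "k \<le> c" using j by (cases j) auto
    obtain w where w: "w \<in> Ch n 0 (Suc i) (i + j)" "z = cdf n w"
      using cartan_exact[OF zC _ _ dz] c by auto
    have "w \<in> Zc n J 0 (Suc i) (Suc i + c)" using w z c unfolding Zc_def Jc_def by auto
    then have "w \<in> Bc n J 0 (Suc i) (Suc i + c)" using h[OF c(2)] unfolding hdm_0_iff by simp
    then obtain v l where "l \<in> Jc n J 0 (Suc i) (Suc i + c)" "w = cdf n v + l" unfolding Bc_def by blast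
    then have "z = cdf n l" "l \<in> Jc n J 0 (Suc i) (i + j)" using w c by (auto simp: cdf_add)
    then show ?thesis by blast
  qed
qed

subsection \<open>Numerical consequences of the recursion\<close>

text \<open>An annihilator number: the dimension in degree \<open>d\<close> of the kernel of
  multiplication by \<open>e_q\<close> from \<open>E\<close> modulo \<open>J\<close> and
  \<open>e_q, ..., e_(n-1)\<close> to \<open>E\<close> modulo \<open>J\<close> and
  \<open>e_(q+1), ..., e_(n-1)\<close>.\<close>

definition alpha :: "nat \<Rightarrow> nat \<Rightarrow> int" where
  "alpha q d = hdm n J q 0 d - kdm n J q 0 d"

lemma alpha_nonneg: "q < n \<Longrightarrow> 0 \<le> alpha q d"
  unfolding alpha_def using kdm_le_hdm[of q 0 d] by simp

lemma hdm_1_sum: "hdm n J 0 1 (Suc d) = (\<Sum>q<n. alpha q d - kdm n J q 1 d)"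
proof -
  have "m \<le> n \<Longrightarrow> hdm n J 0 1 (Suc d) = hdm n J m 1 (Suc d) + (\<Sum>q<m. alpha q d - kdm n J q 1 d)" for m
  proof (induct m)
    case (Suc m)
    then have "hdm n J m 1 (Suc d) = hdm n J (Suc m) 1 (Suc d) + alpha m d - kdm n J m 1 d"
      using hdm_recursion[of m 0 d] unfolding alpha_def by simp
    then show ?case using Suc by simp
  qed simp
  from this[of n] show ?thesis using hdm_top[of n 0 "Suc d"] by simp
qed

text \<open>The recursion stays on the strand where total minus homological degree is
  \<open>c\<close>. The numbers \<open>alpha q c\<close> are its only positive source, and all other
  corrections lower the values, which are nonnegative.\<close>

lemma hdm_zero_of_alpha:
  assumes a: "\<And>q. q < n \<Longrightarrow> alpha q c = 0" and q: "q \<le> n"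
  shows "hdm n J q (Suc i) (Suc i + c) = 0"
  using q
proof (induct i arbitrary: q)
  case 0
  show ?case using 0
  proof (induct "n - q" arbitrary: q)
    case 0
    then show ?case using hdm_top[of q 0] by simp
  next
    case (Suc m)
    then have q: "q < n" by simp
    have "hdm n J (Suc q) (Suc 0) (Suc 0 + c) = 0" using Suc q by (intro Suc(1)) auto
    then show ?case using hdm_recursion[OF q, of 0 c] a[OF q] kdm_nonneg[OF q, of 1 c]
      hdm_nonneg[of q 1 "Suc c"] unfolding alpha_def by simp
  qed
next
  case (Suc i)
  note IH = Suc(1)
  show ?case using Suc(2)
  proof (induct "n - q" arbitrary: q)
    case 0
    then show ?case using hdm_top[of q "Suc i"] by simp
  next
    case (Suc m)
    then have q: "q < n" by simp
    have "hdm n J (Suc q) (Suc (Suc i)) (Suc (Suc i) + c) = 0" using Suc q by (intro Suc(1)) auto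
    moreover have "hdm n J q (Suc i) (Suc i + c) = 0" by (rule IH) (use q in simp)
    ultimately show ?case using hdm_recursion[OF q, of "Suc i" "Suc i + c"] kdm_nonneg[OF q, of "Suc i" "Suc i + c"]
      kdm_nonneg[OF q, of "Suc (Suc i)" "Suc i + c"] hdm_nonneg[of q "Suc (Suc i)" "Suc (Suc i) + c"] by simp
  qed
qed

text \<open>In the recursion, \<open>kdm n J q 1 d\<close> is at most the term at level
  \<open>Suc q\<close>, so \<open>alpha q d\<close> remains. Vanishing at level \<open>q\<close>
  thus forces \<open>alpha q d = 0\<close>.\<close>

lemma hdm_1_ge_alpha: "q < n \<Longrightarrow> alpha q d \<le> hdm n J q 1 (Suc d)"
  using hdm_recursion[of q 0 d] kdm_le_hdm_Suc[of q 1 d] unfolding alpha_def by simp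

end

lemma Zc_hpart_cong:
  assumes "hpart (Suc c) J = hpart (Suc c) J'"
  shows "Zc n J q (Suc i) (Suc i + c) = Zc n J' q (Suc i) (Suc i + c)"
proof -
  have "cdf n z b \<in> J \<longleftrightarrow> cdf n z b \<in> J'" if z: "z \<in> Ch n q (Suc i) (Suc i + c)" for z b
  proof -
    have "cdf n z \<in> Ch n q i (Suc i + c)" by (rule cdf_Ch[OF z])
    then have "homogeneous (Suc c) (cdf n z b)" unfolding Ch_def homogeneous_def by fastforce
    then show ?thesis using assms unfolding hpart_def by blast
  qed
  then show ?thesis unfolding Zc_def by blast
qed

text \<open>Here \<open>kdm\<close> compares cycles of homological degrees 1 and 2 in total degrees
  \<open>k\<close> and \<open>k + 1\<close>; in both cases the boundaries have exterior degree
  \<open>k\<close>, so only that component of the ideal is consulted.\<close>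

lemma kdm_hpart_cong:
  assumes "hpart k J = hpart k J'" "lid n J" "lid n J'"
  shows "kdm n J q 1 k = kdm n J' q 1 k"
proof (cases k)
  case 0
  have "Zc n X q 1 0 = {0}" if "lid n X" for X :: "'a ext set"
    using Zc_Ch[of n X q 1 0] Ch_trivial[of 0 1 n q] cv.subspace_0[OF lid.subspace_Zc[OF that]] by auto
  moreover have "sh q ` Zc n X q (Suc 1) (Suc 0) = {0}" if "lid n X" for X :: "'a ext set"
  proof -
    have "Zc n X q (Suc 1) (Suc 0) = {0}"
      using Zc_Ch[of n X q "Suc 1" "Suc 0"] Ch_trivial[of "Suc 0" "Suc 1" n q] cv.subspace_0[OF lid.subspace_Zc[OF that]] by auto
    then show ?thesis by simp
  qed
  ultimately show ?thesis using assms unfolding kdm_def 0 by simp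
next
  case (Suc c)
  then show ?thesis unfolding kdm_def
    using Zc_hpart_cong[of c J J' n q 0] Zc_hpart_cong[of c J J' n q 1] assms by simp
qed

lemma Ch_trivial_high: "i + n < d \<Longrightarrow> Ch n q i d = {0}"
proof -
  assume d: "i + n < d"
  have "c = 0" if c: "c \<in> Ch n q i d" for c :: "'a chain"
  proof (rule ccontr)
    assume "c \<noteq> 0"
    then obtain a S where "c a S \<noteq> 0" by (auto simp: fun_eq_iff)
    note f = Ch_finite[OF c, OF this]
    have "card S \<le> card {..<n}" using f(3) by (intro card_mono) auto
    then show False using f(6) d by simp
  qed
  then show ?thesis by auto
qed

lemma (in lid) hdm_high: "i + n < d \<Longrightarrow> hdm n J q i d = 0"
proof -
  assume "i + n < d"
  then have "Zc n J q i d \<subseteq> {0}" using Zc_Ch Ch_trivial_high by blast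
  moreover have "0 \<in> Bc n J q i d" by (rule cv.subspace_0[OF subspace_Bc])
  ultimately show ?thesis unfolding hdm_0_iff using Bc_Zc by blast
qed

lemma (in lid) up_Jc_le:
  "l \<in> Jc n J p i d \<Longrightarrow> p \<le> q \<Longrightarrow> q < n \<Longrightarrow> up q l \<in> Jc n J p (Suc i) (Suc d)"
  unfolding Jc_def using up_Ch[of l n p i d q] J_0 by (auto simp: up_def)

text \<open>No new generators occur above degree \<open>k\<close>: the boundary of a 1-cycle is a
  sum of \<open>lm j (F j)\<close>, the chain with coefficients \<open>F j\<close> at
  \<open>x_j\<close> has the same boundary, and the difference bounds by exactness for
  \<open>E\<close>.\<close>

lemma (in gid) hdm_cid:
  assumes d: "k \<le> d"
  shows "hdm n (cid n J k) 0 1 (Suc d) = 0"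
proof -
  interpret C: gid n "cid n J k" by (rule cid_gid)
  let ?c0 = "\<lambda>f :: 'k ext. (\<lambda>a :: nat \<Rightarrow> nat. if a = (\<lambda>_. 0) then f else 0)"
  have "z \<in> Bc n (cid n J k) 0 1 (Suc d)" if z: "z \<in> Zc n (cid n J k) 0 1 (Suc d)" for z
  proof -
    have zC: "z \<in> Ch n 0 (Suc 0) (Suc d)" using z Zc_Ch by fastforce
    have dz: "cdf n z \<in> Ch n 0 0 (Suc d)" by (rule cdf_Ch[OF zC])
    then obtain f where f: "cdf n z = ?c0 f" "f \<in> hpart (Suc d) (ext_carrier n)" unfolding Ch_0_eq by blast
    have "f \<in> cid n J k" using z fun_cong[OF f(1), of "\<lambda>_. 0"] unfolding Zc_def by auto
    then have "f \<in> layer n J k (Suc (d - k))"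
      using f(2) hpart_cid[of "Suc d" k] d unfolding hpart_def by (auto simp: Suc_diff_le)
    then obtain F where F: "f = (\<Sum>j<n. lm j (F j))" "\<And>j. F j \<in> layer n J k (d - k)" by auto
    define l where "l = (\<Sum>j<n. up j (?c0 (F j)))"
    have Fc: "F j \<in> hpart d (cid n J k)" for j using F(2) hpart_cid[of d k] d by simp
    have c0: "?c0 (F j) \<in> Jc n (cid n J k) 0 0 d" for j
    proof -
      have "F j \<in> hpart d (ext_carrier n)" using Fc[of j] C.J_carrier unfolding hpart_def by blast
      then have "?c0 (F j) \<in> Ch n 0 0 d" unfolding Ch_0_eq by blast
      then show ?thesis using Fc[of j] C.J_0 unfolding Jc_def hpart_def by auto
    qed
    have lJ: "l \<in> Jc n (cid n J k) 0 (Suc 0) (Suc d)"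
      unfolding l_def by (rule cv.subspace_sum[OF C.subspace_Jc]) (use C.up_Jc_le[OF c0] in auto)
    have "cdf n (up j (?c0 (F j))) = ?c0 (lm j (F j))" if j: "j < n" for j
    proof -
      have "cdf n (?c0 (F j)) = 0" using c0[of j] Jc_Ch cdf_Ch0 by blast
      moreover have "rs j (?c0 (F j)) = ?c0 (F j)" unfolding rs_def by (auto simp: fun_eq_iff)
      moreover have "lmc j (?c0 (F j)) = ?c0 (lm j (F j))" unfolding lmc_def by (auto simp: fun_eq_iff)
      ultimately show ?thesis unfolding cdf_up[OF j] by simp
    qed
    then have "cdf n l = (\<Sum>j<n. ?c0 (lm j (F j)))" unfolding l_def cc.linear_sum[OF lin_cdf] by simp
    also have "\<dots> = ?c0 f"
    proof
      fix a show "(\<Sum>j<n. ?c0 (lm j (F j))) a = ?c0 f a"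
        unfolding F(1) sum_fun_apply by (cases "a = (\<lambda>_. 0)") (simp_all add: zero_fun_def)
    qed
    finally have dl: "cdf n (z - l) = 0" using f(1) by (simp add: cdf_diff)
    have zl: "z - l \<in> Ch n 0 (Suc 0) (Suc d)"
      using cv.subspace_diff[OF subspace_Ch zC] lJ Jc_Ch by blast
    obtain w where w: "w \<in> Ch n 0 (Suc (Suc 0)) (Suc d)" "z - l = cdf n w"
      using cartan_exact[OF zl _ _ dl] by auto
    have "z = cdf n w + l" using w(2) by (metis diff_add_cancel)
    then show ?thesis unfolding Bc_def using w(1) lJ by auto
  qed
  then show ?thesis unfolding C.hdm_0_iff using C.Bc_Zc by blast
qed


subsection \<open>Pencils of linear maps\<close>

lemma indep_dim_chain:
  assumes ind: "indep m (\<lambda>i. unc (w i))" and w: "\<And>i. i < m \<Longrightarrow> w i \<in> U"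
    and U: "cv.subspace U" "cv.fin_dim U"
  shows "m \<le> cv.dim U"
proof -
  have "m \<le> fv.dim (unc ` U)"
    by (rule indep_dim[OF ind _ cf.rank_nullity(2)[OF U lin_unc]]) (use w in blast)
  also have "\<dots> = cv.dim U" by (rule cf.dim_image_inj[OF U lin_unc]) (simp add: unc_0_iff)
  finally show ?thesis .
qed

lemma indep_of_independent:
  assumes fin: "finite B" and B: "cv.independent B" and b: "bij_betw b {..<m} B"
  shows "indep m (\<lambda>i. unc (b i))"
  unfolding indep_def
proof (intro allI impI)
  fix c i assume c: "\<forall>x. (\<Sum>i<m. c i * unc (b i) x) = 0" and i: "i < m"
  have inj: "inj_on b {..<m}" and im: "b ` {..<m} = B" using b unfolding bij_betw_def by auto
  define u where "u = (\<lambda>v. c (the_inv_into {..<m} b v))"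
  have "(\<Sum>i<m. csc (c i) (b i)) = 0"
  proof (intro ext)
    fix a S
    show "(\<Sum>i<m. csc (c i) (b i)) a S = (0 :: 'a chain) a S"
      using spec[OF c, of "(a, S)"] by (simp add: sum_fun_apply unc_def)
  qed
  moreover have "(\<Sum>v\<in>B. csc (u v) v) = (\<Sum>i<m. csc (c i) (b i))"
    unfolding im[symmetric] sum.reindex[OF inj] comp_def
    by (intro sum.cong refl) (simp add: u_def the_inv_into_f_f[OF inj])
  ultimately have "(\<Sum>v\<in>B. csc (u v) v) = 0" by simp
  then have "u (b i) = 0" using cv.independentD[OF B fin subset_refl] i im by blast
  then show "c i = 0" using the_inv_into_f_f[OF inj] i by (simp add: u_def)
qed

text \<open>The vectors \<open>x i + csc t (y i)\<close> are independent at \<open>t = 0\<close> and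
  hence for almost all \<open>t\<close>. At \<open>t = 0\<close> they need not lie in the image of
  the pencil, which is what lets the generic rank exceed the rank of \<open>X\<close>.\<close>

lemma pencil_open:
  fixes x y :: "nat \<Rightarrow> 'k::field chain"
  assumes ind: "indep m (\<lambda>i. unc (x i))"
    and im: "\<And>i t. i < m \<Longrightarrow> t \<noteq> 0 \<Longrightarrow> x i + csc t (y i) \<in> (\<lambda>c. X c + csc t (Y c)) ` A"
    and X: "Vector_Spaces.linear csc csc X" and Y: "Vector_Spaces.linear csc csc Y"
    and A: "cv.subspace A" "cv.fin_dim A"
  shows "\<exists>u::'k poly. u \<noteq> 0 \<and> (\<forall>t. poly u t \<noteq> 0 \<longrightarrow> t \<noteq> 0 \<longrightarrow> m \<le> cv.dim ((\<lambda>c. X c + csc t (Y c)) ` A))"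
proof -
  define S where "S = range (poly :: 'k poly \<Rightarrow> 'k \<Rightarrow> 'k)"
  have "\<exists>u\<in>S. u 0 \<noteq> 0 \<and> (\<forall>t. u t \<noteq> 0 \<longrightarrow> indep m (\<lambda>i. unc (x i + csc t (y i))))"
  proof (rule indep_open)
    show "(\<lambda>_. 1) \<in> S" unfolding S_def by (intro image_eqI[of _ _ 1]) auto
    show "(\<lambda>p. a p * b p) \<in> S" if "a \<in> S" "b \<in> S" for a b
      using that unfolding S_def by (auto simp: fun_eq_iff intro: image_eqI[of _ _ "_ * _"])
    show "(\<lambda>p. a p - b p) \<in> S" if "a \<in> S" "b \<in> S" for a b
      using that unfolding S_def by (auto simp: fun_eq_iff intro: image_eqI[of _ _ "_ - _"])
    show "(\<lambda>t. unc (x i + csc t (y i)) z) \<in> S" for i z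
    proof -
      have "(\<lambda>t. unc (x i + csc t (y i)) z) = poly [:unc (x i) z, unc (y i) z:]"
        by (cases z) (auto simp: unc_def fun_eq_iff)
      then show ?thesis unfolding S_def by blast
    qed
    have "csc 0 (y i) = 0" for i by (auto simp: fun_eq_iff)
    then show "indep m (\<lambda>i. unc (x i + csc 0 (y i)))" using ind by simp
  qed
  then obtain u where u: "poly u 0 \<noteq> 0" "\<And>t. poly u t \<noteq> 0 \<Longrightarrow> indep m (\<lambda>i. unc (x i + csc t (y i)))"
    unfolding S_def by blast
  have "m \<le> cv.dim ((\<lambda>c. X c + csc t (Y c)) ` A)" if t: "poly u t \<noteq> 0" "t \<noteq> 0" for t
  proof -
    have lin: "Vector_Spaces.linear csc csc (\<lambda>c. X c + csc t (Y c))"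
      by (rule linear_cscI)
        (simp_all add: cc.linear_add[OF X] cc.linear_add[OF Y] cc.linear_scale[OF X] cc.linear_scale[OF Y]
          cv.scale_right_distrib mult.commute)
    show ?thesis
      by (rule indep_dim_chain[OF u(2)[OF t(1)] im[OF _ t(2)] cc.linear_subspace_image[OF lin A(1)]
            cc.rank_nullity(2)[OF A lin]])
  qed
  moreover have "u \<noteq> 0" using u(1) by auto
  ultimately show ?thesis by blast
qed

text \<open>With an extra vector outside \<open>X ` A\<close> but inside the image of every other member of
  the pencil, the generic rank exceeds the rank of \<open>X\<close>.\<close>

lemma pencil_rank:
  fixes X Y :: "'k::field chain \<Rightarrow> 'k chain"
  assumes X: "Vector_Spaces.linear csc csc X" and Y: "Vector_Spaces.linear csc csc Y"
    and A: "cv.subspace A" "cv.fin_dim A"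
  shows "\<exists>u::'k poly. u \<noteq> 0 \<and> (\<forall>t. poly u t \<noteq> 0 \<longrightarrow> t \<noteq> 0 \<longrightarrow>
      cv.dim (X ` A) \<le> cv.dim ((\<lambda>c. X c + csc t (Y c)) ` A))"
    and "b \<notin> X ` A \<Longrightarrow> (\<And>t. t \<noteq> 0 \<Longrightarrow> b \<in> (\<lambda>c. X c + csc t (Y c)) ` A) \<Longrightarrow>
      \<exists>u::'k poly. u \<noteq> 0 \<and> (\<forall>t. poly u t \<noteq> 0 \<longrightarrow> t \<noteq> 0 \<longrightarrow>
      cv.dim (X ` A) < cv.dim ((\<lambda>c. X c + csc t (Y c)) ` A))"
proof -
  let ?m = "cv.dim (X ` A)"
  have XA: "cv.subspace (X ` A)" by (rule cc.linear_subspace_image[OF X A(1)])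
  obtain B where B: "finite B" "B \<subseteq> X ` A" "cv.independent B" "X ` A \<subseteq> cv.span B" "card B = ?m"
    using cv.fin_dim_obtain_basis[OF cc.rank_nullity(2)[OF A X]] .
  obtain s where s: "bij_betw s {..<?m} B"
    using ex_bij_betw_nat_finite[OF B(1)] B(5) by (auto simp: atLeast0LessThan)
  have "\<forall>i. \<exists>c. i < ?m \<longrightarrow> c \<in> A \<and> s i = X c" using bij_betwE[OF s] B(2) by fastforce
  then obtain c where c: "\<And>i. i < ?m \<Longrightarrow> c i \<in> A" "\<And>i. i < ?m \<Longrightarrow> s i = X (c i)" by metis
  show "\<exists>u::'k poly. u \<noteq> 0 \<and> (\<forall>t. poly u t \<noteq> 0 \<longrightarrow> t \<noteq> 0 \<longrightarrow>
      ?m \<le> cv.dim ((\<lambda>c. X c + csc t (Y c)) ` A))"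
    by (rule pencil_open[where x = s and y = "\<lambda>i. Y (c i)", OF indep_of_independent[OF B(1,3) s] _ X Y A])
      (use c in auto)
  assume b: "b \<notin> X ` A" and bt: "\<And>t. t \<noteq> 0 \<Longrightarrow> b \<in> (\<lambda>c. X c + csc t (Y c)) ` A"
  have "cv.span B \<subseteq> X ` A" using cv.span_minimal[OF B(2) XA] .
  then have bB: "b \<notin> cv.span B" using b by blast
  then have ins: "cv.independent (insert b B)" using B(3) by (simp add: cv.independent_insertI)
  have "b \<notin> B" using bB cv.span_base by blast
  then have s': "bij_betw (s(?m := b)) {..<Suc ?m} (insert b B)"
    using s unfolding bij_betw_def inj_on_def lessThan_Suc by (auto simp: image_iff)
  have "\<exists>u::'k poly. u \<noteq> 0 \<and> (\<forall>t. poly u t \<noteq> 0 \<longrightarrow> t \<noteq> 0 \<longrightarrow>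
      Suc ?m \<le> cv.dim ((\<lambda>c. X c + csc t (Y c)) ` A))"
  proof (rule pencil_open[where x = "s(?m := b)" and y = "\<lambda>i. if i = ?m then 0 else Y (c i)",
        OF indep_of_independent[OF _ ins s'] _ X Y A])
    show "finite (insert b B)" using B(1) by simp
    fix i t assume i: "i < Suc ?m" and t: "t \<noteq> (0::'k)"
    show "(s(?m := b)) i + csc t (if i = ?m then 0 else Y (c i)) \<in> (\<lambda>c. X c + csc t (Y c)) ` A"
    proof (cases "i = ?m")
      case True
      then show ?thesis using bt[OF t] by simp
    next
      case False
      then show ?thesis using i c by auto
    qed
  qed
  then show "\<exists>u::'k poly. u \<noteq> 0 \<and> (\<forall>t. poly u t \<noteq> 0 \<longrightarrow> t \<noteq> 0 \<longrightarrow>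
      ?m < cv.dim ((\<lambda>c. X c + csc t (Y c)) ` A))" by (simp only: Suc_le_eq)
qed

text \<open>The sum telescopes: the \<open>X\<close>-part of each term cancels the
  \<open>Y\<close>-part of its predecessor, leaving only the last \<open>Y\<close>-part.\<close>

lemma pencil_chain:
  assumes X: "Vector_Spaces.linear csc csc X" and Y: "Vector_Spaces.linear csc csc Y"
    and a0: "X (a 0) = 0" and a: "\<And>j. j < r \<Longrightarrow> X (a (Suc j)) = Y (a j)"
  shows "X (\<Sum>j\<le>r. csc ((- t) ^ j) (a j)) + csc t (Y (\<Sum>j\<le>r. csc ((- t) ^ j) (a j))) = csc (- ((- t) ^ Suc r)) (Y (a r))"
  using a
proof (induct r)
  case 0
  show ?case by (simp add: a0 cc.linear_0[OF Y] cc.linear_0[OF X])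
next
  case (Suc r)
  let ?s = "\<lambda>r. \<Sum>j\<le>r. csc ((- t) ^ j) (a j)"
  have IH: "X (?s r) + csc t (Y (?s r)) = csc (- ((- t) ^ Suc r)) (Y (a r))"
    by (rule Suc(1)) (use Suc(2) in auto)
  have "X (?s (Suc r)) + csc t (Y (?s (Suc r)))
      = (X (?s r) + csc t (Y (?s r))) + csc ((- t) ^ Suc r) (X (a (Suc r))) + csc (t * (- t) ^ Suc r) (Y (a (Suc r)))"
    by (simp only: sum.atMost_Suc cc.linear_add[OF X] cc.linear_add[OF Y] cc.linear_scale[OF X]
        cc.linear_scale[OF Y] cv.scale_right_distrib cv.scale_scale add_ac)
  also have "X (a (Suc r)) = Y (a r)" using Suc(2) by simp
  finally show ?case unfolding IH by (auto simp: fun_eq_iff)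
qed

lemma funpow_image_chain:
  assumes "\<And>i x. x \<in> P (Suc i) \<Longrightarrow> X x \<in> P i" "x \<in> P (i + k)"
  shows "(X ^^ k) x \<in> P i"
  using assms(2)
proof (induct k arbitrary: x)
  case (Suc k)
  then have "X x \<in> P (i + k)" using assms(1) by simp
  then have "(X ^^ k) (X x) \<in> P i" by (rule Suc(1))
  then show ?case by (simp only: funpow_Suc_right comp_apply)
qed simp

text \<open>If all layers are generated by the images of \<open>X\<close> and \<open>Y\<close>, then lifting
  an element outside the image of \<open>X\<close> along \<open>Y\<close>, and correcting by stabilization of the images of
  the powers of \<open>X\<close>, gives a sequence as in \<open>pencil_chain\<close>.\<close>

theorem pencil_not_generic:
  fixes X Y :: "'k::field chain \<Rightarrow> 'k chain"
  assumes X: "Vector_Spaces.linear csc csc X" and Y: "Vector_Spaces.linear csc csc Y"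
    and comm: "\<And>c. X (Y c) = Y (X c)"
    and P: "\<And>i. cv.subspace (P i)" "\<And>i. cv.fin_dim (P i)"
    and XP: "\<And>i x. x \<in> P (Suc i) \<Longrightarrow> X x \<in> P i" and YP: "\<And>i x. x \<in> P (Suc i) \<Longrightarrow> Y x \<in> P i"
    and onto: "\<And>i p. a \<le> i \<Longrightarrow> i \<le> a + cv.dim (P a) \<Longrightarrow> p \<in> P i \<Longrightarrow> \<exists>x\<in>P (Suc i). \<exists>y\<in>P (Suc i). p = X x + Y y"
    and ne: "X ` P (Suc a) \<noteq> P a"
  shows "\<exists>u::'k poly. u \<noteq> 0 \<and> (\<forall>t. poly u t \<noteq> 0 \<longrightarrow> t \<noteq> 0 \<longrightarrow>
      cv.dim (X ` P (Suc a)) < cv.dim ((\<lambda>c. X c + csc t (Y c)) ` P (Suc a)))"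
proof -
  let ?R = "X ` P (Suc a)"
  have Rsub: "cv.subspace ?R" by (rule cc.linear_subspace_image[OF X P(1)])
  have RP: "?R \<subseteq> P a" using XP by blast
  obtain p where p: "p \<in> P a" "p \<notin> ?R" using ne RP by blast
  have commk: "(Y ^^ k) (X c) = X ((Y ^^ k) c)" for k c
    by (rule funpow_hom[of Y X Y]) (rule comm[symmetric])
  have commk': "(X ^^ k) (Y c) = Y ((X ^^ k) c)" for k c
    by (rule funpow_hom[of X Y X]) (rule comm)
  have lin_funpow: "(Z ^^ k) (c - d) = (Z ^^ k) c - (Z ^^ k) d" "(Z ^^ k) (c + d) = (Z ^^ k) c + (Z ^^ k) d"
    if Z: "Vector_Spaces.linear csc csc Z" for Z :: "'k chain \<Rightarrow> 'k chain" and k c d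
  proof -
    show "(Z ^^ k) (c - d) = (Z ^^ k) c - (Z ^^ k) d"
    proof (induct k)
      case (Suc k)
      then show ?case by (simp only: funpow.simps comp_apply cc.linear_diff[OF Z])
    qed simp
    show "(Z ^^ k) (c + d) = (Z ^^ k) c + (Z ^^ k) d"
    proof (induct k)
      case (Suc k)
      then show ?case by (simp only: funpow.simps comp_apply cc.linear_add[OF Z])
    qed simp
  qed
  \<comment> \<open>Modulo the image of \<open>X\<close>, the element \<open>p\<close> equals
    \<open>(Y ^^ r) q\<close> with \<open>q\<close> taken \<open>r\<close> layers higher;
    \<open>X\<close> and \<open>Y\<close> commute, so every split-off \<open>X\<close>-part returns
    to the image of \<open>X\<close>.\<close>
  have reach: "\<exists>q\<in>P (a + r). p - (Y ^^ r) q \<in> ?R" if "r \<le> Suc (cv.dim (P a))" for r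
    using that
  proof (induct r)
    case 0
    have e: "p - (Y ^^ 0) p = 0" by simp
    have "p - (Y ^^ 0) p \<in> ?R" unfolding e by (rule cv.subspace_0[OF Rsub])
    then show ?case using p(1) by (intro bexI[of _ p]) (simp_all only: add_0_right)
  next
    case (Suc r)
    have "\<exists>q\<in>P (a + r). p - (Y ^^ r) q \<in> ?R" by (rule Suc(1)) (use Suc(2) in simp)
    then obtain q where q: "q \<in> P (a + r)" "p - (Y ^^ r) q \<in> ?R" by blast
    have ar: "a \<le> a + r" "a + r \<le> a + cv.dim (P a)"
      using Suc(2) by (simp_all only: Suc_le_mono nat_add_left_cancel_le le_add1)
    obtain x y where xy: "x \<in> P (Suc (a + r))" "y \<in> P (Suc (a + r))" "q = X x + Y y"
      using onto[OF ar q(1)] by blast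
    have "(Y ^^ r) q = X ((Y ^^ r) x) + (Y ^^ Suc r) y"
      unfolding xy(3) lin_funpow(2)[OF Y] commk by (simp only: funpow_Suc_right comp_apply)
    moreover have "(Y ^^ r) x \<in> P (Suc a)" by (rule funpow_image_chain[of P Y, OF YP]) (use xy in simp_all)
    moreover have "p - v = (p - (u + v)) + u" for u v :: "'k chain" by simp
    ultimately have e: "p - (Y ^^ Suc r) y = (p - (Y ^^ r) q) + X ((Y ^^ r) x)" and "X ((Y ^^ r) x) \<in> ?R"
      by (simp_all only: imageI)
    have "p - (Y ^^ Suc r) y \<in> ?R"
      unfolding e using q(2) \<open>X ((Y ^^ r) x) \<in> ?R\<close> by (rule cv.subspace_add[OF Rsub])
    then show ?case using xy(2) by (intro bexI[of _ y]) (simp_all only: add_Suc_right)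
  qed
  define d where "d = (\<lambda>r. cv.dim ((X ^^ r) ` P (a + r)))"
  have im: "cv.subspace ((X ^^ r) ` P (a + r))" "(X ^^ r) ` P (a + r) \<subseteq> P a" for r
  proof -
    have "Vector_Spaces.linear csc csc (X ^^ r)"
    proof (induct r)
      case 0 show ?case by (rule linear_cscI) (simp_all only: funpow.simps id_apply)
    next
      case (Suc r)
      show ?case
        by (rule linear_cscI)
          (simp_all only: funpow.simps comp_apply cc.linear_add[OF Suc] cc.linear_add[OF X]
            cc.linear_scale[OF Suc] cc.linear_scale[OF X])
    qed
    then show "cv.subspace ((X ^^ r) ` P (a + r))" by (rule cc.linear_subspace_image[OF _ P(1)])
    show "(X ^^ r) ` P (a + r) \<subseteq> P a" using funpow_image_chain[of P X, OF XP] by blast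
  qed
  have dec: "(X ^^ Suc r) ` P (a + Suc r) \<subseteq> (X ^^ r) ` P (a + r)" for r
    using XP by (auto simp only: funpow_Suc_right comp_apply add_Suc_right)
  have fd: "cv.fin_dim ((X ^^ r) ` P (a + r))" for r by (rule cv.fin_dim_mono[OF P(2) im(2)])
  define D where "D = cv.dim (P a)"
  have d0: "d 0 = D"
  proof -
    have "(X ^^ 0) ` P (a + 0) = P a" by auto
    then show ?thesis by (simp only: d_def D_def)
  qed
  have dle: "d (Suc r) \<le> d r" for r unfolding d_def by (rule cv.fin_dim_dim_mono[OF fd dec])
  \<comment> \<open>Dimensions starting at \<open>D\<close> cannot drop \<open>D + 1\<close> times.
    This is why \<open>onto\<close> is required up to \<open>a + cv.dim (P a)\<close>.\<close>
  have "\<exists>r\<le>D. d (Suc r) = d r"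
  proof (rule ccontr)
    assume "\<not> ?thesis"
    then have lt: "d (Suc r) < d r" if "r \<le> D" for r using dle[of r] that by (metis le_neq_implies_less)
    have "r \<le> Suc D \<Longrightarrow> d r + r \<le> D" for r
    proof (induct r)
      case 0 show ?case using d0 by simp
    next
      case (Suc r)
      then show ?case using lt[of r] by simp
    qed
    from this[of "Suc D"] show False by simp
  qed
  then obtain r where r: "r \<le> cv.dim (P a)" "d (Suc r) = d r" unfolding D_def by blast
  have st: "(X ^^ Suc r) ` P (a + Suc r) = (X ^^ r) ` P (a + r)"
    by (rule cv.fin_dim_subspace_eq[OF fd dec im(1)]) (use r(2) in \<open>simp add: d_def\<close>)
  obtain q where q: "q \<in> P (a + r)" "p - (Y ^^ r) q \<in> ?R" using reach[OF le_SucI[OF r(1)]] by blast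
  have "(X ^^ r) q \<in> (X ^^ Suc r) ` P (a + Suc r)" unfolding st using q(1) by blast
  then obtain q' where q': "q' \<in> P (a + Suc r)" "(X ^^ r) q = (X ^^ Suc r) q'" by blast
  \<comment> \<open>Stabilization lifts \<open>(X ^^ r) q\<close> one layer further. Subtracting
    \<open>X q'\<close> makes \<open>X ^^ r\<close> vanish on \<open>w\<close>, while
    \<open>(Y ^^ r) w\<close> changes only within the image of \<open>X\<close>.\<close>
  define w where "w = q - X q'"
  have wP: "w \<in> P (a + r)" unfolding w_def using q(1) XP q'(1) by (intro cv.subspace_diff[OF P(1)]) auto
  have Xw: "(X ^^ r) w = 0"
    unfolding w_def lin_funpow(1)[OF X] q'(2) by (simp only: funpow_Suc_right comp_apply diff_self)
  define b where "b = (Y ^^ r) w"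
  have bR: "b \<notin> ?R"
  proof
    assume b: "b \<in> ?R"
    have "(Y ^^ r) q' \<in> P (Suc a)" by (rule funpow_image_chain[of P Y, OF YP]) (use q' in simp_all)
    then have "X ((Y ^^ r) q') \<in> ?R" by blast
    then have "(p - (Y ^^ r) q) + (b + X ((Y ^^ r) q')) \<in> ?R"
      using q(2) b by (intro cv.subspace_add[OF Rsub])
    moreover have "b + X ((Y ^^ r) q') = (Y ^^ r) q"
      unfolding b_def w_def lin_funpow(1)[OF Y] commk by (simp only: diff_add_cancel)
    ultimately show False using p(2) by (simp only: diff_add_cancel)
  qed
  obtain r' where r': "r = Suc r'"
  proof (cases r)
    case 0
    then have "b = 0" using Xw unfolding b_def by simp
    then show ?thesis using bR cv.subspace_0[OF Rsub] by simp
  qed (use that in blast)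
  \<comment> \<open>The chain interpolates between \<open>X (c 0) = (X ^^ r) w = 0\<close> and
    \<open>Y (c r') = (Y ^^ r) w = b\<close>, with each \<open>X (c (Suc j))\<close> equal to
    \<open>Y (c j)\<close>.\<close>
  define c where "c = (\<lambda>j. (X ^^ (r' - j)) ((Y ^^ j) w))"
  have cP: "c j \<in> P (Suc a)" if "j \<le> r'" for j
  proof -
    have "(Y ^^ j) w \<in> P (Suc a + (r' - j))"
      by (rule funpow_image_chain[of P Y, OF YP]) (use wP r' that in simp_all)
    then show ?thesis unfolding c_def
      by (intro funpow_image_chain[of P X "(Y ^^ j) w" "Suc a" "r' - j"] XP)
  qed
  have c0: "X (c 0) = 0"
  proof -
    have "X (c 0) = (X ^^ Suc r') w" unfolding c_def by simp
    then show ?thesis using Xw r' by (simp only:)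
  qed
  have cS: "X (c (Suc j)) = Y (c j)" if "j < r'" for j
  proof -
    have "r' - j = Suc (r' - Suc j)" using that by simp
    then have "X (c (Suc j)) = (X ^^ (r' - j)) ((Y ^^ Suc j) w)" unfolding c_def by simp
    also have "\<dots> = Y (c j)" unfolding c_def by (simp only: funpow.simps comp_apply commk')
    finally show ?thesis .
  qed
  have "b \<in> (\<lambda>c. X c + csc t (Y c)) ` P (Suc a)" if t: "t \<noteq> 0" for t
  proof -
    let ?s = "\<Sum>j\<le>r'. csc ((- t) ^ j) (c j)"
    let ?k = "- ((- t) ^ Suc r')"
    have k: "?k \<noteq> 0" using t by simp
    have "Y (c r') = b" unfolding c_def b_def r' by simp
    then have e: "X ?s + csc t (Y ?s) = csc ?k b" using pencil_chain[OF X Y c0 cS, of r' t] by simp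
    have "X (csc (1 / ?k) ?s) + csc t (Y (csc (1 / ?k) ?s)) = csc (1 / ?k) (X ?s + csc t (Y ?s))"
      by (simp only: cc.linear_scale[OF X] cc.linear_scale[OF Y] cv.scale_right_distrib cv.scale_scale mult.commute)
    also have "\<dots> = b" unfolding e cv.scale_scale using k by (auto simp: fun_eq_iff)
    finally have "b = X (csc (1 / ?k) ?s) + csc t (Y (csc (1 / ?k) ?s))" by simp
    moreover have "csc (1 / ?k) ?s \<in> P (Suc a)"
      by (intro cv.subspace_scale[OF P(1)] cv.subspace_sum[OF P(1)]) (use cP in auto)
    ultimately show ?thesis by (rule image_eqI)
  qed
  from pencil_rank(2)[OF X Y P bR this] show ?thesis .
qed


subsection \<open>Comparison with the generic initial ideal\<close>

lemma (in lid) alpha_cong: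
  assumes J': "lid n J'" and h: "\<And>q d. q \<le> n \<Longrightarrow> hdm n J q 0 d = hdm n J' q 0 d" and q: "q < n"
  shows "alpha q d = lid.alpha n J' q d"
  unfolding alpha_def lid.alpha_def[OF J'] kdm_0[OF q] lid.kdm_0[OF J' q] using h q by simp

lemma hleads_hdm_0:
  assumes "lid n J" "lid n J'" "hleads J = hleads J'" "q \<le> n"
  shows "hdm n J q 0 d = hdm n J' q 0 d"
  unfolding lid.hdm_0[OF assms(1,4)] lid.hdm_0[OF assms(2,4)] leads_hpart assms(3) ..

lemma alpha_hleads:
  assumes "lid n J" "lid n J'" "hleads J = hleads J'" "q < n"
  shows "lid.alpha n J q d = lid.alpha n J' q d"
  by (rule lid.alpha_cong[OF assms(1,2) hleads_hdm_0[OF assms(1-3)] assms(4)])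

text \<open>\<open>I\<close> plays the role of the generic initial ideal: same \<open>alpha\<close>, but no
  correction terms in positive homological degree.\<close>

locale comparison = J: lid n J + I: lid n I
  for n :: nat and J I :: "'k::field ext set" +
  assumes h0: "\<And>q d. q \<le> n \<Longrightarrow> hdm n J q 0 d = hdm n I q 0 d"
    and k: "\<And>q i d. q < n \<Longrightarrow> 0 < i \<Longrightarrow> kdm n I q i d = 0"
begin

lemma alpha_eq: "q < n \<Longrightarrow> J.alpha q d = I.alpha q d"
  by (rule J.alpha_cong[OF I.lid_axioms h0])

text \<open>Both ideals obey the same recursion with the same \<open>alpha\<close>; the remaining
  corrections vanish for \<open>I\<close> and are nonnegative for \<open>J\<close>.\<close>

lemma hdm_le: "q \<le> n \<Longrightarrow> hdm n J q (Suc i) d \<le> hdm n I q (Suc i) d"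
proof (induct i arbitrary: q d)
  case 0
  show ?case using 0
  proof (induct "n - q" arbitrary: q d)
    case 0
    then show ?case using J.hdm_top[of q 0] I.hdm_top[of q 0] by simp
  next
    case (Suc m)
    then have q: "q < n" by simp
    show ?case
    proof (cases d)
      case 0
      then show ?thesis using J.hdm_low I.hdm_low by simp
    next
      case (Suc d')
      have "hdm n J (Suc q) (Suc 0) d \<le> hdm n I (Suc q) (Suc 0) d" using Suc.hyps(2) q by (intro Suc.hyps(1)) auto
      then show ?thesis unfolding Suc
        using J.hdm_recursion[OF q, of 0 d'] I.hdm_recursion[OF q, of 0 d'] k[OF q, of 1 d']
          J.kdm_nonneg[OF q, of 1 d'] alpha_eq[OF q, of d'] unfolding J.alpha_def I.alpha_def by simp
    qed
  qed
next
  case (Suc i)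
  note IH = Suc(1)
  show ?case using Suc(2)
  proof (induct "n - q" arbitrary: q d)
    case 0
    then show ?case using J.hdm_top[of q "Suc i"] I.hdm_top[of q "Suc i"] by simp
  next
    case (Suc m)
    then have q: "q < n" by simp
    show ?case
    proof (cases d)
      case 0
      then show ?thesis using J.hdm_low I.hdm_low by simp
    next
      case (Suc d')
      have "hdm n J (Suc q) (Suc (Suc i)) d \<le> hdm n I (Suc q) (Suc (Suc i)) d"
        using Suc.hyps(2) q by (intro Suc.hyps(1)) auto
      moreover have "hdm n J q (Suc i) d' \<le> hdm n I q (Suc i) d'" by (rule IH) (use q in simp)
      ultimately show ?thesis unfolding Suc
        using J.hdm_recursion[OF q, of "Suc i" d'] I.hdm_recursion[OF q, of "Suc i" d'] k[OF q, of "Suc i" d']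
          k[OF q, of "Suc (Suc i)" d'] J.kdm_nonneg[OF q, of "Suc i" d'] J.kdm_nonneg[OF q, of "Suc (Suc i)" d'] by simp
    qed
  qed
qed

text \<open>At level 0 the recursion bounds the left side by two terms, each at most its counterpart
  for \<open>I\<close>; equality of the totals forces equality of the term one homological degree
  lower.\<close>

lemma hdm_eq_descend:
  assumes eq: "hdm n J 0 (Suc (Suc i)) (Suc d) = hdm n I 0 (Suc (Suc i)) (Suc d)"
  shows "hdm n J 0 (Suc i) d = hdm n I 0 (Suc i) d"
proof (cases "n = 0")
  case True
  then show ?thesis using J.hdm_top[of 0 i] I.hdm_top[of 0 i] by simp
next
  case False
  then have q: "0 < n" by simp
  have "hdm n J (Suc 0) (Suc (Suc i)) (Suc d) \<le> hdm n I (Suc 0) (Suc (Suc i)) (Suc d)"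
    by (rule hdm_le) (use q in simp)
  moreover have "hdm n J 0 (Suc i) d \<le> hdm n I 0 (Suc i) d" by (rule hdm_le) simp
  ultimately show ?thesis
    using eq J.hdm_recursion[OF q, of "Suc i" d] I.hdm_recursion[OF q, of "Suc i" d] k[OF q, of "Suc i" d]
      k[OF q, of "Suc (Suc i)" d] J.kdm_nonneg[OF q, of "Suc i" d] J.kdm_nonneg[OF q, of "Suc (Suc i)" d] by simp
qed

lemma hdm_1_I: "hdm n I 0 1 (Suc d) = (\<Sum>q<n. J.alpha q d)"
  unfolding I.hdm_1_sum by (intro sum.cong refl) (simp add: k alpha_eq)

lemma hdm_1_eq_iff:
  "hdm n J 0 1 (Suc d) = hdm n I 0 1 (Suc d) \<longleftrightarrow> (\<forall>q<n. kdm n J q 1 d = 0)"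
proof -
  have "hdm n J 0 1 (Suc d) = hdm n I 0 1 (Suc d) \<longleftrightarrow> (\<Sum>q<n. kdm n J q 1 d) = 0"
    unfolding J.hdm_1_sum hdm_1_I sum_subtractf by auto
  also have "\<dots> \<longleftrightarrow> (\<forall>q<n. kdm n J q 1 d = 0)"
    using J.kdm_nonneg by (subst sum_nonneg_eq_0_iff) auto
  finally show ?thesis .
qed

lemma kdm_zero_of_betti:
  assumes eq: "(\<Sum>d\<le>Suc i + n. hdm n J 0 (Suc i) d) = (\<Sum>d\<le>Suc i + n. hdm n I 0 (Suc i) d)" and q: "q < n"
  shows "kdm n J q 1 d = 0"
proof -
  have all: "hdm n J 0 (Suc i) d = hdm n I 0 (Suc i) d" for d
  proof (cases "d \<le> Suc i + n")
    case True
    have "(\<Sum>d\<le>Suc i + n. hdm n I 0 (Suc i) d - hdm n J 0 (Suc i) d) = 0" using eq by (simp add: sum_subtractf)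
    then have "\<forall>d\<in>{..Suc i + n}. hdm n I 0 (Suc i) d - hdm n J 0 (Suc i) d = 0"
      using hdm_le[of 0 i] by (subst (asm) sum_nonneg_eq_0_iff) auto
    then show ?thesis using True by auto
  next
    case False
    then show ?thesis using J.hdm_high[of "Suc i" d 0] I.hdm_high[of "Suc i" d 0] by simp
  qed
  have "(\<forall>d. hdm n J 0 (Suc i) d = hdm n I 0 (Suc i) d) \<Longrightarrow> \<forall>d. hdm n J 0 1 d = hdm n I 0 1 d" for i
  proof (induct i)
    case (Suc i)
    then have "\<forall>d. hdm n J 0 (Suc i) d = hdm n I 0 (Suc i) d" using hdm_eq_descend by blast
    then show ?case by (rule Suc(1))
  qed simp
  then have "hdm n J 0 1 (Suc d) = hdm n I 0 1 (Suc d)" using all by blast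
  then show ?thesis using hdm_1_eq_iff q by blast
qed

end

lemma (in gid) comparison_generic:
  assumes inf: "infinite (UNIV :: 'k set)" and g: "generic n J g"
  shows "comparison n (ext_act n g ` J) (Gin n J)"
proof -
  let ?J = "ext_act n g ` J"
  have J: "lid n ?J" by (rule generic_lid[OF g])
  have up: "up_closed n (hleads ?J)" by (rule lid.up_closed_hleads[OF J])
  have Gin: "Gin n J = mono_ideal n (hleads ?J)" by (rule Gin_eq[OF inf g])
  have I: "lid n (Gin n J)" unfolding Gin by (rule lid_mono_ideal[OF up])
  have "hleads ?J = hleads (Gin n J)"
    unfolding Gin by (rule hleads_mono_ideal[OF lid.hleads_subset[OF J], symmetric])
  then show ?thesis
    unfolding comparison_def comparison_axioms_def
    using J I hleads_hdm_0[OF J I] kdm_stable[OF up stable_generic[OF inf g]] unfolding Gin by blast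
qed

lemma hpart_ext_act:
  assumes "gid n J"
  shows "hpart d (ext_act n g ` J) = ext_act n g ` hpart d J"
proof -
  interpret gid n J by fact
  show ?thesis using hpart_lift ext_act_hpart by blast
qed

context lid begin

text \<open>Vanishing in degree \<open>c\<close> kills the strand of \<open>c\<close> at every level
  and so bounds \<open>kdm\<close> in homological degree 1 and degree \<open>c + 1\<close> by 0.
  Without first homology in the next degree, the sum of the \<open>alpha\<close> in degree
  \<open>c + 1\<close> is then 0.\<close>

lemma alpha_zero_induct:
  assumes a: "\<And>q. q < n \<Longrightarrow> alpha q k = 0" and h: "\<And>d. k \<le> d \<Longrightarrow> hdm n J 0 1 (Suc d) = 0"
    and c: "k \<le> c"
  shows "\<forall>q<n. alpha q c = 0"
  using c
proof (induct c rule: dec_induct)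
  case base
  show ?case using a by blast
next
  case (step c)
  have "kdm n J q 1 (Suc c) = 0" if q: "q < n" for q
  proof -
    have "hdm n J q (Suc 0) (Suc 0 + c) = 0" by (rule hdm_zero_of_alpha) (use step q in auto)
    then show ?thesis using kdm_le_hdm[OF q, of 1 "Suc c"] kdm_nonneg[OF q, of 1 "Suc c"] by simp
  qed
  then have "(\<Sum>q<n. alpha q (Suc c)) = 0"
    using hdm_1_sum[of "Suc c"] h[of "Suc c"] step by (simp add: sum_subtractf)
  then show ?case using alpha_nonneg by (subst (asm) sum_nonneg_eq_0_iff) auto
qed

end

lemma hdm_0_ext_act:
  assumes "lid n J" "\<exists>h. inv_pair n g h"
  shows "hdm n (ext_act n g ` J) 0 i d = hdm n J 0 i d"
  using hdm_ext_act[OF assms(1)] assms(2) blk_0 by blast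

lemma generic_inv: "generic n J g \<Longrightarrow> \<exists>h. inv_pair n g h" unfolding generic_def by blast

text \<open>The coordinates are generic for \<open>J\<close>. What passes to the ideal of one
  component is the vanishing of \<open>kdm\<close> in degree \<open>k\<close>; generation in degree
  \<open>k\<close> does the rest.\<close>

theorem (in gid) componentwise_linear_of_betti:
  assumes inf: "infinite (UNIV :: 'k set)"
    and eq: "betti n (ext_carrier n) J (Suc i) = betti n (ext_carrier n) (Gin n J) (Suc i)"
  shows "componentwise_linear n J"
proof -
  obtain g where g: "generic n J g" using generic_open[OF inf] by blast
  let ?J = "ext_act n g ` J"
  interpret C: comparison n ?J "Gin n J" by (rule comparison_generic[OF inf g])
  note inv = generic_inv[OF g]
  have k0: "kdm n ?J q 1 d = 0" if "q < n" for q d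
  proof (rule C.kdm_zero_of_betti[OF _ that])
    have "(\<Sum>d\<le>Suc i + n. hdm n ?J 0 (Suc i) d) = int (betti n (ext_carrier n) J (Suc i))"
      unfolding betti_eq by (simp add: hdm_0_ext_act[OF lid_axioms inv])
    then show "(\<Sum>d\<le>Suc i + n. hdm n ?J 0 (Suc i) d) = (\<Sum>d\<le>Suc i + n. hdm n (Gin n J) 0 (Suc i) d)"
      unfolding eq C.I.betti_eq .
  qed
  have "betti_gr n (comp_ideal n k J) {0} i (i + j) = 0" if j: "j \<noteq> k" for k i j
  proof -
    let ?L = "cid n J k"
    interpret L: gid n ?L by (rule cid_gid)
    let ?M = "ext_act n g ` ?L"
    interpret M: lid n ?M using lid_ext_act[OF L.lid_axioms] inv unfolding inv_pair_def by blast
    have hp: "hpart k ?M = hpart k ?J"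
      unfolding hpart_ext_act[OF cid_gid] hpart_ext_act[OF gid_axioms] by (simp add: hpart_cid)
    have kM: "kdm n ?M q 1 k = 0" if "q < n" for q
      using kdm_hpart_cong[OF hp M.lid_axioms C.J.lid_axioms] k0[OF that] by simp
    have h1: "hdm n ?M 0 1 (Suc d) = 0" if "k \<le> d" for d
      using hdm_0_ext_act[OF L.lid_axioms inv] hdm_cid[OF that] by simp
    have "(\<Sum>q<n. M.alpha q k) = 0"
      using M.hdm_1_sum[of k] h1[of k] kM by (simp add: sum_subtractf)
    then have a: "M.alpha q k = 0" if "q < n" for q
      using M.alpha_nonneg that by (subst (asm) sum_nonneg_eq_0_iff) auto
    have hM: "hdm n ?M 0 (Suc i) (Suc i + c) = 0" if "k \<le> c" for i c
    proof (rule M.hdm_zero_of_alpha)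
      fix q assume "q < n"
      then show "M.alpha q c = 0" using M.alpha_zero_induct[OF a h1 that] by blast
    qed simp
    show ?thesis unfolding comp_ideal_eq
    proof (rule L.hdm_imp_linear[OF _ _ j])
      show "hpart d ?L = {0}" if "d < k" for d using that by (simp add: hpart_cid)
      show "hdm n ?L 0 (Suc i) (Suc i + c) = 0" if "k \<le> c" for i c
        using hM[OF that] hdm_0_ext_act[OF L.lid_axioms inv] by simp
    qed
  qed
  then show ?thesis unfolding componentwise_linear_def by blast
qed

subsection \<open>Linear ideals in generic coordinates\<close>

lemma mmul_elem: 
  assumes "m < n" "i < n"
  shows "mmul n (elem l m t) g i j = g i j + t * (if i = l then g m j else 0)"
proof -
  have "mmul n (elem l m t) g i j = (\<Sum>k<n. (if k = i then g i j else 0) + (if k = m then (if i = l then t * g m j else 0) else 0))"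
    unfolding mmul_def elem_def by (intro sum.cong refl) (auto simp: algebra_simps)
  then show ?thesis using assms by (simp add: sum.distrib)
qed

lemma polyfun_cong:
  assumes "p \<in> polyfun n" "\<And>i j. i < n \<Longrightarrow> j < n \<Longrightarrow> g i j = g' i j"
  shows "p g = p g'"
  using assms by (induct) auto

lemma inv_pair_elem:
  fixes t :: "'k::field"
  assumes "l \<noteq> m" "m < n"
  shows "inv_pair n (elem l m t) (elem l m (- t))"
proof -
  have "is_one n (mmul n (elem l m s) (elem l m (- s)))" for s :: 'k
    unfolding is_one_def
  proof (intro allI impI)
    fix i j assume i: "i < n"
    show "mmul n (elem l m s) (elem l m (- s)) i j = (if i = j then 1 else 0)"
      unfolding mmul_elem[OF assms(2) i] using assms(1) by (auto simp: elem_def)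
  qed
  from this[of t] this[of "- t"] show ?thesis unfolding inv_pair_def by simp
qed

lemma blk_elem: "blk n q (elem q m t)" unfolding blk_def elem_def by auto

text \<open>A transvection turns the contraction \<open>sh q\<close> into a member of the pencil
  spanned by \<open>sh q\<close> and \<open>sh m\<close>.\<close>

lemma lsh_elem:
  assumes "q < n" "m < n" "q \<noteq> m"
  shows "lsh n (elem q m t) q c = sh q c + csc t (sh m c)"
proof -
  have "lsh n (elem q m t) q c = (\<Sum>k<n. (if k = q then sh q c else 0) + (if k = m then csc t (sh m c) else 0))"
    unfolding lsh_def elem_def using assms(3) by (intro sum.cong refl) (auto simp: fun_eq_iff)
  then show ?thesis using assms by (simp add: sum.distrib)
qed

context lid begin

text \<open>With the next term of the long exact sequence zero, the connecting map is onto, so its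
  rank is the dimension of its target.\<close>

lemma hdm_Suc_eq_kdm:
  assumes q: "q < n" and h: "hdm n J q (Suc i) (Suc d) = 0"
  shows "hdm n J (Suc q) (Suc i) (Suc d) = kdm n J q (Suc i) d"
  using hdm_recursion[OF q, of i d] h kdm_le_hdm[OF q, of i d] kdm_le_hdm_Suc[OF q, of "Suc i" d] by simp

lemma kdm_zero_image:
  assumes q: "q < n" and k: "kdm n J q i d = 0"
  shows "sh q ` Zc n J q (Suc i) (Suc d) = Zc n J q i d"
proof (rule cv.fin_dim_subspace_eq[OF fin_dim_Zc])
  show "sh q ` Zc n J q (Suc i) (Suc d) \<subseteq> Zc n J q i d" using sh_Zc[OF _ q] by blast
  show "cv.subspace (sh q ` Zc n J q (Suc i) (Suc d))" by (rule cc.linear_subspace_image[OF lin_sh subspace_Zc])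
  show "cv.dim (Zc n J q i d) \<le> cv.dim (sh q ` Zc n J q (Suc i) (Suc d))" using k unfolding kdm_def by simp
qed

text \<open>Chasing the long exact sequences: modulo the image of \<open>sh q\<close>, the operator
  \<open>sh (Suc q)\<close> is onto.\<close>

lemma sh_two_onto:
  assumes q: "Suc q < n" and h: "hdm n J q (Suc (Suc i)) (Suc (Suc d)) = 0"
    and h2: "hdm n J (Suc (Suc q)) (Suc i) (Suc (Suc d)) = 0" and p: "p \<in> Zc n J q (Suc i) d"
  shows "\<exists>x\<in>Zc n J q (Suc (Suc i)) (Suc d). \<exists>y\<in>Zc n J q (Suc (Suc i)) (Suc d). p = sh q x + sh (Suc q) y"
proof -
  have q': "q < n" using q by simp
  have "kdm n J (Suc q) (Suc i) (Suc d) = 0"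
    using kdm_le_hdm_Suc[OF q, of "Suc i" "Suc d"] h2 kdm_nonneg[OF q, of "Suc i" "Suc d"] by simp
  note onto = kdm_zero_image[OF q this]
  have dB: "lmc q (rs q p) \<in> Bc n J q (Suc i) (Suc d)" by (rule delta_in[OF p q'])
  then have "lmc q (rs q p) \<in> Zc n J (Suc q) (Suc i) (Suc d)"
    unfolding Zc_Suc using Bc_Zc by (auto simp: sh_lmc)
  then obtain z where z: "z \<in> Zc n J (Suc q) (Suc (Suc i)) (Suc (Suc d))" "lmc q (rs q p) = sh (Suc q) z"
    using onto by blast
  \<comment> \<open>By the vanishing at level \<open>q\<close> the lift \<open>z\<close> is a
    boundary, so \<open>delta_onto\<close> supplies \<open>y\<close>. Contracting with
    \<open>x_(q+1)\<close> shows that \<open>p\<close> and \<open>sh (Suc q) y\<close> have the same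
    connecting image, and \<open>delta_kernel\<close> puts their difference into the image of
    \<open>sh q\<close>.\<close>
  have "z \<in> Bc n J q (Suc (Suc i)) (Suc (Suc d))" "sh q z = 0"
    using z(1) h unfolding hdm_0_iff Zc_Suc by auto
  then obtain y where y: "y \<in> Zc n J q (Suc (Suc i)) (Suc d)"
    "z - lmc q (rs q y) \<in> Bc n J (Suc q) (Suc (Suc i)) (Suc (Suc d))"
    using delta_onto[OF _ _ q'] by blast
  have "sh (Suc q) (z - lmc q (rs q y)) \<in> Bc n J (Suc q) (Suc i) (Suc d)" by (rule sh_Bc[OF y(2) q])
  moreover have "sh (Suc q) (rs q y) = rs q (sh (Suc q) y)" by (rule ext) (simp add: sh_def rs_def)
  then have "sh (Suc q) (z - lmc q (rs q y)) = lmc q (rs q (p - sh (Suc q) y))"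
    by (simp add: sh_diff sh_lmc z(2) rs_diff lmc_diff)
  moreover have "p - sh (Suc q) y \<in> Zc n J q (Suc i) d"
    by (rule cv.subspace_diff[OF subspace_Zc p sh_Zc[OF y(1) q]])
  ultimately have "p - sh (Suc q) y \<in> sh q ` Zc n J q (Suc (Suc i)) (Suc d)"
    using delta_kernel[OF _ q'] by metis
  then obtain x where "x \<in> Zc n J q (Suc (Suc i)) (Suc d)" "p - sh (Suc q) y = sh q x" by blast
  then show ?thesis using y(1) by (metis diff_add_cancel)
qed

end

text \<open>Among the admissible matrices one with the smallest total defect \<open>mu\<close> at
  level \<open>Suc q\<close> is chosen. If the defect is positive, \<open>sh q\<close> is not onto
  somewhere although \<open>sh q\<close> and \<open>sh (Suc q)\<close> together are; a transvection
  then lowers the defect.\<close>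

lemma generic_step:
  fixes L :: "'k::field ext set"
  assumes inf: "infinite (UNIV :: 'k set)" and L: "lid n L" and p: "p \<in> polyfun n"
    and inv: "\<And>g. p g \<noteq> 0 \<Longrightarrow> \<exists>h. inv_pair n g h"
    and top: "\<And>g i. p g \<noteq> 0 \<Longrightarrow> hdm n (ext_act n g ` L) (Suc (Suc q)) (Suc i) (Suc i + Suc c) = 0"
    and q: "Suc q < n"
    and S: "\<And>R. \<exists>g. p g \<noteq> 0 \<and> (\<forall>i<R. hdm n (ext_act n g ` L) q (Suc i) (Suc i + c) = 0)"
  shows "\<exists>g. p g \<noteq> 0 \<and> (\<forall>i<R. hdm n (ext_act n g ` L) (Suc q) (Suc i) (Suc i + c) = 0)"
proof -
  \<comment> \<open>The pencil argument at a degree \<open>a < R\<close> uses the degrees up to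
    \<open>a + cv.dim (P a)\<close>, and surjectivity there looks one degree further. The sum bounds
    \<open>cv.dim (P a)\<close> independently of the coordinates.\<close>
  define R' where "R' = R + 2 + (\<Sum>i<R. cv.dim (Ch n q (Suc i) (i + c) :: 'k chain set))"
  define good where "good = (\<lambda>g. p g \<noteq> 0 \<and> (\<forall>i<R'. hdm n (ext_act n g ` L) q (Suc i) (Suc i + c) = 0))"
  define mu where "mu = (\<lambda>g. nat (\<Sum>i<R. hdm n (ext_act n g ` L) (Suc q) (Suc i) (Suc i + c)))"
  have "\<exists>g. good g" using S[of R'] unfolding good_def .
  then obtain g where g: "good g" and min: "\<And>g'. good g' \<Longrightarrow> mu g \<le> mu g'"
    using ex_has_least_nat[of good _ mu] by blast
  have lidact: "lid n (ext_act n g ` L)" if "p g \<noteq> 0" for g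
    using lid_ext_act[OF L] inv[OF that] unfolding inv_pair_def by blast
  let ?L = "ext_act n g ` L"
  have pg: "p g \<noteq> 0" using g unfolding good_def by blast
  interpret X: lid n ?L by (rule lidact[OF pg])
  have q': "q < n" using q by simp
  define P where "P = (\<lambda>i. Zc n ?L q (Suc i) (i + c))"
  let ?X = "sh q" and ?Y = "sh (Suc q)"
  let ?im = "\<lambda>t i. (\<lambda>v. ?X v + csc t (?Y v)) ` P (Suc i)"
  have hX: "hdm n ?L q (Suc i) (Suc i + c) = 0" if "i < R'" for i using g that unfolding good_def by blast
  have RR': "i < R' " if "i < R" for i using that unfolding R'_def by simp
  have hq: "hdm n ?L (Suc q) (Suc i) (Suc i + c) = int (cv.dim (P i)) - int (cv.dim (?X ` P (Suc i)))"
    if i: "i < R'" for i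
    using X.hdm_Suc_eq_kdm[OF q', of i "i + c"] hX[OF i] unfolding kdm_def P_def by simp
  show ?thesis
  proof (cases "\<forall>i<R. hdm n ?L (Suc q) (Suc i) (Suc i + c) = 0")
    case True
    then show ?thesis using pg by blast
  next
    case False
    then obtain a where a: "a < R" "hdm n ?L (Suc q) (Suc a) (Suc a + c) \<noteq> 0" by blast
    have Psub: "cv.subspace (P i)" "cv.fin_dim (P i)" for i
      unfolding P_def by (rule X.subspace_Zc, rule X.fin_dim_Zc)
    have XP: "?X x \<in> P i" "?Y x \<in> P i" if "x \<in> P (Suc i)" for x i
      using X.sh_Zc[of x q "Suc i" "i + c"] that q q' unfolding P_def by auto
    have dimP: "a + cv.dim (P a) < R + (\<Sum>i<R. cv.dim (Ch n q (Suc i) (i + c) :: 'k chain set))"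
    proof -
      have "cv.dim (P a) \<le> cv.dim (Ch n q (Suc a) (a + c) :: 'k chain set)"
        unfolding P_def by (rule cv.fin_dim_dim_mono[OF fin_dim_Ch Zc_Ch])
      also have "\<dots> \<le> (\<Sum>i<R. cv.dim (Ch n q (Suc i) (i + c) :: 'k chain set))"
        by (rule member_le_sum) (use a in auto)
      finally show ?thesis using a(1) by linarith
    qed
    have onto: "\<exists>x\<in>P (Suc i). \<exists>y\<in>P (Suc i). v = ?X x + ?Y y"
      if i: "i \<le> a + cv.dim (P a)" and v: "v \<in> P i" for i v
    proof -
      have "Suc i < R'" using i dimP unfolding R'_def by linarith
      from hX[OF this] have 1: "hdm n ?L q (Suc (Suc i)) (Suc (Suc (i + c))) = 0" by simp
      have 2: "hdm n ?L (Suc (Suc q)) (Suc i) (Suc (Suc (i + c))) = 0" using top[OF pg, of i] by simp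
      have v': "v \<in> Zc n ?L q (Suc i) (i + c)" using v unfolding P_def .
      have "P (Suc i) = Zc n ?L q (Suc (Suc i)) (Suc (i + c))" unfolding P_def by simp
      then show ?thesis using X.sh_two_onto[OF q 1 2 v'] by simp
    qed
    have ne: "?X ` P (Suc a) \<noteq> P a"
    proof
      assume "?X ` P (Suc a) = P a"
      then have "hdm n ?L (Suc q) (Suc a) (Suc a + c) = 0" using hq[OF RR'[OF a(1)]] by simp
      then show False using a(2) by simp
    qed
    obtain u0 :: "'k poly" where u0: "u0 \<noteq> 0"
      "\<And>t. poly u0 t \<noteq> 0 \<Longrightarrow> t \<noteq> 0 \<Longrightarrow> cv.dim (?X ` P (Suc a)) < cv.dim (?im t a)"
      using pencil_not_generic[OF lin_sh lin_sh sh_comm Psub XP onto ne] by blast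
    have "\<forall>i. \<exists>u :: 'k poly. u \<noteq> 0 \<and> (\<forall>t. poly u t \<noteq> 0 \<longrightarrow> t \<noteq> 0 \<longrightarrow> cv.dim (?X ` P (Suc i)) \<le> cv.dim (?im t i))"
      using pencil_rank(1)[OF lin_sh lin_sh Psub] by blast
    from choice[OF this] obtain u :: "nat \<Rightarrow> 'k poly" where
      u': "\<forall>i. u i \<noteq> 0 \<and> (\<forall>t. poly (u i) t \<noteq> 0 \<longrightarrow> t \<noteq> 0 \<longrightarrow> cv.dim (?X ` P (Suc i)) \<le> cv.dim (?im t i))" ..
    have u: "u i \<noteq> 0" "poly (u i) t \<noteq> 0 \<Longrightarrow> t \<noteq> 0 \<Longrightarrow> cv.dim (?X ` P (Suc i)) \<le> cv.dim (?im t i)" for i t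
      using u' by blast+
    let ?e = "\<lambda>t. elem q (Suc q) t"
    obtain Q where Q: "\<And>t. p (\<lambda>i j. g i j + t * (if i = q then g (Suc q) j else 0)) = poly Q t"
      using polyfun_line[OF p, of g "\<lambda>i j. if i = q then g (Suc q) j else 0"] by blast
    have pQ: "p (mmul n (?e t) g) = poly Q t" for t
      unfolding Q[symmetric] by (rule polyfun_cong[OF p]) (simp add: mmul_elem[OF q])
    have "poly Q 0 = p g" using Q[of 0] by simp
    then have "Q \<noteq> 0" using pg by auto
    \<comment> \<open>Away from its roots, \<open>Q\<close> keeps the new matrix in the open set,
      each \<open>u i\<close> prevents a rank from dropping, and \<open>u0\<close> makes the rank at
      \<open>a\<close> grow.\<close>
    then have "u0 * Q * (\<Prod>i<R. u i) \<noteq> 0" using u0(1) u(1) by simp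
    from poly_nonroot[OF inf this] have "{t. poly (u0 * Q * (\<Prod>i<R. u i)) t \<noteq> 0} - {0} \<noteq> {}"
      using finite_subset[of "{t. poly (u0 * Q * (\<Prod>i<R. u i)) t \<noteq> 0}" "{0}"] by auto
    then obtain t where t: "poly (u0 * Q * (\<Prod>i<R. u i)) t \<noteq> 0" "t \<noteq> 0" by blast
    have tu: "poly u0 t \<noteq> 0" "poly Q t \<noteq> 0" "\<And>i. i < R \<Longrightarrow> poly (u i) t \<noteq> 0"
      using t(1) by (auto simp: poly_prod prod_zero_iff)
    let ?g = "mmul n (?e t) g"
    have pg': "p ?g \<noteq> 0" using pQ tu(2) by simp
    have act: "ext_act n ?g ` L = ext_act n (?e t) ` ?L" by (simp add: image_image ext_act_ext_act)
    have ip: "inv_pair n (?e t) (?e (- t))" by (rule inv_pair_elem[OF _ q]) simp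
    have one: "is_one n (mmul n (?e (- t)) (?e t))" using ip unfolding inv_pair_def by blast
    interpret X': lid n "ext_act n (?e t) ` ?L" using lidact[OF pg'] unfolding act .
    \<comment> \<open>The transvection preserves the span of the coordinates from \<open>q\<close>
      on, so homology at level \<open>q\<close> is unchanged; only level \<open>Suc q\<close> is
      affected.\<close>
    have hX': "hdm n (ext_act n (?e t) ` ?L) q i d = hdm n ?L q i d" for i d
      by (rule hdm_ext_act[OF X.lid_axioms ip blk_elem blk_elem])
    have Z': "Zc n (ext_act n (?e t) ` ?L) q i d = gch n (?e t) ` Zc n ?L q i d" for i d
      by (rule gch_Zc_image[OF X.lid_axioms ip blk_elem blk_elem, symmetric])
    have hq': "hdm n (ext_act n ?g ` L) (Suc q) (Suc i) (Suc i + c) = int (cv.dim (P i)) - int (cv.dim (?im t i))"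
      if i: "i < R'" for i
    proof -
      have "hdm n (ext_act n ?g ` L) (Suc q) (Suc i) (Suc i + c) = kdm n (ext_act n (?e t) ` ?L) q (Suc i) (i + c)"
        unfolding act using X'.hdm_Suc_eq_kdm[OF q', of i "i + c"] hX[OF i] hX' by simp
      also have "\<dots> = int (cv.dim (gch n (?e t) ` P i)) - int (cv.dim (?X ` gch n (?e t) ` P (Suc i)))"
        unfolding kdm_def Z' P_def by simp
      also have "?X ` gch n (?e t) ` P (Suc i) = gch n (?e t) ` ?im t i"
        using q q' by (simp add: image_image sh_gch lsh_elem)
      also have "cv.dim (gch n (?e t) ` P i) = cv.dim (P i)"
        by (rule dim_gch[OF Psub(1) _ one]) (auto simp: P_def Zc_def)
      also have "cv.dim (gch n (?e t) ` ?im t i) = cv.dim (?im t i)"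
      proof (rule dim_gch[OF _ _ one])
        have lin: "Vector_Spaces.linear csc csc (\<lambda>v. ?X v + csc t (?Y v))"
          by (rule linear_cscI) (simp_all add: sh_add sh_csc cv.scale_right_distrib mult.commute)
        show "cv.subspace (?im t i)" by (rule cc.linear_subspace_image[OF lin Psub(1)])
        have "?im t i \<subseteq> P i"
          using XP cv.subspace_add[OF Psub(1)] cv.subspace_scale[OF Psub(1)] by blast
        then show "?im t i \<subseteq> Ch n q (Suc i) (i + c)" unfolding P_def using Zc_Ch by blast
      qed
      finally show ?thesis .
    qed
    have "good ?g" unfolding good_def using pg' hX hX' act by simp
    then have "mu g \<le> mu ?g" by (rule min)
    moreover have "(\<Sum>i<R. hdm n (ext_act n ?g ` L) (Suc q) (Suc i) (Suc i + c))
        < (\<Sum>i<R. hdm n ?L (Suc q) (Suc i) (Suc i + c))"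
    proof (rule sum_strict_mono_ex1)
      show "\<forall>i\<in>{..<R}. hdm n (ext_act n ?g ` L) (Suc q) (Suc i) (Suc i + c) \<le> hdm n ?L (Suc q) (Suc i) (Suc i + c)"
        using hq hq' RR' u(2)[OF tu(3) t(2)] by (simp add: of_nat_le_iff)
      show "\<exists>i\<in>{..<R}. hdm n (ext_act n ?g ` L) (Suc q) (Suc i) (Suc i + c) < hdm n ?L (Suc q) (Suc i) (Suc i + c)"
        using hq[OF RR'[OF a(1)]] hq'[OF RR'[OF a(1)]] u0(2)[OF tu(1) t(2)] a(1) by (intro bexI[of _ a]) auto
    qed simp
    moreover have "0 \<le> (\<Sum>i<R. hdm n (ext_act n ?g ` L) (Suc q) (Suc i) (Suc i + c))"
      unfolding act by (rule sum_nonneg) (rule X'.hdm_nonneg)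
    ultimately show ?thesis unfolding mu_def by linarith
  qed
qed

text \<open>The largest degree \<open>c\<close> with a nonzero \<open>alpha\<close> would survive in all
  coordinate systems, contradicting \<open>generic_step\<close>.\<close>

lemma linear_generic_alpha:
  fixes L :: "'k::field ext set"
  assumes inf: "infinite (UNIV :: 'k set)" and L: "gid n L"
    and h: "\<And>i c. k \<le> c \<Longrightarrow> hdm n L 0 (Suc i) (Suc i + c) = 0"
    and p: "p \<in> polyfun n" "p g0 \<noteq> 0" and gen: "\<And>g. p g \<noteq> 0 \<Longrightarrow> generic n L g" and q: "q < n"
  shows "lid.alpha n (ext_act n g0 ` L) q k = 0"
proof (rule ccontr)
  interpret L: gid n L by fact
  let ?A = "\<lambda>g. lid.alpha n (ext_act n g ` L)"
  have lidg: "lid n (ext_act n g ` L)" if "p g \<noteq> 0" for g by (rule L.generic_lid[OF gen[OF that]])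
  \<comment> \<open>All generic matrices give the same leading monomials, so a nonzero annihilator
    number persists while the coordinates are changed.\<close>
  have const: "?A g q d = ?A g0 q d" if "p g \<noteq> 0" "q < n" for g q d
    by (rule alpha_hleads[OF lidg[OF that(1)] lidg[OF p(2)] L.generic_hleads[OF gen[OF that(1)] gen[OF p(2)]] that(2)])
  assume ne: "?A g0 q k \<noteq> 0"
  define C where "C = {c. k \<le> c \<and> (\<exists>q<n. ?A g0 q c \<noteq> 0)}"
  have Cn: "c \<le> n" if "c \<in> C" for c
  proof (rule ccontr)
    assume "\<not> c \<le> n"
    then have "?A g0 q c = 0" if "q < n" for q
      using lid.hdm_high[OF lidg[OF p(2)], of 0 c] lid.kdm_nonneg[OF lidg[OF p(2)] that, of 0 c]
        lid.kdm_le_hdm[OF lidg[OF p(2)] that, of 0 c] unfolding lid.alpha_def[OF lidg[OF p(2)]] by simp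
    then show False using that unfolding C_def by blast
  qed
  then have finC: "finite C" by (meson atMost_iff finite_atMost finite_subset subsetI)
  have "k \<in> C" using ne q unfolding C_def by blast
  then have CC: "Max C \<in> C" using finC Max_in by blast
  define c where "c = Max C"
  have kc: "k \<le> c" using CC unfolding c_def C_def by blast
  obtain q0 where q0: "q0 < n" "?A g0 q0 c \<noteq> 0" using CC unfolding c_def C_def by blast
  have above: "?A g q (Suc c) = 0" if "p g \<noteq> 0" "q < n" for g q
  proof (rule ccontr)
    assume "?A g q (Suc c) \<noteq> 0"
    then have "Suc c \<in> C" using const[OF that] that(2) kc unfolding C_def by auto
    then show False using Max_ge[OF finC] unfolding c_def by fastforce
  qed
  have top: "hdm n (ext_act n g ` L) q (Suc i) (Suc i + Suc c) = 0" if "p g \<noteq> 0" "q \<le> n" for g q i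
    by (rule lid.hdm_zero_of_alpha[OF lidg[OF that(1)] above[OF that(1)] that(2)])
  \<comment> \<open>The matrix may depend on \<open>R\<close>, because each passage to the next
    level uses up homological degrees. At \<open>q0\<close> the bound \<open>R = 1\<close> is
    enough.\<close>
  have "q \<le> q0 \<Longrightarrow> \<forall>R. \<exists>g. p g \<noteq> 0 \<and> (\<forall>i<R. hdm n (ext_act n g ` L) q (Suc i) (Suc i + c) = 0)" for q
  proof (induct q)
    case 0
    have "hdm n (ext_act n g0 ` L) 0 (Suc i) (Suc i + c) = 0" for i
      using hdm_0_ext_act[OF L.lid_axioms generic_inv[OF gen[OF p(2)]]] h[OF kc] by simp
    then show ?case using p(2) by blast
  next
    case (Suc q)
    then have q: "Suc q < n" using q0(1) by simp
    have IH: "\<And>R. \<exists>g. p g \<noteq> 0 \<and> (\<forall>i<R. hdm n (ext_act n g ` L) q (Suc i) (Suc i + c) = 0)"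
      using Suc by simp
    have "hdm n (ext_act n g ` L) (Suc (Suc q)) (Suc i) (Suc i + Suc c) = 0" if "p g \<noteq> 0" for g i
      by (rule top[OF that]) (use q in simp)
    from generic_step[OF inf L.lid_axioms p(1) generic_inv[OF gen] this q IH] show ?case by blast
  qed
  then obtain g where g: "p g \<noteq> 0" "\<forall>i<1. hdm n (ext_act n g ` L) q0 (Suc i) (Suc i + c) = 0" by blast
  then have "hdm n (ext_act n g ` L) q0 1 (Suc c) = 0" by simp
  then have "?A g q0 c = 0"
    using lid.hdm_1_ge_alpha[OF lidg[OF g(1)] q0(1), of c] lid.alpha_nonneg[OF lidg[OF g(1)] q0(1), of c] by simp
  then show False using q0 const[OF g(1) q0(1)] by simp
qed

text \<open>The equality is checked one degree at a time: linearity of the ideal generated in degree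
  \<open>k\<close> makes \<open>kdm\<close> vanish there, this passes to \<open>J\<close>, and it
  decides the first Betti number in degree \<open>k + 1\<close>.\<close>

theorem (in gid) betti_1_of_componentwise_linear:
  assumes inf: "infinite (UNIV :: 'k set)" and cl: "componentwise_linear n J"
  shows "betti n (ext_carrier n) J 1 = betti n (ext_carrier n) (Gin n J) 1"
proof -
  obtain pJ g1 where pJ: "pJ \<in> polyfun n" "pJ g1 \<noteq> 0" "\<And>g. pJ g \<noteq> 0 \<Longrightarrow> generic n J g"
    using generic_open[OF inf] by blast
  have h: "hdm n J 0 1 d = hdm n (Gin n J) 0 1 d" for d
  proof (cases d)
    case 0
    interpret C: comparison n "ext_act n g1 ` J" "Gin n J" by (rule comparison_generic[OF inf pJ(3)[OF pJ(2)]])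
    show ?thesis using 0 hdm_low C.I.hdm_low by simp
  next
    case (Suc k)
    let ?L = "cid n J k"
    interpret L: gid n ?L by (rule cid_gid)
    obtain pL g2 where pL: "pL \<in> polyfun n" "pL g2 \<noteq> 0" "\<And>g. pL g \<noteq> 0 \<Longrightarrow> generic n ?L g"
      using L.generic_open[OF inf] by blast
    \<comment> \<open>Coordinates generic for \<open>J\<close> and for the component ideal at once.
      They may vary with \<open>k\<close>, since homology at level 0 does not depend on
      them.\<close>
    obtain g where g: "pJ g \<noteq> 0" "pL g \<noteq> 0" using polyfun_common[OF inf pJ(1,2) pL(1,2)] by blast
    interpret C: comparison n "ext_act n g ` J" "Gin n J" by (rule comparison_generic[OF inf pJ(3)[OF g(1)]])
    interpret M: lid n "ext_act n g ` ?L" by (rule L.generic_lid[OF pL(3)[OF g(2)]])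
    have lin: "hdm n ?L 0 (Suc i) (Suc i + c) = 0" if "k \<le> c" for i c
    proof (rule L.linear_imp_hdm[OF _ that])
      show "betti_gr n ?L {0} i (i + j) = 0" if "j \<noteq> k" for i j
        using cl that unfolding componentwise_linear_def comp_ideal_eq by blast
    qed
    have a: "M.alpha q k = 0" if "q < n" for q
      by (rule linear_generic_alpha[OF inf L.gid_axioms lin pL(1) g(2) pL(3) that])
    have "hdm n (ext_act n g ` ?L) 0 1 (Suc k) = 0"
      using hdm_0_ext_act[OF L.lid_axioms generic_inv[OF pL(3)[OF g(2)]]] lin[of k 0] by simp
    then have "(\<Sum>q<n. kdm n (ext_act n g ` ?L) q 1 k) = 0"
      unfolding M.hdm_1_sum using a by (simp add: sum_negf)
    then have kM: "kdm n (ext_act n g ` ?L) q 1 k = 0" if "q < n" for q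
      using M.kdm_nonneg that by (subst (asm) sum_nonneg_eq_0_iff) auto
    have hp: "hpart k (ext_act n g ` ?L) = hpart k (ext_act n g ` J)"
      unfolding hpart_ext_act[OF cid_gid] hpart_ext_act[OF gid_axioms] by (simp add: hpart_cid)
    have "kdm n (ext_act n g ` J) q 1 k = 0" if "q < n" for q
      using kdm_hpart_cong[OF hp M.lid_axioms C.J.lid_axioms] kM[OF that] by simp
    then have "hdm n (ext_act n g ` J) 0 1 (Suc k) = hdm n (Gin n J) 0 1 (Suc k)"
      using C.hdm_1_eq_iff by blast
    then show ?thesis
      unfolding Suc using hdm_0_ext_act[OF lid_axioms generic_inv[OF pJ(3)[OF g(1)]]] by simp
  qed
  interpret C: comparison n "ext_act n g1 ` J" "Gin n J" by (rule comparison_generic[OF inf pJ(3)[OF pJ(2)]])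
  have "int (betti n (ext_carrier n) J (Suc 0)) = int (betti n (ext_carrier n) (Gin n J) (Suc 0))"
    unfolding betti_eq C.I.betti_eq using h by simp
  then show ?thesis by simp
qed

theorem theorem4p7:
  fixes n :: nat and J :: "'k::field ext set"
  assumes "infinite (UNIV :: 'k set)"
    and "graded_ideal n J"
  shows "componentwise_linear n J \<longleftrightarrow>
    (\<exists>i\<ge>1. betti n (ext_carrier n) J i = betti n (ext_carrier n) (Gin n J) i)"
proof
  interpret gid n J by (rule gid_graded_ideal[OF assms(2)])
  show "\<exists>i\<ge>1. betti n (ext_carrier n) J i = betti n (ext_carrier n) (Gin n J) i"
    if "componentwise_linear n J"
    using betti_1_of_componentwise_linear[OF assms(1) that] by blast
  assume "\<exists>i\<ge>1. betti n (ext_carrier n) J i = betti n (ext_carrier n) (Gin n J) i"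
  then obtain i where "betti n (ext_carrier n) J (Suc i) = betti n (ext_carrier n) (Gin n J) (Suc i)"
    by (metis Suc_le_D One_nat_def)
  then show "componentwise_linear n J" by (rule componentwise_linear_of_betti[OF assms(1)])
qed

end
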